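(* For each $n\in\mathbb{N}$ let $I_n\subset\mathbb{N}^r$ be such that, as $n\to\infty$, $$\mathrm{Var}_{q_n}\!\left(\sum_{\mathbf{k}\in I_n}a(\mathbf{k})X_{\mathbf{k}}\right)=o\!\left(\sigma_n^2\right),$$ and let $\mathbf{X}_{I_n}:=(X_{\mathbf{k}})_{\mathbf{k}\in I_n}$. Then the probability measures $Q_{q_n}(\mathbf{X}_{I_n}^{-1})$ and $P_n(\mathbf{X}_{I_n}^{-1})$ on $\mathbb{N}_0^{d_n}$, $d_n:=|I_n|$ (i.e., the laws of $\mathbf{X}_{I_n}$ under $Q_{q_n}$ and under $P_n$), satisfy $$\lim_{n\to\infty}d_{\mathrm{TV}}\!\left(Q_{q_n}(\mathbf{X}_{I_n}^{-1}),\,P_n(\mathbf{X}_{I_n}^{-1})\right)=0.$$ Moreover, as $n\to\infty$, $$Q_{q_n}(\dim=n)\sim\frac{1}{\sqrt{2\pi\sigma_n^2}}.$$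
   Context: Throughout $r\ge 2$ is a fixed integer and $\mathbb{N}=\{1,2,\dots\}$, $\mathbb{N}_0=\mathbb{N}\cup\{0\}$. For $\mathbf{y}\in\mathbb{R}^r_{\ge0}$ put $$a(\mathbf{y}):=\frac{1}{c_r}\prod_{1\le\ell\le j\le r}(y_\ell+\dots+y_j),\qquad c_r:=r!\,(r-1)!\cdots1!.$$ Finite-dimensional irreducible representations $\rho_{\mathbf{k}}$ of $\mathfrak{sl}_{r+1}(\mathbb{C})$ are indexed (up to isomorphism) by $\mathbf{k}\in\mathbb{N}^r$, with $\dim\rho_{\mathbf{k}}=a(\mathbf{k})$. A finite-dimensional representation $\rho$ (up to isomorphism, including the zero-dimensional one) is $\rho=\bigoplus_{\mathbf{k}\in\mathbb{N}^r}\rho_{\mathbf{k}}^{X_{\mathbf{k}}(\rho)}$ with multiplicities $X_{\mathbf{k}}(\rho)\in\mathbb{N}_0$, all but finitely many zero, and $\dim\rho=\sum_{\mathbf{k}}a(\mathbf{k})X_{\mathbf{k}}(\rho)$. $P_n$ is the uniform probability measure on the (finite) set of $n$-dimensional representations up to isomorphism. For $q\in(0,1)$, the Boltzmann model is the probability measure on the set of all finite-dimensional representations up to isomorphism $$Q_q(\rho):=q^{\dim(\rho)}\prod_{\mathbf{k}\in\mathbb{N}^r}\left(1-q^{a(\mathbf{k})}\right);$$ $\mathrm{E}_q$ and $\mathrm{Var}_q$ are expectation and variance under $Q_q$. For $n\in\mathbb{N}$, $q_n\in(0,1)$ is the unique $q$ with $\mathrm{E}_q(\dim)=n$, i.e.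 $\sum_{\mathbf{k}}\frac{a(\mathbf{k})q^{a(\mathbf{k})}}{1-q^{a(\mathbf{k})}}=n$, and $\sigma_n^2:=\mathrm{Var}_{q_n}(\dim)=\sum_{\mathbf{k}\in\mathbb{N}^r}\frac{a(\mathbf{k})^2q_n^{a(\mathbf{k})}}{(1-q_n^{a(\mathbf{k})})^2}$. For probability measures $\mu_1,\mu_2$ on $\mathbb{N}_0^d$, $d\in\mathbb{N}\cup\{\infty\}$, with all subsets as events, where $\mathbb{N}_0^\infty$ denotes the set of sequences in $\mathbb{N}_0$ with all but finitely many entries zero, $d_{\mathrm{TV}}(\mu_1,\mu_2):=\sup_{B\subset\mathbb{N}_0^d}|\mu_1(B)-\mu_2(B)|$. *)

theory Defs
  imports "HOL-Probability.Probability" "HOL-Library.Landau_Symbols"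
begin

definition weights :: "nat \<Rightarrow> (nat \<Rightarrow> nat) set" where
  "weights r = {1..r} \<rightarrow>\<^sub>E {1..}"

definition cnorm :: "nat \<Rightarrow> nat" where
  "cnorm r = (\<Prod>i=1..r. fact i)"

definition adim :: "nat \<Rightarrow> (nat \<Rightarrow> real) \<Rightarrow> real" where
  "adim r y = 1 / real (cnorm r) * (\<Prod>j=1..r. \<Prod>l=1..j. \<Sum>i=l..j. y i)"

text \<open>
  The dimension of the irreducible representation with index \<open>k\<close>, kept as a real number so that
  no rounding is involved; accordingly \<open>q\<^bsup>a(k)\<^esup>\<close> below is written with \<open>powr\<close>.
\<close>
definition wdim :: "nat \<Rightarrow> (nat \<Rightarrow> nat) \<Rightarrow> real" where
  "wdim r k = adim r (\<lambda>i. real (k i))"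

text \<open>
  The space of finitely supported vectors of natural numbers indexed by \<open>I\<close>, each extended
  by zero to all of \<open>'k\<close>.  Indexing by \<open>I\<close> itself, instead of by an enumeration of \<open>I\<close>, covers
  finite and infinite \<open>I\<close> at once.
\<close>
definition mults :: "'k set \<Rightarrow> ('k \<Rightarrow> nat) set" where
  "mults I = {x. finite {k. x k \<noteq> 0} \<and> {k. x k \<noteq> 0} \<subseteq> I}"

text \<open>
  A finite-dimensional representation of \<open>sl\<^bsub>r+1\<^esub>(\<complex>)\<close> up to isomorphism is encoded by its
  multiplicities: \<open>\<rho> k\<close> is the multiplicity of the irreducible representation with index \<open>k\<close>,
  whose dimension is \<open>wdim r k\<close>.
\<close>
definition reps :: "nat \<Rightarrow> ((nat \<Rightarrow> nat) \<Rightarrow> nat) set" where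
  "reps r = mults (weights r)"

text \<open>
  The dimension of the part of \<open>\<rho>\<close> supported on \<open>I\<close>, i.e. the sum of \<open>a(k) X\<^sub>k\<close> over \<open>k \<in> I\<close>.
  Only the nonzero terms are summed, because \<open>sum\<close> vanishes on infinite index sets.
\<close>
definition pdim :: "nat \<Rightarrow> (nat \<Rightarrow> nat) set \<Rightarrow> ((nat \<Rightarrow> nat) \<Rightarrow> nat) \<Rightarrow> real" where
  "pdim r I \<rho> = (\<Sum>k\<in>{k\<in>I. \<rho> k \<noteq> 0}. wdim r k * real (\<rho> k))"

definition rdim :: "nat \<Rightarrow> ((nat \<Rightarrow> nat) \<Rightarrow> nat) \<Rightarrow> real" where
  "rdim r \<rho> = pdim r (weights r) \<rho>"

definition P :: "nat \<Rightarrow> nat \<Rightarrow> ((nat \<Rightarrow> nat) \<Rightarrow> nat) measure" where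
  "P r n = uniform_count_measure {\<rho> \<in> reps r. rdim r \<rho> = real n}"

text \<open>
  The infinite product over \<open>weights r\<close> of \<open>1 - q\<^bsup>a(k)\<^esup>\<close>, as the unordered limit of the finite
  partial products (the multiplicative analogue of \<open>infsum\<close>).
\<close>
definition Qconst :: "nat \<Rightarrow> real \<Rightarrow> real" where
  "Qconst r q = Lim (finite_subsets_at_top (weights r)) (\<lambda>F. \<Prod>k\<in>F. 1 - q powr wdim r k)"

definition Q :: "nat \<Rightarrow> real \<Rightarrow> ((nat \<Rightarrow> nat) \<Rightarrow> nat) measure" where
  "Q r q = point_measure (reps r) (\<lambda>\<rho>. ennreal (q powr rdim r \<rho> * Qconst r q))"

text \<open>
  The unique \<open>q\<close> with \<open>E\<^sub>q(dim) = n\<close>; meaningful for \<open>n \<ge> 1\<close> only.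
\<close>
definition qn :: "nat \<Rightarrow> nat \<Rightarrow> real" where
  "qn r n = (THE q. 0 < q \<and> q < 1 \<and> prob_space.expectation (Q r q) (rdim r) = real n)"

definition sigma2 :: "nat \<Rightarrow> nat \<Rightarrow> real" where
  "sigma2 r n = prob_space.variance (Q r (qn r n)) (rdim r)"

definition marginal :: "'k set \<Rightarrow> ('k \<Rightarrow> nat) \<Rightarrow> 'k \<Rightarrow> nat" where
  "marginal I \<rho> = (\<lambda>k. if k \<in> I then \<rho> k else 0)"

definition law :: "'k set \<Rightarrow> ('k \<Rightarrow> nat) measure \<Rightarrow> ('k \<Rightarrow> nat) measure" where
  "law I M = distr M (count_space (mults I)) (marginal I)"

definition dTV :: "'k set \<Rightarrow> ('k \<Rightarrow> nat) measure \<Rightarrow> ('k \<Rightarrow> nat) measure \<Rightarrow> real" where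
  "dTV I \<mu> \<nu> = (SUP B\<in>Pow (mults I). \<bar>measure \<mu> B - measure \<nu> B\<bar>)"

end

theory Submission
  imports Defs
begin

text \<open>
  Under the Boltzmann measure the multiplicities \<open>X\<^sub>k\<close> are independent and geometric with ratio
  \<open>q\<^bsup>a(k)\<^esup>\<close>, and the weight \<open>q\<^bsup>dim\<^esup>\<close> is constant on the representations of dimension \<open>n\<close>, so
  that \<open>P\<^sub>n\<close> is the Boltzmann measure conditioned on \<open>dim = n\<close>.  Write \<open>dim = D\<^sub>I + D'\<close>, where \<open>D\<^sub>I\<close>
  collects the indices in \<open>I\<close>.  Since \<open>D\<^sub>I\<close> and \<open>D'\<close> are independent, the density of the conditioned
  law of \<open>X\<^sub>I\<close> relative to the unconditioned one is, at a vector of dimension \<open>j\<close>, the ratio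
  \<open>Q(D' = n - j) / Q(dim = n)\<close>.  A local limit theorem for \<open>dim\<close> and for \<open>D'\<close> shows that this ratio is
  close to one whenever \<open>j\<close> is within a small multiple of \<open>\<sigma>\<^sub>n\<close> of the mean of \<open>D\<^sub>I\<close>: removing \<open>I\<close>
  hardly changes the variance.  Chebyshev's inequality, with the hypothesis on the variance of
  \<open>D\<^sub>I\<close>, makes all other \<open>j\<close> negligible (\<open>dTV_law_le\<close>).  The second claim is the local limit theorem
  for \<open>dim\<close> itself, at its mean \<open>n\<close>.

  The local limit theorem has to be uniform in the set of indices, and this is where the shape of
  \<open>a\<close> matters.  Let \<open>R = r (r + 1) / 2\<close> be the degree of \<open>a\<close> and put \<open>q = exp (- 1 / K\<^sup>R)\<close>, so that \<open>K\<close>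
  is the typical size of the coordinates of the indices that count.  Three facts are needed.

  \<^item> The dimension \<open>a(k)\<close> is an integer (\<open>wdim_Ints\<close>), so that probabilities are Fourier
    coefficients on \<open>[-\<pi>, \<pi>]\<close>.

  \<^item> The cumulants have their natural size: the \<open>j\<close>-th one is at most of order \<open>K\<^bsup>jR + r\<^esup>\<close> for \<open>j\<close> up
    to \<open>3\<close>.  This reduces to summing \<open>min 1 (K\<^sup>R / a(k))\<close> over all indices (\<open>sum_min_wdim_le\<close>).  The
    region \<open>a(y) \<le> 1\<close> of positive vectors is unbounded, with cusps along the coordinate axes; the sum
    is controlled by a lower bound for \<open>a\<close> by monomials whose exponents depend on which coordinates are large (\<open>ln_tailprod_ge\<close>).

  \<^item> For every frequency \<open>t\<close> with \<open>c / K\<^sup>R \<le> |t| \<le> \<pi>\<close>, a positive proportion of the about \<open>K\<^sup>r\<close> indices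
    in a box of side about \<open>K\<close> has \<open>|sin (a(k) t / 2)|\<close> bounded below (\<open>card_good_weights_ge\<close>).  The
    reason is that an iterated difference of \<open>a\<close> with step \<open>h\<close> is exactly \<open>h\<^sup>R\<close>, at every point: with
    \<open>h\<^sup>R\<close> of order \<open>1 / |t|\<close> the values of \<open>a(k) t / 2\<close> on a grid cannot all be near multiples of \<open>\<pi>\<close>.
    As every index of the box contributes about equally to the variance, a set carrying a small
    part of the variance can remove only few of the good indices, so the characteristic function
    of \<open>D'\<close> is in modulus at most \<open>exp (- c K\<^sup>r)\<close> at these frequencies.

  For smaller \<open>|t|\<close> the logarithm of the characteristic function is compared with its quadratic
  Taylor polynomial (\<open>local_limit_finite\<close>).  The total error is of order \<open>K\<^bsup>- R - r\<^esup>\<close>, while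
  \<open>1 / \<sigma>\<^sub>n\<close> is of order \<open>K\<^bsup>- R - r/2\<^esup>\<close>.  All analysis is done for finite sets of indices and carried
  to infinite ones by a limit, which keeps infinite products of characteristic functions out of
  the argument.
\<close>

section \<open>Finite differences\<close>

definition fwd_diff :: "real \<Rightarrow> (real \<Rightarrow> real) \<Rightarrow> real \<Rightarrow> real" where
  "fwd_diff h g x = g (x + h) - g x"

text \<open>
  The Leibniz rule for a linear factor, whose second difference vanishes.  It lets products of linear
  factors be differenced one factor at a time, without expanding the polynomial.
\<close>

lemma fwd_diff_pow_mult_linear:
  "(fwd_diff h ^^ n) (\<lambda>x. (s * x + b) * f x) =
     (\<lambda>x. (s * (x + real n * h) + b) * (fwd_diff h ^^ n) f x + real n * s * h * (fwd_diff h ^^ (n - 1)) f x)"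
proof (induction n)
  case 0
  then show ?case by simp
next
  case (Suc n)
  show ?case
  proof (cases n)
    case 0
    then show ?thesis by (auto simp: fwd_diff_def fun_eq_iff algebra_simps)
  next
    case (Suc m)
    define u where "u = (fwd_diff h ^^ n) f"
    define w where "w = (fwd_diff h ^^ m) f"
    have uw: "u = fwd_diff h w" by (simp add: u_def w_def Suc)
    have "(fwd_diff h ^^ Suc n) (\<lambda>x. (s * x + b) * f x) =
        fwd_diff h (\<lambda>x. (s * (x + real n * h) + b) * u x + real n * s * h * w x)"
      unfolding u_def w_def funpow.simps o_apply Suc.IH by (simp add: Suc)
    also have "\<dots> = (\<lambda>x. (s * (x + real (Suc n) * h) + b) * fwd_diff h u x + real (Suc n) * s * h * u x)"
      unfolding uw by (auto simp: fwd_diff_def fun_eq_iff algebra_simps)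
    finally show ?thesis by (simp add: u_def)
  qed
qed

lemma fwd_diff_pow_const_mult: "(fwd_diff h ^^ n) (\<lambda>x. c * f x) = (\<lambda>x. c * (fwd_diff h ^^ n) f x)"
  by (induction n) (auto simp: fwd_diff_def fun_eq_iff algebra_simps)


text \<open>
  Only the factors that depend on \<open>x\<close> count towards the degree, so one more difference than their
  number annihilates the product.
\<close>

lemma fwd_diff_pow_prod_linear:
  assumes "finite S"
  shows "(fwd_diff h ^^ Suc (card {p \<in> S. s p \<noteq> 0})) (\<lambda>x. \<Prod>p\<in>S. s p * x + b p) = (\<lambda>x. 0)"
  using assms
proof (induction S rule: finite_induct)
  case empty
  then show ?case by (simp add: fwd_diff_def fun_eq_iff)
next
  case (insert q S)
  show ?case
  proof (cases "s q = 0")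
    case True
    then have "{p \<in> insert q S. s p \<noteq> 0} = {p \<in> S. s p \<noteq> 0}" by auto
    then show ?thesis using insert True by (simp add: fwd_diff_pow_const_mult del: funpow.simps)
  next
    case False
    then have "{p \<in> insert q S. s p \<noteq> 0} = insert q {p \<in> S. s p \<noteq> 0}" by auto
    then have c: "card {p \<in> insert q S. s p \<noteq> 0} = Suc (card {p \<in> S. s p \<noteq> 0})"
      using insert by simp
    let ?c = "card {p \<in> S. s p \<noteq> 0}"
    let ?f = "\<lambda>x. \<Prod>p\<in>S. s p * x + b p"
    have z: "(fwd_diff h ^^ Suc ?c) ?f = (\<lambda>x. 0)" by (rule insert.IH)
    have z2: "(fwd_diff h ^^ Suc (Suc ?c)) ?f = (\<lambda>x. 0)"
      by (subst funpow.simps) (simp only: o_apply z, simp add: fwd_diff_def fun_eq_iff)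
    have "(fwd_diff h ^^ Suc (Suc ?c)) (\<lambda>x. (s q * x + b q) * ?f x) = (\<lambda>x. 0)"
      unfolding fwd_diff_pow_mult_linear z2 by (simp only: diff_Suc_1 z) simp
    then show ?thesis
      unfolding c using insert.hyps by (simp only: prod.insert[OF insert.hyps] not_False_eq_True)
  qed
qed

lemma fwd_diff_pow_prod_monic:
  assumes "finite S"
  shows "(fwd_diff h ^^ card S) (\<lambda>x. \<Prod>p\<in>S. x + b p) = (\<lambda>x. fact (card S) * h ^ card S)"
  using assms
proof (induction S rule: finite_induct)
  case empty
  then show ?case by simp
next
  case (insert q S)
  let ?f = "\<lambda>x. \<Prod>p\<in>S. x + b p"
  have z: "(fwd_diff h ^^ Suc (card S)) ?f = (\<lambda>x. 0)"
    by (subst funpow.simps) (simp only: o_apply insert.IH, simp add: fwd_diff_def fun_eq_iff)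
  have "(fwd_diff h ^^ Suc (card S)) (\<lambda>x. (1 * x + b q) * ?f x) = (\<lambda>x. fact (Suc (card S)) * h ^ Suc (card S))"
    unfolding fwd_diff_pow_mult_linear z by (simp only: diff_Suc_1 insert.IH) (simp add: algebra_simps)
  then show ?case using insert by (simp del: funpow.simps)
qed

text \<open>
  A polynomial of degree at most \<open>n\<close> with integral values at \<open>0, \<dots>, n\<close> is integer-valued: by
  induction its first difference is, and the values are recovered by summation.
\<close>

lemma Ints_on_nat_of_fwd_diff:
  assumes "(fwd_diff 1 ^^ Suc n) f = (\<lambda>x. 0)" "\<And>i. i \<le> n \<Longrightarrow> f (real i) \<in> \<int>"
  shows "f (real m) \<in> \<int>"
  using assms
proof (induction n arbitrary: f m)
  case 0
  have "f (x + 1) = f x" for x using 0(1) by (auto simp: fwd_diff_def fun_eq_iff)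
  then have "f (real m) = f 0" 
  proof (induction m)
    case (Suc m)
    then show ?case using \<open>f (real m + 1) = f (real m)\<close> by (simp add: add.commute)
  qed simp
  then show ?case using 0(2)[of 0] by simp
next
  case (Suc n)
  have *: "(fwd_diff 1 ^^ Suc n) (fwd_diff 1 f) = (\<lambda>x. 0)"
    using Suc.prems(1) by (simp only: funpow_Suc_right o_apply)
  have "fwd_diff 1 f (real i) \<in> \<int>" if "i \<le> n" for i
    using Suc.prems(2)[of i] Suc.prems(2)[of "Suc i"] that
    by (auto simp: fwd_diff_def add.commute)
  from Suc.IH[OF * this] have d: "fwd_diff 1 f (real i) \<in> \<int>" for i by simp
  show ?case
  proof (induction m)
    case 0
    then show ?case using Suc.prems(2)[of 0] by simp
  next
    case (Suc m)
    have "f (real (Suc m)) = f (real m) + fwd_diff 1 f (real m)" by (simp add: fwd_diff_def add.commute)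
    then show ?case using Suc d by simp
  qed
qed

section \<open>Integrality of the dimension\<close>

definition index_pairs :: "nat \<Rightarrow> (nat \<times> nat) set" where
  "index_pairs r = {(l, j). l < j \<and> j \<le> r}"

lemma finite_index_pairs [simp]: "finite (index_pairs r)"
  by (rule finite_subset[of _ "{..r} \<times> {..r}"]) (auto simp: index_pairs_def)

lemma prod_index_pairs: "(\<Prod>p\<in>index_pairs r. g (fst p) (snd p)) = (\<Prod>j=1..r. \<Prod>l<j. g l j)"
proof -
  have "(\<Prod>j=1..r. \<Prod>l<j. g l j) = (\<Prod>p\<in>Sigma {1..r} (\<lambda>j. {..<j}). g (snd p) (fst p))"
    by (simp add: prod.Sigma case_prod_unfold)
  also have "\<dots> = (\<Prod>p\<in>index_pairs r. g (fst p) (snd p))"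
    by (rule prod.reindex_bij_witness[of _ prod.swap prod.swap]) (auto simp: index_pairs_def)
  finally show ?thesis by simp
qed

lemma prod_diff_fact: "(\<Prod>l<j. real j - real l) = fact j"
proof -
  have "(\<Prod>l<j. real j - real l) = (\<Prod>i=1..j. real i)"
    by (rule prod.reindex_bij_witness[of _ "\<lambda>i. j - i" "\<lambda>l. j - l"]) (auto simp: of_nat_diff)
  then show ?thesis by (simp add: fact_prod)
qed

lemma cnorm_eq_vandermonde: "real (cnorm r) = (\<Prod>p\<in>index_pairs r. real (snd p) - real (fst p))"
  by (simp add: prod_index_pairs[of "\<lambda>l j. real j - real l"] prod_diff_fact cnorm_def)

lemma cnorm_pos: "cnorm r > 0"
  by (simp add: cnorm_def)

text \<open>
  The square is a product over all ordered pairs of distinct indices, a set that the permutation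
  maps to itself.
\<close>

lemma vandermonde_permutation_square:
  fixes x :: "nat \<Rightarrow> nat"
  assumes "bij_betw x {..r} {..r}"
  shows "(\<Prod>p\<in>index_pairs r. real (x (snd p)) - real (x (fst p)))\<^sup>2 = (real (cnorm r))\<^sup>2"
proof -
  define T where "T = {(l, j). l \<le> r \<and> j \<le> r \<and> l \<noteq> j}"
  have T: "T = index_pairs r \<union> prod.swap ` index_pairs r"
    by (auto simp: T_def index_pairs_def image_iff)
  have sq: "(\<Prod>p\<in>T. \<bar>g (snd p) - g (fst p)\<bar>) = (\<Prod>p\<in>index_pairs r. g (snd p) - g (fst p))\<^sup>2"
    for g :: "nat \<Rightarrow> real"
  proof -
    have dis: "index_pairs r \<inter> prod.swap ` index_pairs r = {}"
      by (auto simp: index_pairs_def)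
    have "(\<Prod>p\<in>T. \<bar>g (snd p) - g (fst p)\<bar>) = (\<Prod>p\<in>index_pairs r. \<bar>g (snd p) - g (fst p)\<bar>) *
        (\<Prod>p\<in>prod.swap ` index_pairs r. \<bar>g (snd p) - g (fst p)\<bar>)"
      unfolding T using dis by (intro prod.union_disjoint) simp_all
    also have "(\<Prod>p\<in>prod.swap ` index_pairs r. \<bar>g (snd p) - g (fst p)\<bar>) = (\<Prod>p\<in>index_pairs r. \<bar>g (snd p) - g (fst p)\<bar>)"
      by (subst prod.reindex) (auto simp: inj_on_def abs_minus_commute)
    finally show ?thesis
      by (simp add: power2_eq_square flip: abs_prod)
  qed
  have xr: "x i \<le> r" if "i \<le> r" for i
    using bij_betwE[OF assms] that by auto
  have bij: "bij_betw (map_prod x x) T T"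
  proof (rule bij_betwI')
    show "map_prod x x a = map_prod x x b \<longleftrightarrow> a = b" if "a \<in> T" "b \<in> T" for a b
      using assms that by (auto simp: T_def bij_betw_def inj_on_def)
    show "map_prod x x a \<in> T" if "a \<in> T" for a
      using assms that xr by (auto simp: T_def bij_betw_def inj_on_def)
    show "\<exists>a\<in>T. b = map_prod x x a" if b: "b \<in> T" for b
    proof -
      obtain l j where lj: "b = (l, j)" "l \<le> r" "j \<le> r" "l \<noteq> j" using b by (auto simp: T_def)
      then obtain l' j' where "l = x l'" "j = x j'" "l' \<le> r" "j' \<le> r"
        using assms unfolding bij_betw_def by (metis atMost_iff imageE)
      then show ?thesis using lj by (intro bexI[of _ "(l', j')"]) (auto simp: T_def)
    qed
  qed
  have "(\<Prod>p\<in>T. \<bar>real (x (snd p)) - real (x (fst p))\<bar>) = (\<Prod>p\<in>T. \<bar>real (snd p) - real (fst p)\<bar>)"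
    using prod.reindex_bij_betw[OF bij, of "\<lambda>p. \<bar>real (snd p) - real (fst p)\<bar>"] by simp
  then show ?thesis
    using sq[of "\<lambda>i. real (x i)"] sq[of real] by (simp add: cnorm_eq_vandermonde)
qed

text \<open>
  If all nodes lie in \<open>{0..r}\<close>, then either two of them coincide or they form a permutation, and the
  quotient is \<open>0\<close> or \<open>\<plusminus>1\<close>.  As a function of one node it is a polynomial of degree at most \<open>r\<close>, so
  integrality extends from \<open>{0..r}\<close> to all naturals, one node after the other.
\<close>

lemma superfactorial_dvd_vandermonde:
  fixes x :: "nat \<Rightarrow> nat"
  shows "(\<Prod>p\<in>index_pairs r. real (x (snd p)) - real (x (fst p))) / real (cnorm r) \<in> \<int>"
proof -
  define V where "V x = (\<Prod>p\<in>index_pairs r. x (snd p) - x (fst p)) / real (cnorm r)" for x :: "nat \<Rightarrow> real"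
  have "\<forall>x :: nat \<Rightarrow> nat. (\<forall>i. m \<le> i \<and> i \<le> r \<longrightarrow> x i \<le> r) \<longrightarrow> V (\<lambda>i. real (x i)) \<in> \<int>" if "m \<le> Suc r" for m
    using that
  proof (induction m)
    case 0
    show ?case
    proof (intro allI impI)
      fix x :: "nat \<Rightarrow> nat" assume x: "\<forall>i. 0 \<le> i \<and> i \<le> r \<longrightarrow> x i \<le> r"
      show "V (\<lambda>i. real (x i)) \<in> \<int>"
      proof (cases "inj_on x {..r}")
        case True
        then have "bij_betw x {..r} {..r}"
          using x by (simp add: bij_betw_def endo_inj_surj image_subset_iff)
        from vandermonde_permutation_square[OF this] have "(V (\<lambda>i. real (x i)))\<^sup>2 = 1"
          using cnorm_pos[of r] by (simp add: V_def power_divide)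
        then show ?thesis by (auto simp: power2_eq_1_iff)
      next
        case False
        then obtain i j where "i \<le> r" "j \<le> r" "i < j" "x i = x j"
          unfolding inj_on_def by (metis atMost_iff linorder_neqE_nat)
        then have "(i, j) \<in> index_pairs r \<and> real (x (snd (i, j))) - real (x (fst (i, j))) = 0"
          by (simp add: index_pairs_def)
        then have "(\<Prod>p\<in>index_pairs r. real (x (snd p)) - real (x (fst p))) = 0"
          using finite_index_pairs by (meson prod_zero)
        then have "V (\<lambda>i. real (x i)) = 0" unfolding V_def by (simp only: div_0)
        then show ?thesis by simp
      qed
    qed
  next
    case (Suc m)
    then have m: "m \<le> r" by simp
    show ?case
    proof (intro allI impI)
      fix x :: "nat \<Rightarrow> nat" assume x: "\<forall>i. Suc m \<le> i \<and> i \<le> r \<longrightarrow> x i \<le> r"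
      define f where "f t = V ((\<lambda>i. real (x i))(m := t))" for t
      define s where "s p = (if snd p = m then 1 else if fst p = m then -1 else 0 :: real)" for p :: "nat \<times> nat"
      define b where "b p = (if snd p = m then - real (x (fst p)) else if fst p = m then real (x (snd p)) else real (x (snd p)) - real (x (fst p)))" for p :: "nat \<times> nat"
      have f: "f = (\<lambda>t. (1 / real (cnorm r)) * (\<Prod>p\<in>index_pairs r. s p * t + b p))"
      proof
        fix t
        have "(\<Prod>p\<in>index_pairs r. ((\<lambda>i. real (x i))(m := t)) (snd p) - ((\<lambda>i. real (x i))(m := t)) (fst p)) =
            (\<Prod>p\<in>index_pairs r. s p * t + b p)"
          by (intro prod.cong refl) (auto simp: s_def b_def index_pairs_def)
        then show "f t = (1 / real (cnorm r)) * (\<Prod>p\<in>index_pairs r. s p * t + b p)"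
          unfolding f_def V_def by (simp only: times_divide_eq_left mult_1)
      qed
      have "{p \<in> index_pairs r. s p \<noteq> 0} = (\<lambda>i. if i < m then (i, m) else (m, i)) ` ({..r} - {m})"
        using m by (auto simp: s_def index_pairs_def image_iff split: if_splits)
      moreover have "inj_on (\<lambda>i. if i < m then (i, m) else (m, i)) ({..r} - {m})"
        by (auto simp: inj_on_def split: if_splits)
      ultimately have "card {p \<in> index_pairs r. s p \<noteq> 0} = r"
        using m by (simp only: card_image) simp
      then have z: "(fwd_diff 1 ^^ Suc r) f = (\<lambda>x. 0)"
        unfolding f fwd_diff_pow_const_mult using fwd_diff_pow_prod_linear[where S = "index_pairs r" and h = 1 and s = s and b = b]
        by (simp del: funpow.simps)
      have i: "f (real i) \<in> \<int>" if "i \<le> r" for i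
      proof -
        have "V (\<lambda>j. real ((x(m := i)) j)) \<in> \<int>"
          using Suc.IH x that m by (auto simp: less_Suc_eq_le[symmetric] le_Suc_eq not_less_eq_eq)
        moreover have "(\<lambda>j. real ((x(m := i)) j)) = (\<lambda>i. real (x i))(m := real i)" by auto
        ultimately show ?thesis by (simp add: f_def)
      qed
      have "f (real (x m)) \<in> \<int>" by (rule Ints_on_nat_of_fwd_diff[OF z i])
      then show "V (\<lambda>i. real (x i)) \<in> \<int>" by (simp add: f_def fun_upd_idem)
    qed
  qed
  from this[of "Suc r"] show ?thesis by (simp add: V_def)
qed

text \<open>
  The part of the Weyl product that involves only the coordinates from \<open>i\<close> on; for \<open>i = 1\<close> it is the
  whole product.  Cutting off the first coordinates one by one drives the inductions below.
\<close>

definition tailprod :: "nat \<Rightarrow> nat \<Rightarrow> (nat \<Rightarrow> real) \<Rightarrow> real" where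
  "tailprod r i y = (\<Prod>j=i..r. \<Prod>l=i..j. \<Sum>m=l..j. y m)"

lemma adim_eq_tailprod: "adim r y = tailprod r 1 y / real (cnorm r)"
  by (simp add: adim_def tailprod_def)

text \<open>
  In terms of the partial sums of \<open>k\<close> the Weyl product is a Vandermonde product.
\<close>

lemma wdim_Ints: "wdim r k \<in> \<int>"
proof -
  define x where "x j = (\<Sum>i=1..j. k i)" for j
  have "(\<Prod>j=1..r. \<Prod>l=1..j. \<Sum>i=l..j. real (k i)) = (\<Prod>j=1..r. \<Prod>l<j. real (x j) - real (x l))"
  proof (rule prod.cong[OF refl])
    fix j
    show "(\<Prod>l=1..j. \<Sum>i=l..j. real (k i)) = (\<Prod>l<j. real (x j) - real (x l))"
    proof (rule prod.reindex_bij_witness[of _ Suc "\<lambda>l. l - 1"])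
      fix l assume l: "l \<in> {1..j}"
      then have "{1..j} = {1..l-1} \<union> {l..j}" by auto
      then have "x j = x (l - 1) + (\<Sum>i=l..j. k i)"
        unfolding x_def using l by (subst sum.union_disjoint[symmetric]) auto
      then show "real (x j) - real (x (l - 1)) = (\<Sum>i=l..j. real (k i))" by simp
    qed auto
  qed
  also have "\<dots> = (\<Prod>p\<in>index_pairs r. real (x (snd p)) - real (x (fst p)))"
    by (simp add: prod_index_pairs[of "\<lambda>l j. real (x j) - real (x l)"])
  finally show ?thesis
    using superfactorial_dvd_vandermonde[of x r] by (simp add: wdim_def adim_def)
qed

section \<open>Oscillation forced by iterated differences\<close>

text \<open>
  An \<open>n\<close>-fold difference is a signed sum of \<open>2\<^sup>n\<close> values and \<open>|sin|\<close> is subadditive, so one of the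
  values has at least the \<open>2\<^sup>n\<close>-th part of the sine.
\<close>

lemma exists_sin_ge_of_fwd_diff:
  "\<exists>s\<le>n. \<bar>sin (\<theta> * (fwd_diff h ^^ n) g x)\<bar> / 2 ^ n \<le> \<bar>sin (\<theta> * g (x + real s * h))\<bar>"
proof (induction n arbitrary: g)
  case 0
  then show ?case by simp
next
  case (Suc n)
  obtain s where s: "s \<le> n" "\<bar>sin (\<theta> * (fwd_diff h ^^ n) (fwd_diff h g) x)\<bar> / 2 ^ n \<le> \<bar>sin (\<theta> * fwd_diff h g (x + real s * h))\<bar>"
    using Suc by blast
  let ?A = "\<theta> * g (x + real (Suc s) * h)" and ?B = "\<theta> * g (x + real s * h)"
  have e: "\<theta> * fwd_diff h g (x + real s * h) = ?A - ?B"
    by (simp add: fwd_diff_def algebra_simps)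
  have "\<bar>sin (?A - ?B)\<bar> \<le> \<bar>sin ?A * cos ?B\<bar> + \<bar>cos ?A * sin ?B\<bar>"
    unfolding sin_diff by (rule abs_triangle_ineq4)
  also have "\<dots> \<le> \<bar>sin ?A\<bar> + \<bar>sin ?B\<bar>"
    unfolding abs_mult by (intro add_mono mult_left_le mult_left_le_one_le) auto
  finally have "\<bar>sin (\<theta> * (fwd_diff h ^^ n) (fwd_diff h g) x)\<bar> / 2 ^ n \<le> \<bar>sin ?A\<bar> + \<bar>sin ?B\<bar>"
    using s(2) unfolding e by linarith
  then have "\<bar>sin (\<theta> * (fwd_diff h ^^ Suc n) g x)\<bar> / 2 ^ Suc n \<le> (\<bar>sin ?A\<bar> + \<bar>sin ?B\<bar>) / 2"
    by (simp only: funpow_Suc_right o_apply) (simp add: field_simps)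
  then have "\<bar>sin (\<theta> * (fwd_diff h ^^ Suc n) g x)\<bar> / 2 ^ Suc n \<le> \<bar>sin ?A\<bar> \<or>
        \<bar>sin (\<theta> * (fwd_diff h ^^ Suc n) g x)\<bar> / 2 ^ Suc n \<le> \<bar>sin ?B\<bar>"
  proof -
    have "L \<le> a \<or> L \<le> b" if "L \<le> (a + b) / 2" for L a b :: real
      using that by (cases "a \<le> b") auto
    then show ?thesis using \<open>_ \<le> (\<bar>sin ?A\<bar> + \<bar>sin ?B\<bar>) / 2\<close> by blast
  qed
  then show ?case
    using s(1) by (metis Suc_le_mono le_SucI)
qed

text \<open>
  Exactly the sums starting at \<open>i\<close> contain \<open>y\<^sub>i\<close>, each with coefficient one.  Hence the product is, up to
  a factor free of \<open>y\<^sub>i\<close>, monic in \<open>y\<^sub>i\<close> of degree equal to their number, and its top difference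
  is constant.
\<close>

lemma tailprod_fwd_diff:
  assumes "1 \<le> i" "i \<le> r"
  shows "(fwd_diff h ^^ (Suc r - i)) (\<lambda>t. tailprod r i (y(i := t))) =
    (\<lambda>t. fact (Suc r - i) * h ^ (Suc r - i) * tailprod r (Suc i) y)"
proof -
  have e: "tailprod r i (y(i := t)) = tailprod r (Suc i) y * (\<Prod>j\<in>{i..r}. t + (\<Sum>m=Suc i..j. y m))" for t
  proof -
    have in1: "(\<Prod>l=i..j. \<Sum>m=l..j. (y(i := t)) m) =
        (t + (\<Sum>m=Suc i..j. y m)) * (\<Prod>l=Suc i..j. \<Sum>m=l..j. y m)" if "j \<in> {i..r}" for j
    proof -
      have a: "{i..j} = insert i {Suc i..j}" using that by auto
      have "(\<Sum>m=i..j. (y(i := t)) m) = t + (\<Sum>m=Suc i..j. y m)"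
        unfolding a by (subst sum.insert) (auto intro!: sum.cong)
      moreover have "(\<Prod>l=Suc i..j. \<Sum>m=l..j. (y(i := t)) m) = (\<Prod>l=Suc i..j. \<Sum>m=l..j. y m)"
        by (intro prod.cong sum.cong) auto
      ultimately show ?thesis by (subst a, subst prod.insert) auto
    qed
    have "tailprod r i (y(i := t)) = (\<Prod>j=i..r. (t + (\<Sum>m=Suc i..j. y m)) * (\<Prod>l=Suc i..j. \<Sum>m=l..j. y m))"
      unfolding tailprod_def by (rule prod.cong[OF refl in1])
    also have "\<dots> = (\<Prod>j\<in>{i..r}. t + (\<Sum>m=Suc i..j. y m)) * (\<Prod>j=i..r. \<Prod>l=Suc i..j. \<Sum>m=l..j. y m)"
      by (rule prod.distrib)
    also have "(\<Prod>j=i..r. \<Prod>l=Suc i..j. \<Sum>m=l..j. y m) = tailprod r (Suc i) y"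
      unfolding tailprod_def using assms by (subst prod.atLeast_Suc_atMost) auto
    finally show ?thesis by (simp only: mult.commute)
  qed
  show ?thesis
    unfolding e fwd_diff_pow_const_mult
    using fwd_diff_pow_prod_monic[of "{i..r}" h "\<lambda>j. \<Sum>m=Suc i..j. y m"] by (auto simp: fun_eq_iff)
qed

text \<open>
  Differencing \<open>d, d - 1, \<dots>, 1\<close> times in the last \<open>d\<close> coordinates turns the normalised product into the
  constant \<open>h\<^bsup>1 + \<dots> + d\<^esup>\<close>: the factorials produced are those in the normalisation.  So at every base point
  \<open>y\<close> a bounded shift by multiples of \<open>h\<close> makes the sine large.
\<close>

lemma exists_shift_sin_ge:
  assumes "d \<le> r"
  shows "\<exists>s :: nat \<Rightarrow> nat. (\<forall>j. s j \<le> r) \<and>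
     \<bar>sin (\<theta> * h ^ (\<Sum>{1..d}))\<bar> / 2 ^ (\<Sum>{1..d})
       \<le> \<bar>sin (\<theta> * (tailprod r (Suc r - d) (\<lambda>j. y j + real (s j) * h) / real (cnorm d)))\<bar>"
  using assms
proof (induction d arbitrary: \<theta>)
  case 0
  have "tailprod r (Suc r) (\<lambda>j. y j + 0 * h) / real (cnorm 0) = 1"
    by (simp add: tailprod_def cnorm_def)
  then show ?case by (intro exI[of _ "\<lambda>_. 0"]) simp
next
  case (Suc d)
  define i where "i = r - d"
  have i: "1 \<le> i" "i \<le> r" "Suc r - Suc d = i" "Suc r - d = Suc i" "Suc r - i = Suc d"
    using Suc.prems by (auto simp: i_def)
  obtain s where s: "\<forall>j. s j \<le> r" and
    s2: "\<bar>sin ((\<theta> * h ^ Suc d) * h ^ (\<Sum>{1..d}))\<bar> / 2 ^ (\<Sum>{1..d})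
       \<le> \<bar>sin ((\<theta> * h ^ Suc d) * (tailprod r (Suc i) (\<lambda>j. y j + real (s j) * h) / real (cnorm d)))\<bar>"
    using Suc.IH[of "\<theta> * h ^ Suc d"] Suc.prems unfolding i by auto
  let ?y = "\<lambda>j. y j + real (s j) * h"
  define g where "g t = (1 / real (cnorm (Suc d))) * tailprod r i (?y(i := t))" for t
  have cn: "real (cnorm (Suc d)) = fact (Suc d) * real (cnorm d)"
    by (simp add: cnorm_def algebra_simps)
  have "(fwd_diff h ^^ Suc d) g (y i) = (1 / real (cnorm (Suc d))) * (fact (Suc d) * h ^ Suc d * tailprod r (Suc i) ?y)"
    unfolding g_def fwd_diff_pow_const_mult using tailprod_fwd_diff[OF i(1,2), of h ?y] unfolding i(5)
    by (simp only:)
  also have "\<dots> = h ^ Suc d * (tailprod r (Suc i) ?y / real (cnorm d))"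
    unfolding cn using cnorm_pos[of d] by (simp add: field_simps del: fact_Suc)
  finally have fdg: "(fwd_diff h ^^ Suc d) g (y i) = h ^ Suc d * (tailprod r (Suc i) ?y / real (cnorm d))" .
  obtain u where u: "u \<le> Suc d"
    "\<bar>sin (\<theta> * (fwd_diff h ^^ Suc d) g (y i))\<bar> / 2 ^ Suc d \<le> \<bar>sin (\<theta> * g (y i + real u * h))\<bar>"
    using exists_sin_ge_of_fwd_diff by blast
  have "?y(i := y i + real u * h) = (\<lambda>j. y j + real ((s(i := u)) j) * h)" by auto
  then have gu: "g (y i + real u * h) = tailprod r i (\<lambda>j. y j + real ((s(i := u)) j) * h) / real (cnorm (Suc d))"
    by (simp add: g_def)
  have su: "\<Sum>{1..Suc d} = \<Sum>{1..d} + Suc d" by simp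
  have "\<bar>sin (\<theta> * h ^ (\<Sum>{1..Suc d}))\<bar> / 2 ^ (\<Sum>{1..Suc d}) =
      (\<bar>sin ((\<theta> * h ^ Suc d) * h ^ (\<Sum>{1..d}))\<bar> / 2 ^ (\<Sum>{1..d})) / 2 ^ Suc d"
    unfolding su power_add by (simp add: ac_simps)
  also have "\<dots> \<le> \<bar>sin ((\<theta> * h ^ Suc d) * (tailprod r (Suc i) ?y / real (cnorm d)))\<bar> / 2 ^ Suc d"
    by (rule divide_right_mono[OF s2]) simp
  also have "\<dots> = \<bar>sin (\<theta> * (fwd_diff h ^^ Suc d) g (y i))\<bar> / 2 ^ Suc d"
    unfolding fdg by (simp add: ac_simps)
  also have "\<dots> \<le> \<bar>sin (\<theta> * g (y i + real u * h))\<bar>" by (rule u(2))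
  finally have "\<bar>sin (\<theta> * h ^ (\<Sum>{1..Suc d}))\<bar> / 2 ^ (\<Sum>{1..Suc d}) \<le>
    \<bar>sin (\<theta> * (tailprod r i (\<lambda>j. y j + real ((s(i := u)) j) * h) / real (cnorm (Suc d))))\<bar>"
    unfolding gu .
  moreover have "\<forall>j. (s(i := u)) j \<le> r" using s u(1) Suc.prems by auto
  ultimately show ?case unfolding i(3) by blast
qed

section \<open>Summation over all weights\<close>

text \<open>
  The degree \<open>r (r + 1) / 2\<close> of the dimension polynomial.
\<close>

abbreviation wdeg :: "nat \<Rightarrow> nat" where "wdeg r \<equiv> \<Sum>{1..r}"

text \<open>
  The order of magnitude of the variance at scale \<open>K\<close>: about \<open>K\<^sup>r\<close> weights matter, each with
  variance of order \<open>K\<^bsup>2R\<^esup>\<close>.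
\<close>

abbreviation var_scale :: "nat \<Rightarrow> real \<Rightarrow> real" where
  "var_scale r K \<equiv> K ^ (2 * wdeg r) * K ^ r"

lemma weights_ge_1: "k \<in> weights r \<Longrightarrow> i \<in> {1..r} \<Longrightarrow> 1 \<le> k i"
  by (auto simp: weights_def dest!: PiE_mem)

lemma tailprod_pos:
  assumes "1 \<le> i" "\<And>i. i \<in> {1..r} \<Longrightarrow> 0 < y i"
  shows "0 < tailprod r i y"
  unfolding tailprod_def using assms by (intro prod_pos sum_pos) auto

lemma wdim_pos: "k \<in> weights r \<Longrightarrow> 0 < wdim r k"
  unfolding wdim_def adim_eq_tailprod
  using weights_ge_1[of k r] cnorm_pos[of r]
  by (intro divide_pos_pos tailprod_pos) (force, force, force)

lemma wdim_ge_1: "k \<in> weights r \<Longrightarrow> 1 \<le> wdim r k"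
  using wdim_pos[of k r] wdim_Ints[of r k]
  by (metis Ints_cases of_int_0_less_iff of_int_1_le_iff int_one_le_iff_zero_less)

lemma tailprod_homogeneous: "tailprod r 1 (\<lambda>i. c * y i) = c ^ wdeg r * tailprod r 1 y"
proof -
  have "tailprod r 1 (\<lambda>i. c * y i) = (\<Prod>j=1..r. c ^ j * (\<Prod>l=1..j. \<Sum>m=l..j. y m))"
    unfolding tailprod_def by (intro prod.cong refl) (simp add: sum_distrib_left[symmetric] prod.distrib)
  also have "\<dots> = (\<Prod>j=1..r. c ^ j) * tailprod r 1 y"
    unfolding tailprod_def by (simp add: prod.distrib)
  finally show ?thesis by (simp add: power_sum)
qed

lemma sum_lower_triangle:
  fixes f :: "nat \<Rightarrow> nat \<Rightarrow> real"
  shows "(\<Sum>j=1..r. \<Sum>l=1..j. f l j + f j l) = (\<Sum>l=1..r. (\<Sum>j=1..r. f l j) + f l l)"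
  by (induction r) (simp_all add: sum.distrib algebra_simps)

text \<open>
  Each factor \<open>y\<^sub>l + \<dots> + y\<^sub>j\<close> is bounded below by the geometric mean of its two end terms, except that the end
  term in \<open>J\<close> is taken alone if exactly one of them lies in \<open>J\<close>.  Counting pairs gives the exponents.
  The coordinates in \<open>J\<close> get more than the average exponent \<open>(r + 1) / 2\<close>, the others less, as soon as
  \<open>J\<close> is a nonempty proper subset.
\<close>

lemma ln_tailprod_ge:
  assumes y: "\<And>i. i \<in> {1..r} \<Longrightarrow> 0 < y i" and J: "J \<subseteq> {1..r}"
  shows "(\<Sum>i=1..r. (if i \<in> J then (2 * real r - real (card J) + 1) / 2 else (real r - real (card J) + 1) / 2) * ln (y i))
     \<le> ln (tailprod r 1 y)"
proof -
  define c where "c l j = (if (l \<in> J) = (j \<in> J) then 1/2 else if l \<in> J then 1 else 0 :: real)" for l j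
  have "(\<Sum>j=1..r. \<Sum>l=1..j. c l j * ln (y l) + c j l * ln (y j)) \<le> (\<Sum>j=1..r. \<Sum>l=1..j. ln (\<Sum>m=l..j. y m))"
  proof (intro sum_mono)
    fix j l assume jl: "j \<in> {1..r}" "l \<in> {1..j}"
    have ge: "ln (y i) \<le> ln (\<Sum>m=l..j. y m)" if "i \<in> {l..j}" for i
    proof -
      have "y i \<le> (\<Sum>m=l..j. y m)"
        using that jl y by (intro member_le_sum) (auto intro: less_imp_le)
      then show ?thesis using y[of i] that jl by (subst ln_le_cancel_iff) (auto intro: less_le_trans)
    qed
    have "c l j * ln (y l) + c j l * ln (y j) \<le> c l j * ln (\<Sum>m=l..j. y m) + c j l * ln (\<Sum>m=l..j. y m)"
      using ge[of l] ge[of j] jl by (intro add_mono mult_left_mono) (auto simp: c_def)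
    also have "\<dots> = ln (\<Sum>m=l..j. y m)"
      by (auto simp: c_def)
    finally show "c l j * ln (y l) + c j l * ln (y j) \<le> ln (\<Sum>m=l..j. y m)" .
  qed
  also have "\<dots> = ln (tailprod r 1 y)"
    unfolding tailprod_def
  proof -
    have pos: "0 < (\<Sum>m=l..j. y m)" if "j \<in> {1..r}" "l \<in> {1..j}" for j l
      using that y by (intro sum_pos) auto
    have pp: "0 < (\<Prod>l=1..j. \<Sum>m=l..j. y m)" if "j \<in> {1..r}" for j
      using that pos by (intro prod_pos) auto
    have "(\<Sum>j=1..r. \<Sum>l=1..j. ln (\<Sum>m=l..j. y m)) = (\<Sum>j=1..r. ln (\<Prod>l=1..j. \<Sum>m=l..j. y m))"
    proof (rule sum.cong[OF refl])
      fix j assume j: "j \<in> {1..r}"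
      show "(\<Sum>l=1..j. ln (\<Sum>m=l..j. y m)) = ln (\<Prod>l=1..j. \<Sum>m=l..j. y m)"
        by (rule ln_prod[symmetric]) (use pos[OF j] in fastforce)+
    qed
    also have "\<dots> = ln (\<Prod>j=1..r. \<Prod>l=1..j. \<Sum>m=l..j. y m)"
      by (rule ln_prod[symmetric], simp, drule pp, simp only: less_irrefl not_False_eq_True less_imp_neq[symmetric])
    finally show "(\<Sum>j=1..r. \<Sum>l=1..j. ln (\<Sum>m=l..j. y m)) = ln (\<Prod>j=1..r. \<Prod>l=1..j. \<Sum>m=l..j. y m)" .
  qed
  also have "(\<Sum>j=1..r. \<Sum>l=1..j. c l j * ln (y l) + c j l * ln (y j)) =
    (\<Sum>l=1..r. (\<Sum>j=1..r. c l j * ln (y l)) + c l l * ln (y l))"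
    by (rule sum_lower_triangle[of "\<lambda>l j. c l j * ln (y l)"])
  also have "\<dots> = (\<Sum>i=1..r. (if i \<in> J then (2 * real r - real (card J) + 1) / 2 else (real r - real (card J) + 1) / 2) * ln (y i))"
  proof (intro sum.cong refl)
    fix l assume "l \<in> {1..r}"
    have fin: "finite J" using J finite_subset by blast
    have cJ: "(\<Sum>j=1..r. if j \<in> J then a else b) = real (card J) * a + (real r - real (card J)) * b" for a b :: real
    proof -
      have "(\<Sum>j=1..r. if j \<in> J then a else b) = (\<Sum>j\<in>J. a) + (\<Sum>j\<in>{1..r}-J. b)"
      proof (subst sum.If_cases)
        have "{1..r} \<inter> {j. j \<in> J} = J" "{1..r} \<inter> - {j. j \<in> J} = {1..r} - J" using J by auto
        then show "(\<Sum>j\<in>{1..r} \<inter> {j. j \<in> J}. a) + (\<Sum>j\<in>{1..r} \<inter> - {j. j \<in> J}. b) = (\<Sum>j\<in>J. a) + (\<Sum>j\<in>{1..r}-J. b)"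
          by simp
      qed simp
      also have "\<dots> = real (card J) * a + (real r - real (card J)) * b"
        using J fin card_mono[OF _ J] by (simp add: card_Diff_subset of_nat_diff)
      finally show ?thesis .
    qed
    have "(\<Sum>j=1..r. c l j) = (if l \<in> J then real (card J) * (1/2) + (real r - real (card J)) * 1
        else real (card J) * 0 + (real r - real (card J)) * (1/2))"
      unfolding cJ[symmetric] by (auto simp: c_def intro!: sum.cong)
    moreover have "c l l = 1/2" by (simp add: c_def)
    ultimately have "(\<Sum>j=1..r. c l j) + c l l =
      (if l \<in> J then (2 * real r - real (card J) + 1) / 2 else (real r - real (card J) + 1) / 2)"
      by (simp add: field_simps)
    then show "(\<Sum>j=1..r. c l j * ln (y l)) + c l l * ln (y l) =
      (if l \<in> J then (2 * real r - real (card J) + 1) / 2 else (real r - real (card J) + 1) / 2) * ln (y l)"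
      by (simp only: sum_distrib_right[symmetric] distrib_right[symmetric])
  qed
  finally show ?thesis .
qed

text \<open>
  A bounded increasing function whose derivative decays like a power above \<open>-1\<close> at zero and below
  \<open>-1\<close> at infinity.
\<close>

definition hill :: "real \<Rightarrow> real \<Rightarrow> real" where
  "hill d z = z powr d / (1 + z powr d)"

text \<open>
  The derivative of \<open>hill d\<close>, up to the factor \<open>d\<close>.
\<close>

definition hill_kernel :: "real \<Rightarrow> real \<Rightarrow> real" where
  "hill_kernel d z = z powr (d - 1) / (1 + z powr d)\<^sup>2"

lemma one_plus_powr_pos: "0 < 1 + (z :: real) powr d"
  using powr_ge_zero[of z d] by linarith

lemma hill_kernel_ge:
  assumes "0 < d" "0 < z"
  shows "(if 1 < z then z powr (- 1 - d) else z powr (d - 1)) / 4 \<le> hill_kernel d z"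
proof (cases "1 < z")
  case True
  have p: "1 \<le> z powr d" using True assms by (simp add: ge_one_powr_ge_zero)
  have "(1 + z powr d)\<^sup>2 \<le> (2 * z powr d)\<^sup>2"
    using p by (intro power_mono) auto
  also have "\<dots> = 4 * z powr (d + d)" unfolding powr_add by (simp add: power2_eq_square)
  finally have "z powr (d - 1) / (4 * z powr (d + d)) \<le> hill_kernel d z"
    unfolding hill_kernel_def using assms p by (intro divide_left_mono) (auto intro!: mult_pos_pos zero_less_power one_plus_powr_pos)
  also have "z powr (d - 1) / (4 * z powr (d + d)) = z powr (- 1 - d) / 4"
    using powr_diff[of z "d - 1" "d + d"] by (simp add: algebra_simps)
  finally show ?thesis using True by simp
next
  case False
  then have p: "z powr d \<le> 1" using assms by (simp add: powr_le1)
  have "(1 + z powr d)\<^sup>2 \<le> 2\<^sup>2" using p by (intro power_mono) auto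
  then have "z powr (d - 1) / 4 \<le> hill_kernel d z"
    unfolding hill_kernel_def using one_plus_powr_pos[of z d] by (intro divide_left_mono) auto
  then show ?thesis using False by simp
qed

lemma hill_kernel_antimono:
  assumes "0 < d" "d \<le> 1" "0 < x" "x \<le> y"
  shows "hill_kernel d y \<le> hill_kernel d x"
  unfolding hill_kernel_def
proof (intro frac_le power_mono)
  show "y powr (d - 1) \<le> x powr (d - 1)" using assms by (intro powr_mono2') auto
  show "1 + x powr d \<le> 1 + y powr d" using assms by (simp add: powr_mono2)
qed (use one_plus_powr_pos[of x d] in auto)

lemma hill_diff_ge:
  assumes d: "0 < d" "d \<le> 1" and x: "0 \<le> x" "x < y"
  shows "(y - x) * (d * hill_kernel d y) \<le> hill d y - hill d x"
proof (cases "x = 0")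
  case True
  have y: "y > 0" using x by simp
  have "y * (d * hill_kernel d y) = d * (y powr d / (1 + y powr d)\<^sup>2)"
    using y by (simp add: hill_kernel_def powr_diff)
  also have "\<dots> \<le> 1 * (y powr d / (1 + y powr d)\<^sup>2)"
    using d by (intro mult_right_mono) auto
  also have "\<dots> \<le> y powr d / (1 + y powr d)"
    using power_increasing[of 1 2 "1 + y powr d"]
    by (simp, intro divide_left_mono) (auto intro!: mult_pos_pos zero_less_power one_plus_powr_pos)
  finally show ?thesis using True d by (simp add: hill_def)
next
  case False
  then have x0: "x > 0" using x by simp
  have der: "(hill d has_real_derivative d * hill_kernel d z) (at z)" if "z > 0" for z
  proof -
    have nz: "1 + z powr d \<noteq> 0" using powr_ge_zero[of z d] by linarith
    have p: "((\<lambda>z. z powr d) has_real_derivative d * z powr (d - 1)) (at z)"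
      using that by (rule has_real_derivative_powr)
    have "((\<lambda>z. z powr d / (1 + z powr d)) has_real_derivative
        (d * z powr (d - 1) * (1 + z powr d) - z powr d * (0 + d * z powr (d - 1))) / ((1 + z powr d) * (1 + z powr d))) (at z)"
      by (intro DERIV_divide DERIV_add DERIV_const p nz)
    moreover have "(d * z powr (d - 1) * (1 + z powr d) - z powr d * (0 + d * z powr (d - 1))) = d * z powr (d - 1)"
      by (simp add: distrib_left)
    ultimately show ?thesis
      unfolding hill_def[abs_def] hill_kernel_def by (simp add: power2_eq_square)
  qed
  have "\<exists>z. x < z \<and> z < y \<and> hill d y - hill d x = (y - x) * (d * hill_kernel d z)"
    by (rule MVT2[OF x(2)]) (rule der, use x0 in linarith)
  then obtain z where z: "z > x" "z < y" "hill d y - hill d x = (y - x) * (d * hill_kernel d z)"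
    by blast
  have "hill_kernel d y \<le> hill_kernel d z" using z x0 d by (intro hill_kernel_antimono) auto
  then show ?thesis unfolding z(3) using x d by (intro mult_left_mono) auto
qed

text \<open>
  A decreasing function is summed against its primitive; the sum telescopes and the primitive is at
  most one.
\<close>

lemma sum_hill_kernel_le:
  assumes d: "0 < d" "d \<le> 1" and K: "0 < K"
  shows "(\<Sum>k=1..N. hill_kernel d (real k / K)) \<le> K / d"
proof -
  have s1: "hill d z \<le> 1" for z
    by (simp add: hill_def add_pos_nonneg)
  have "hill_kernel d (real k / K) \<le> (K / d) * (hill d (real k / K) - hill d (real (k - 1) / K))" if "k \<in> {1..N}" for k
  proof -
    have "(real k / K - real (k - 1) / K) * (d * hill_kernel d (real k / K)) \<le> hill d (real k / K) - hill d (real (k - 1) / K)"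
      using K that by (intro hill_diff_ge d) (auto simp: divide_strict_right_mono)
    moreover have "real k / K - real (k - 1) / K = 1 / K" using that K by (simp add: of_nat_diff diff_divide_distrib)
    ultimately have "(1 / K) * (d * hill_kernel d (real k / K)) \<le> hill d (real k / K) - hill d (real (k - 1) / K)"
      by simp
    then have "(K / d) * ((1 / K) * (d * hill_kernel d (real k / K))) \<le> (K / d) * (hill d (real k / K) - hill d (real (k - 1) / K))"
      using d K by (intro mult_left_mono) auto
    then show ?thesis using d K by simp
  qed
  then have "(\<Sum>k=1..N. hill_kernel d (real k / K)) \<le> (\<Sum>k=1..N. (K / d) * (hill d (real k / K) - hill d (real (k - 1) / K)))"
    by (intro sum_mono) auto
  also have "\<dots> = (K / d) * (hill d (real N / K) - hill d (real 0 / K))"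
    unfolding sum_distrib_left[symmetric]
    using sum_telescope''[of 0 N "\<lambda>k. hill d (real k / K)"] by simp
  also have "\<dots> \<le> (K / d) * 1"
    using s1[of "real N / K"] K d by (intro mult_left_mono) (auto simp: hill_def)
  finally show ?thesis by simp
qed

text \<open>
  Apply the monomial bound with \<open>J\<close> the set of coordinates exceeding one, and use \<open>min 1 (1 / P) \<le> P\<^bsup>- p\<^esup>\<close>
  with \<open>p = 2 / (r + 1)\<close>.  Then the coordinates above one get an exponent below \<open>-1\<close> and the others one above
  \<open>-1\<close>, with the margin \<open>1 / (r + 1)\<close> that is built into the kernel, so that the right-hand side is summable.
  If no coordinate or every coordinate exceeds one, then \<open>p = 0\<close> and \<open>p = 3 / (r + 1)\<close> do the same.
\<close>

lemma min_inverse_tailprod_le: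
  assumes r: "2 \<le> r" and y: "\<And>i. i \<in> {1..r} \<Longrightarrow> 0 < y i"
  shows "min 1 (1 / tailprod r 1 y) \<le> 4 ^ r * (\<Prod>i=1..r. hill_kernel (1 / (real r + 1)) (y i))"
proof -
  define d where "d = 1 / (real r + 1)"
  define J where "J = {i \<in> {1..r}. 1 < y i}"
  define m where "m = card J"
  \<comment> \<open>The exponent that separates large from small coordinates.\<close>
  define p where "p = (if m = 0 then 0 else if m = r then 3 / (real r + 1) else 2 / (real r + 1))"
  define e where "e i = (if i \<in> J then (2 * real r - real m + 1) / 2 else (real r - real m + 1) / 2)" for i
  define g where "g z = (if 1 < z then - 1 - d else d - 1)" for z :: real
  let ?P = "tailprod r 1 y"
  have P: "?P > 0" using y by (intro tailprod_pos) auto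
  have d: "0 < d" by (simp add: d_def)
  have p: "0 \<le> p" "p \<le> 1" using r by (auto simp: p_def)
  have finJ: "finite J" by (simp add: J_def)
  have "J \<subseteq> {1..r}" by (auto simp: J_def)
  then have mr: "m \<le> r" using card_mono[of "{1..r}" J] by (simp add: m_def)
  have L: "(\<Sum>i=1..r. e i * ln (y i)) \<le> ln ?P"
    unfolding e_def m_def by (rule ln_tailprod_ge) (auto simp: y J_def)
  have t: "- (p * (e i * ln (y i))) \<le> g (y i) * ln (y i)" if i: "i \<in> {1..r}" for i
  proof (cases "i \<in> J")
    case True
    then have "m > 0" using finJ by (auto simp: m_def card_gt_0_iff)
    have "1 + d \<le> p * e i"
    proof (cases "m = r")
      case True
      then have "p * e i = 3 / 2" using \<open>i \<in> J\<close> r by (simp add: p_def e_def field_simps)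
      moreover have "d \<le> 1 / 2" using r by (simp add: d_def field_simps)
      ultimately show ?thesis by simp
    next
      case False
      then have "real m + 1 \<le> real r" using mr by linarith
      moreover have "p * e i = (2 * real r - real m + 1) / (real r + 1)"
        using False \<open>m > 0\<close> \<open>i \<in> J\<close> by (simp add: p_def e_def divide_simps) (simp add: algebra_simps)
      moreover have "1 + d = (real r + 2) / (real r + 1)" by (simp add: d_def field_simps)
      ultimately show ?thesis by (simp add: divide_right_mono)
    qed
    moreover have "0 \<le> ln (y i)" using True by (simp add: J_def)
    ultimately have "(1 + d) * ln (y i) \<le> p * e i * ln (y i)" by (intro mult_right_mono)
    moreover have "g (y i) = - (1 + d)" using True by (simp add: g_def J_def)
    ultimately show ?thesis by (simp only: mult.assoc minus_mult_left[symmetric] neg_le_iff_le)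
  next
    case False
    have "m \<noteq> r"
    proof
      assume "m = r"
      then have "J = {1..r}" using \<open>J \<subseteq> {1..r}\<close> by (intro card_subset_eq) (auto simp: m_def)
      then show False using i False by blast
    qed
    have "p * e i \<le> 1 - d"
    proof (cases "m = 0")
      case True
      then show ?thesis by (simp add: p_def d_def field_simps)
    next
      case m0: False
      have "p * e i = (real r - real m + 1) / (real r + 1)"
        using m0 \<open>m \<noteq> r\<close> False by (simp add: p_def e_def divide_simps) (simp add: algebra_simps)
      moreover have "1 - d = real r / (real r + 1)" by (simp add: d_def field_simps)
      moreover have "real r - real m + 1 \<le> real r" using m0 by linarith
      ultimately show ?thesis by (simp add: divide_right_mono)
    qed
    moreover have "ln (y i) \<le> 0" using False y[OF i] i by (simp add: J_def)
    ultimately have "(1 - d) * ln (y i) \<le> p * e i * ln (y i)" by (intro mult_right_mono_neg)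
    moreover have "g (y i) = - (1 - d)" using False i by (simp add: g_def J_def)
    ultimately show ?thesis by (simp only: mult.assoc minus_mult_left[symmetric] neg_le_iff_le)
  qed
  have "ln (min 1 (1 / ?P)) \<le> - p * ln ?P"
  proof (cases "?P \<le> 1")
    case True
    then show ?thesis using P p by (simp add: min_def mult_nonneg_nonpos field_simps)
  next
    case False
    then have "p * ln ?P \<le> 1 * ln ?P" using p by (intro mult_right_mono) auto
    then show ?thesis using P False by (simp add: min_def ln_div field_simps)
  qed
  also have "\<dots> \<le> - p * (\<Sum>i=1..r. e i * ln (y i))"
    using L p by (simp add: mult_left_mono)
  also have "\<dots> = (\<Sum>i=1..r. - (p * (e i * ln (y i))))"
    by (simp add: sum_distrib_left sum_negf)
  also have "\<dots> \<le> (\<Sum>i=1..r. g (y i) * ln (y i))" by (intro sum_mono t)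
  also have "\<dots> = (\<Sum>i=1..r. ln (y i powr g (y i)))"
    using y by (intro sum.cong) (auto simp: ln_powr)
  also have "\<dots> = ln (\<Prod>i=1..r. y i powr g (y i))"
  proof (rule ln_prod[symmetric])
    fix i assume "i \<in> {1..r}"
    from y[OF this] show "y i powr g (y i) \<noteq> 0" by simp
  qed simp
  finally have "min 1 (1 / ?P) \<le> (\<Prod>i=1..r. y i powr g (y i))"
  proof (subst (asm) ln_le_cancel_iff)
    show "0 < (\<Prod>i=1..r. y i powr g (y i))"
    proof (intro prod_pos ballI)
      fix i assume "i \<in> {1..r}"
      from y[OF this] show "0 < y i powr g (y i)" by simp
    qed
  qed (use P in auto)
  also have "\<dots> \<le> (\<Prod>i=1..r. 4 * hill_kernel d (y i))"
  proof (intro prod_mono conjI)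
    fix i assume "i \<in> {1..r}"
    note yi = y[OF this]
    from hill_kernel_ge[OF d yi] show "y i powr g (y i) \<le> 4 * hill_kernel d (y i)"
      by (auto simp: g_def split: if_splits)
  qed auto
  finally show ?thesis by (simp add: prod.distrib d_def)
qed

text \<open>
  After rescaling the coordinates by \<open>K\<close>, the product bound makes the sum over all weights a power of a
  sum in one variable.
\<close>

lemma sum_min_wdim_le:
  assumes r: "2 \<le> r"
  shows "\<exists>C>0. \<forall>K>0. \<forall>F. finite F \<longrightarrow> F \<subseteq> weights r \<longrightarrow>
     (\<Sum>k\<in>F. min 1 (K ^ wdeg r / wdim r k)) \<le> C * K ^ r"
proof -
  define d where "d = 1 / (real r + 1)"
  have d: "0 < d" "d \<le> 1" by (auto simp: d_def)
  let ?C = "real (cnorm r) * 4 ^ r * (1 / d) ^ r"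
  have c1: "real (cnorm r) \<ge> 1" using cnorm_pos[of r] by linarith
  have "(\<Sum>k\<in>F. min 1 (K ^ wdeg r / wdim r k)) \<le> ?C * K ^ r" if K: "K > 0" and F: "finite F" "F \<subseteq> weights r" for K F
  proof -
    define N where "N = Max (insert 1 ((\<lambda>(k, i). k i) ` (F \<times> {1..r})))"
    have N: "k i \<le> N" if "k \<in> F" "i \<in> {1..r}" for k i
      unfolding N_def using F that by (intro Max_ge) force+
    have sub: "F \<subseteq> {1..r} \<rightarrow>\<^sub>E {1..N}"
    proof
      fix k assume k: "k \<in> F"
      then have "k \<in> weights r" using F by auto
      then show "k \<in> {1..r} \<rightarrow>\<^sub>E {1..N}"
        using N[OF k] by (auto simp: weights_def PiE_iff)
    qed
    have h0: "0 \<le> hill_kernel d z" for z by (simp add: hill_kernel_def)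
    have "min 1 (K ^ wdeg r / wdim r k) \<le> real (cnorm r) * 4 ^ r * (\<Prod>i=1..r. hill_kernel d (real (k i) / K))" if k: "k \<in> F" for k
    proof -
      have y: "0 < real (k i) / K" if "i \<in> {1..r}" for i
        using weights_ge_1[of k r i] k F K that by fastforce
      have eq: "K ^ wdeg r / wdim r k = real (cnorm r) * (1 / tailprod r 1 (\<lambda>i. real (k i) / K))"
      proof -
        have "tailprod r 1 (\<lambda>i. real (k i) / K) = tailprod r 1 (\<lambda>i. real (k i)) / K ^ wdeg r"
          using tailprod_homogeneous[of r "1 / K" "\<lambda>i. real (k i)"] by (simp add: power_one_over)
        then show ?thesis using K by (simp add: wdim_def adim_eq_tailprod)
      qed
      have "tailprod r 1 (\<lambda>i. real (k i) / K) > 0" using y by (intro tailprod_pos) auto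
      then have "min 1 (K ^ wdeg r / wdim r k) \<le> real (cnorm r) * min 1 (1 / tailprod r 1 (\<lambda>i. real (k i) / K))"
        unfolding eq using c1 by (auto simp: min_def)
      also have "\<dots> \<le> real (cnorm r) * (4 ^ r * (\<Prod>i=1..r. hill_kernel d (real (k i) / K)))"
        unfolding d_def using min_inverse_tailprod_le[OF r y] by (intro mult_left_mono) auto
      finally show ?thesis by simp
    qed
    then have "(\<Sum>k\<in>F. min 1 (K ^ wdeg r / wdim r k)) \<le> (\<Sum>k\<in>F. real (cnorm r) * 4 ^ r * (\<Prod>i=1..r. hill_kernel d (real (k i) / K)))"
      by (intro sum_mono)
    also have "\<dots> \<le> (\<Sum>k\<in>{1..r} \<rightarrow>\<^sub>E {1..N}. real (cnorm r) * 4 ^ r * (\<Prod>i=1..r. hill_kernel d (real (k i) / K)))"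
      using sub by (intro sum_mono2) (auto intro!: finite_PiE mult_nonneg_nonneg prod_nonneg h0)
    also have "\<dots> = real (cnorm r) * 4 ^ r * (\<Prod>i=1..r. \<Sum>j=1..N. hill_kernel d (real j / K))"
      by (subst prod_sum_PiE) (auto simp: sum_distrib_left)
    also have "\<dots> \<le> real (cnorm r) * 4 ^ r * (\<Prod>i=1..r. K / d)"
      using sum_hill_kernel_le[OF d K, of N] by (intro mult_left_mono prod_mono) (auto intro!: sum_nonneg h0)
    finally show ?thesis by (simp add: power_divide)
  qed
  moreover have "?C > 0" using d c1 by simp
  ultimately show ?thesis by blast
qed

section \<open>Cumulants of a geometric variable\<close>

text \<open>
  The variance of a geometric variable with ratio \<open>e\<^bsup>- u\<^esup>\<close>.
\<close>

definition geom_var :: "real \<Rightarrow> real" where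
  "geom_var u = exp (- u) / (1 - exp (- u))\<^sup>2"

text \<open>
  The quartic term provides the decay of the variance for large \<open>u\<close>, and the quadratic one the exact
  behaviour at zero.
\<close>

lemma cosh_ge_quartic: "1 + u\<^sup>2 / 2 + u ^ 4 / 24 \<le> cosh (u :: real)"
proof -
  have s: "(\<lambda>n. if even n then u ^ n / fact n else 0) sums cosh u"
    using cosh_converges[of u] by (simp add: divide_inverse mult.commute cong: if_cong)
  have "sum (\<lambda>n. if even n then u ^ n / fact n else 0) {..<5} \<le> (\<Sum>n. if even n then u ^ n / fact n else 0)"
    using s by (intro sum_le_suminf) (auto simp: sums_iff zero_le_even_power)
  also have "(\<Sum>n. if even n then u ^ n / fact n else 0) = cosh u" using s by (simp add: sums_iff)
  finally have "(\<Sum>n<5. if even n then u ^ n / fact n else 0) \<le> cosh u" .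
  moreover have "{..<5} = {0, 1, 2, 3, 4 :: nat}" by auto
  ultimately show ?thesis by (simp add: fact_numeral)
qed

lemma geom_var_eq: "0 < u \<Longrightarrow> geom_var u = 1 / (2 * cosh u - 2)"
proof -
  assume "0 < u"
  then have e: "exp (- u) \<noteq> 1" by simp
  have "(1 - exp (- u))\<^sup>2 = exp (- u) * (2 * cosh u - 2)"
    by (simp add: cosh_def power2_eq_square algebra_simps exp_minus)
  then show ?thesis by (simp add: geom_var_def)
qed

lemma geom_var_le: "0 < u \<Longrightarrow> geom_var u \<le> 1 / (u\<^sup>2 + u ^ 4 / 12)"
proof -
  assume u: "0 < u"
  have p: "0 < u\<^sup>2 + u ^ 4 / 12" using u by (intro add_pos_pos) auto
  have "u\<^sup>2 + u ^ 4 / 12 \<le> 2 * cosh u - 2" using cosh_ge_quartic[of u] by simp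
  then show ?thesis unfolding geom_var_eq[OF u] using p by (intro divide_left_mono mult_pos_pos) auto
qed

lemma geom_var_pos: "0 < u \<Longrightarrow> 0 < geom_var u"
  by (simp add: geom_var_def)

lemma geom_var_square_le:
  assumes "0 < u" shows "u\<^sup>2 * geom_var u \<le> 24 * min 1 (1 / u)"
proof -
  have "u\<^sup>2 * geom_var u \<le> u\<^sup>2 * (1 / (u\<^sup>2 + u ^ 4 / 12))"
    using assms geom_var_le by (intro mult_left_mono) auto
  also have "\<dots> = 1 / (1 + u\<^sup>2 / 12)"
  proof -
    have "u\<^sup>2 + u ^ 4 / 12 = u\<^sup>2 * (1 + u\<^sup>2 / 12)" by (simp add: algebra_simps eval_nat_numeral)
    then show ?thesis using assms by simp
  qed
  also have "\<dots> \<le> 24 * min 1 (1 / u)"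
  proof -
    have "u \<le> 24 * (1 + u\<^sup>2 / 12)"
      using sum_squares_ge_zero[of "u - 1" 0] by (simp add: power2_eq_square algebra_simps)
         (smt (verit) assms mult_left_mono)
    moreover have "(1::real) \<le> 24 * (1 + u\<^sup>2 / 12)" by (simp add: algebra_simps)
    moreover have "0 < 1 + u\<^sup>2 / 12" by (simp add: add_pos_nonneg)
    ultimately show ?thesis using assms by (auto simp: min_def field_simps)
  qed
  finally show ?thesis .
qed

lemma inverse_one_minus_exp_le:
  assumes "0 < u" shows "1 / (1 - exp (- u)) \<le> 1 + 1 / (u :: real)"
proof -
  have "1 + u \<le> exp u" by (rule exp_ge_add_one_self)
  then have "1 / (1 - exp (- u)) = 1 + 1 / (exp u - 1)"
    using assms by (simp add: exp_minus field_simps)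
  also have "\<dots> \<le> 1 + 1 / u"
    using \<open>1 + u \<le> exp u\<close> assms by (intro add_left_mono divide_left_mono mult_pos_pos) linarith+
  finally show ?thesis .
qed

lemma third_cumulant_le:
  fixes u :: real
  assumes "0 < u" shows "u ^ 3 * (2 * exp (- u) / (1 - exp (- u)) ^ 3) \<le> 96 * min 1 (1 / u)"
proof -
  have p: "0 < 1 - exp (- u)" using assms by simp
  have "u ^ 3 * (2 * exp (- u) / (1 - exp (- u)) ^ 3) = 2 * u ^ 3 * geom_var u * (1 / (1 - exp (- u)))"
    by (simp add: geom_var_def eval_nat_numeral mult.assoc)
  also have "\<dots> \<le> 2 * u ^ 3 * (1 / (u\<^sup>2 + u ^ 4 / 12)) * (1 + 1 / u)"
    using assms p geom_var_le[OF assms] geom_var_pos[OF assms] inverse_one_minus_exp_le[OF assms]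
    by (intro mult_mono) auto
  also have "\<dots> = 2 * ((u + 1) / (1 + u\<^sup>2 / 12))"
  proof -
    have "u\<^sup>2 + u ^ 4 / 12 = u\<^sup>2 * (1 + u\<^sup>2 / 12)" by (simp add: algebra_simps eval_nat_numeral)
    moreover have "1 + 1 / u = (u + 1) / u" using assms by (simp add: field_simps)
    ultimately show ?thesis using assms by (simp add: eval_nat_numeral)
  qed
  also have "(u + 1) / (1 + u\<^sup>2 / 12) \<le> 48 * min 1 (1 / u)"
  proof -
    have "0 \<le> (u - 1) * (u - 1)" by simp
    then have s: "2 * u \<le> 1 + u * u" by (simp add: algebra_simps)
    have "(u + 1) * u \<le> 48 * (1 + u\<^sup>2 / 12)"
      using s zero_le_square[of u] unfolding power2_eq_square distrib_right distrib_left by linarith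
    moreover have "u + 1 \<le> 48 * (1 + u\<^sup>2 / 12)"
      using s zero_le_square[of u] unfolding power2_eq_square distrib_right distrib_left by linarith
    moreover have "0 < 1 + u\<^sup>2 / 12" by (simp add: add_pos_nonneg)
    ultimately show ?thesis using assms by (auto simp: min_def field_simps)
  qed
  finally show ?thesis by simp
qed

lemma mean_geometric_le:
  fixes u :: real
  assumes "0 < u" shows "u * (exp (- u) / (1 - exp (- u))) \<le> 2 * min 1 (1 / u)"
proof -
  have "1 + u + u\<^sup>2 / 2 \<le> exp u"
    using exp_lower_Taylor_quadratic[of u] assms by simp
  then have "u + u\<^sup>2 / 2 \<le> exp u - 1" by simp
  moreover have "exp (- u) / (1 - exp (- u)) = 1 / (exp u - 1)"
    using assms by (simp add: exp_minus field_simps)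
  ultimately have "u * (exp (- u) / (1 - exp (- u))) \<le> u * (1 / (u + u\<^sup>2 / 2))"
    using assms by (simp, intro divide_left_mono) (auto intro!: mult_pos_pos add_pos_pos)
  also have "\<dots> = 1 / (1 + u / 2)"
  proof -
    have "u + u\<^sup>2 / 2 = u * (1 + u / 2)" by (simp add: power2_eq_square algebra_simps)
    then show ?thesis using assms by simp
  qed
  also have "\<dots> \<le> 2 * min 1 (1 / u)"
    using assms by (auto simp: min_def field_simps)
  finally show ?thesis .
qed

lemma fixes u :: real
  shows geom_var_ge: "0 < u \<Longrightarrow> u \<le> U \<Longrightarrow> exp (- U) \<le> geom_var u"
  and geom_var_ge2: "0 < u \<Longrightarrow> u \<le> U \<Longrightarrow> exp (- U) \<le> u\<^sup>2 * geom_var u"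
proof -
  assume u: "0 < u" "u \<le> U"
  then have p: "0 < 1 - exp (- u)" "1 - exp (- u) \<le> 1" by auto
  have "exp (- U) \<le> exp (- u) / 1" using u by simp
  also have "\<dots> \<le> geom_var u"
    unfolding geom_var_def using p by (intro divide_left_mono) (auto simp: power_le_one)
  finally show "exp (- U) \<le> geom_var u" .
  have "1 - exp (- u) \<le> u" using exp_ge_add_one_self[of "- u"] by linarith
  then have "(1 - exp (- u))\<^sup>2 \<le> u\<^sup>2" using p by (intro power_mono) auto
  then have "exp (- u) / u\<^sup>2 \<le> geom_var u"
    unfolding geom_var_def using p u by (intro divide_left_mono) auto
  then have "exp (- u) \<le> u\<^sup>2 * geom_var u" using u by (simp add: field_simps)
  moreover have "exp (- U) \<le> exp (- u)" using u by simp
  ultimately show "exp (- U) \<le> u\<^sup>2 * geom_var u" by linarith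
qed

section \<open>Frequencies and weights in a box\<close>

text \<open>
  Boxes rather than sublevel sets of the dimension, since they are stable under shifting coordinates
  up to a change of size.
\<close>

definition weight_box :: "nat \<Rightarrow> real \<Rightarrow> (nat \<Rightarrow> nat) set" where
  "weight_box r L = {k \<in> weights r. \<forall>i\<in>{1..r}. real (k i) \<le> L}"

lemma finite_weight_box [simp]: "finite (weight_box r L)"
proof (rule finite_subset)
  show "weight_box r L \<subseteq> {1..r} \<rightarrow>\<^sub>E {1..nat \<lfloor>L\<rfloor>}"
    by (rule subsetI) (simp add: weight_box_def weights_def PiE_iff le_nat_floor)
qed (auto intro: finite_PiE)

lemma weight_box_subset: "weight_box r L \<subseteq> weights r" by (auto simp: weight_box_def)

lemma wdim_weight_box_le:
  assumes "k \<in> weight_box r L" "0 \<le> L"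
  shows "wdim r k \<le> (real r * L) ^ wdeg r"
proof -
  have k: "k \<in> weights r" using assms by (auto simp: weight_box_def)
  have "tailprod r 1 (\<lambda>i. real (k i)) \<le> (\<Prod>j=1..r. \<Prod>l=1..j. real r * L)"
    unfolding tailprod_def
  proof (intro prod_mono conjI prod_nonneg sum_nonneg)
    fix j l assume jl: "j \<in> {1..r}" "l \<in> {1..j}"
    have "(\<Sum>m=l..j. real (k m)) \<le> (\<Sum>m=l..j. L)"
      using assms jl by (intro sum_mono) (auto simp: weight_box_def)
    also have "\<dots> = real (Suc j - l) * L" by simp
    also have "\<dots> \<le> real r * L" using jl assms by (intro mult_right_mono) auto
    finally show "(\<Sum>m=l..j. real (k m)) \<le> real r * L" .
  qed auto
  also have "\<dots> = (real r * L) ^ wdeg r"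
    by (simp add: power_sum)
  finally have "tailprod r 1 (\<lambda>i. real (k i)) \<le> (real r * L) ^ wdeg r" .
  moreover have "wdim r k \<le> tailprod r 1 (\<lambda>i. real (k i))"
  proof -
    have "0 \<le> tailprod r 1 (\<lambda>i. real (k i))"
      unfolding tailprod_def by (intro prod_nonneg sum_nonneg) auto
    moreover have "1 \<le> real (cnorm r)" using cnorm_pos[of r] by linarith
    ultimately show ?thesis unfolding wdim_def adim_eq_tailprod
      using mult_left_mono[of 1 "real (cnorm r)" "tailprod r 1 (\<lambda>i. real (k i))"] by (simp add: divide_le_eq)
  qed
  ultimately show ?thesis by linarith
qed

text \<open>
  Choose the step \<open>h\<close> with \<open>h\<^sup>R\<close> of order \<open>1 / |t|\<close>, so that the sine of \<open>t h\<^sup>R / 2\<close> is bounded below.  Every point of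
  a box of side \<open>K\<close> then has a shift with large sine.  There are only boundedly many shifts, so each good
  point is reached boundedly often.  The lower bound on \<open>|t|\<close> keeps \<open>h\<close> of order \<open>K\<close> and hence the shifted
  points in a box of comparable size.
\<close>

lemma card_good_weights_ge:
  assumes r: "1 \<le> r" and c0: "0 < c0"
  shows "\<exists>B>0. \<exists>\<eta>>0. \<exists>c>0. \<forall>K\<ge>1. \<forall>t. c0 / K ^ wdeg r \<le> \<bar>t\<bar> \<longrightarrow> \<bar>t\<bar> \<le> pi \<longrightarrow>
     c * K ^ r \<le> real (card {k \<in> weight_box r (B * K). \<eta> \<le> \<bar>sin (wdim r k * t / 2)\<bar>})"
proof -
  define R where "R = wdeg r"
  have R: "R > 0" using r by (auto simp: R_def intro!: sum_pos)
  define b where "b = root R (pi / c0)"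
  have b: "b > 0" using c0 R by (simp add: b_def)
  define B where "B = 1 + real r * b"
  define s0 where "s0 = sin (pi / 2 ^ (R + 1))"
  define \<eta> where "\<eta> = s0 / 2 ^ R"
  \<comment> \<open>The factor \<open>(r + 1)\<^sup>r\<close> counts the shifts, the factor \<open>2\<^sup>r\<close> comes from rounding \<open>K\<close> down.\<close>
  define c where "c = 1 / (2 * (real r + 1)) ^ r"
  have "(2::real) \<le> 2 ^ (R + 1)" using power_increasing[of 1 "R + 1" "2::real"] by simp
  then have pi2: "pi / 2 ^ (R + 1) \<le> pi / 2" "0 < pi / 2 ^ (R + 1)"
    by (intro divide_left_mono) (simp_all del: power_Suc)
  then have s0: "s0 > 0" unfolding s0_def using pi_gt_zero by (intro sin_gt_zero) linarith+
  have main: "c * K ^ r \<le> real (card {k \<in> weight_box r (B * K). \<eta> \<le> \<bar>sin (wdim r k * t / 2)\<bar>})"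
    if K: "1 \<le> K" and t: "c0 / K ^ R \<le> \<bar>t\<bar>" "\<bar>t\<bar> \<le> pi" for K t
  proof -
    define G where "G = {k \<in> weight_box r (B * K). \<eta> \<le> \<bar>sin (wdim r k * t / 2)\<bar>}"
    have t0: "\<bar>t\<bar> > 0" using t(1) c0 K by (smt (verit) divide_pos_pos zero_less_power)
    define x where "x = root R (pi / \<bar>t\<bar>)"
    have xR: "x ^ R = pi / \<bar>t\<bar>" unfolding x_def using R t0 by (intro real_root_pow_pos2) auto
    have "pi / \<bar>t\<bar> \<ge> 1" using t t0 by simp
    then have x1: "x \<ge> 1" using R by (simp add: x_def)
    define h where "h = nat \<lfloor>x\<rfloor>"
    have h: "1 \<le> h" "real h \<le> x" "x < 2 * real h"
    proof -
      have "1 \<le> \<lfloor>x\<rfloor>" using x1 by (simp add: le_floor_iff)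
      then show "1 \<le> h" "real h \<le> x" "x < 2 * real h" unfolding h_def by linarith+
    qed
    have xb: "x \<le> b * K"
    proof -
      have "pi / \<bar>t\<bar> \<le> pi / (c0 / K ^ R)"
        using t c0 K t0 by (intro divide_left_mono) (auto intro!: mult_pos_pos divide_pos_pos)
      also have "\<dots> = (pi / c0) * K ^ R" by simp
      finally have "x \<le> root R ((pi / c0) * K ^ R)" unfolding x_def using R by simp
      also have "\<dots> = b * K" unfolding b_def real_root_mult using R K by (simp only: real_root_power_cancel)
      finally show ?thesis .
    qed
    define N where "N = nat \<lfloor>K\<rfloor>"
    have N: "real N \<le> K" "K \<le> 2 * real N" 
    proof -
      have "1 \<le> \<lfloor>K\<rfloor>" using K by (simp add: le_floor_iff)
      then show "real N \<le> K" "K \<le> 2 * real N" unfolding N_def by linarith+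
    qed
    have sint: "s0 \<le> \<bar>sin ((t / 2) * real h ^ R)\<bar>"
    proof -
      define v where "v = \<bar>t\<bar> / 2 * real h ^ R"
      have "real h ^ R \<le> pi / \<bar>t\<bar>" unfolding xR[symmetric] using h by (intro power_mono) auto
      then have v1: "v \<le> pi / 2" using t0 by (simp add: v_def field_simps)
      have "pi / \<bar>t\<bar> \<le> (2 * real h) ^ R" unfolding xR[symmetric] using h x1 by (intro power_mono) auto
      then have v2: "pi / 2 ^ (R + 1) \<le> v" using t0 by (simp add: v_def field_simps power_mult_distrib)
      have "s0 \<le> sin v" unfolding s0_def
        by (rule sin_monotone_2pi_le) (use v1 v2 pi2 pi_gt_zero in linarith)+
      also have "\<dots> \<le> \<bar>sin v\<bar>" by simp
      also have "\<bar>sin v\<bar> = \<bar>sin ((t / 2) * real h ^ R)\<bar>"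
        unfolding v_def by (cases "t \<ge> 0") auto
      finally show ?thesis .
    qed
    define base where "base = {1..r} \<rightarrow>\<^sub>E {1..N}"
    have "\<exists>s :: nat \<Rightarrow> nat. (\<forall>j. s j \<le> r) \<and> (\<lambda>i\<in>{1..r}. k i + s i * h) \<in> G" if k: "k \<in> base" for k
    proof -
      obtain s :: "nat \<Rightarrow> nat" where s: "\<forall>j. s j \<le> r" and
        s2: "\<bar>sin ((t / 2) * real h ^ R)\<bar> / 2 ^ R \<le>
          \<bar>sin ((t / 2) * (tailprod r (Suc r - r) (\<lambda>j. real (k j) + real (s j) * real h) / real (cnorm r)))\<bar>"
        unfolding R_def using exists_shift_sin_ge[of r r "t / 2" "real h" "\<lambda>j. real (k j)"] by auto
      let ?k = "\<lambda>i\<in>{1..r}. k i + s i * h"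
      have "tailprod r 1 (\<lambda>i. real (?k i)) = tailprod r 1 (\<lambda>j. real (k j) + real (s j) * real h)"
        unfolding tailprod_def by (intro prod.cong sum.cong refl) auto
      then have w: "tailprod r (Suc r - r) (\<lambda>j. real (k j) + real (s j) * real h) / real (cnorm r) = wdim r ?k"
        by (simp add: wdim_def adim_eq_tailprod)
      have "\<eta> \<le> \<bar>sin ((t / 2) * real h ^ R)\<bar> / 2 ^ R"
        unfolding \<eta>_def using sint by (intro divide_right_mono) auto
      then have "\<eta> \<le> \<bar>sin (wdim r ?k * t / 2)\<bar>"
        using s2 unfolding w by (simp add: mult.commute)
      moreover have "?k \<in> weight_box r (B * K)"
      proof -
        have "real (k i + s i * h) \<le> B * K" if i: "i \<in> {1..r}" for i
        proof -
          have "real (k i) \<le> K" using k i N(1) by (auto simp: base_def dest!: PiE_mem)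
          moreover have "real (s i) * real h \<le> real r * (b * K)"
            using s h(2) xb by (intro mult_mono) auto
          ultimately show ?thesis by (simp add: B_def algebra_simps)
        qed
        moreover have "1 \<le> k i + s i * h" if "i \<in> {1..r}" for i
          using k that by (auto simp: base_def dest!: PiE_mem)
        ultimately show ?thesis by (auto simp: weight_box_def weights_def)
      qed
      ultimately show ?thesis using s unfolding G_def by auto
    qed
    then obtain s :: "(nat \<Rightarrow> nat) \<Rightarrow> nat \<Rightarrow> nat" where
      s: "\<And>k j. k \<in> base \<Longrightarrow> s k j \<le> r" "\<And>k. k \<in> base \<Longrightarrow> (\<lambda>i\<in>{1..r}. k i + s k i * h) \<in> G"
      by metis
    define F where "F k = (\<lambda>i\<in>{1..r}. k i + s k i * h, \<lambda>i\<in>{1..r}. s k i)" for k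
    \<comment> \<open>The base point is recovered from the good point together with the shift.\<close>
    have inj: "inj_on F base"
    proof (rule inj_onI)
      fix k k' assume kk: "k \<in> base" "k' \<in> base" and eq: "F k = F k'"
      show "k = k'"
      proof (rule PiE_ext[OF kk[unfolded base_def]])
        fix i assume i: "i \<in> {1..r}"
        have "s k i = s k' i" "k i + s k i * h = k' i + s k' i * h"
          using eq i unfolding F_def by (auto dest!: fun_cong[where x = i])
        then show "k i = k' i" by simp
      qed
    qed
    have "F ` base \<subseteq> G \<times> ({1..r} \<rightarrow>\<^sub>E {0..r})"
      using s by (auto simp: F_def)
    then have "card base \<le> card (G \<times> ({1..r} \<rightarrow>\<^sub>E {0..r}))"
      using inj by (intro card_inj_on_le[of F]) (auto simp: G_def intro!: finite_PiE finite_cartesian_product)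
    then have "N ^ r \<le> card G * (r + 1) ^ r"
      by (simp add: card_cartesian_product card_PiE base_def)
    then have "real N ^ r \<le> real (card G) * (real r + 1) ^ r"
    proof -
      have "real (N ^ r) \<le> real (card G * (r + 1) ^ r)"
        using \<open>N ^ r \<le> card G * (r + 1) ^ r\<close> by (simp only: of_nat_le_iff)
      then show ?thesis by (simp add: add.commute)
    qed
    moreover have "(K / 2) ^ r \<le> real N ^ r" using N K by (intro power_mono) auto
    ultimately have "(K / 2) ^ r \<le> real (card G) * (real r + 1) ^ r" by linarith
    then show ?thesis
      unfolding G_def[symmetric] c_def power_mult_distrib power_divide by (simp add: field_simps)
  qed
  have "B > 0" using b by (simp add: B_def add_pos_nonneg)
  moreover have "\<eta> > 0" using s0 by (simp add: \<eta>_def)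
  moreover have "c > 0" by (simp add: c_def)
  ultimately show ?thesis using main unfolding R_def by blast
qed

section \<open>Multiplicity vectors of given dimension\<close>

definition total_dim :: "('k \<Rightarrow> nat) \<Rightarrow> ('k \<Rightarrow> nat) \<Rightarrow> nat" where
  "total_dim a \<rho> = (\<Sum>k\<in>{k. \<rho> k \<noteq> 0}. a k * \<rho> k)"

definition level :: "('k \<Rightarrow> nat) \<Rightarrow> 'k set \<Rightarrow> nat \<Rightarrow> ('k \<Rightarrow> nat) set" where
  "level a A m = {\<rho> \<in> mults A. total_dim a \<rho> = m}"

lemma total_dim_eq_sum: "finite F \<Longrightarrow> {k. \<rho> k \<noteq> 0} \<subseteq> F \<Longrightarrow> total_dim a \<rho> = (\<Sum>k\<in>F. a k * \<rho> k)"
  unfolding total_dim_def by (rule sum.mono_neutral_left) auto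

lemma total_dim_ge:
  assumes "\<rho> \<in> mults A" "\<rho> k \<noteq> 0"
  shows "a k * \<rho> k \<le> total_dim a \<rho>"
proof -
  have "finite {k. \<rho> k \<noteq> 0}" using assms by (auto simp: mults_def)
  then show ?thesis unfolding total_dim_def using assms
    by (intro member_le_sum[of k _ "\<lambda>k. a k * \<rho> k"]) auto
qed

lemma finite_level:
  assumes "finite F" "\<And>k. k \<in> F \<Longrightarrow> 1 \<le> a k"
  shows "finite (level a F m)"
proof (rule finite_subset)
  show "level a F m \<subseteq> {f. \<forall>x. (x \<in> F \<longrightarrow> f x \<in> {0..m}) \<and> (x \<notin> F \<longrightarrow> f x = 0)}"
  proof (intro subsetI, unfold mem_Collect_eq, intro allI conjI impI)
    fix \<rho> k assume \<rho>: "\<rho> \<in> level a F m"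
    show "\<rho> k = 0" if "k \<notin> F" using \<rho> that by (auto simp: level_def mults_def)
    show "\<rho> k \<in> {0..m}" if "k \<in> F"
    proof (cases "\<rho> k = 0")
      case False
      then have "a k * \<rho> k \<le> m" using \<rho> total_dim_ge[of \<rho> F k a] by (auto simp: level_def)
      moreover have "1 * \<rho> k \<le> a k * \<rho> k" by (rule mult_right_mono[OF assms(2)[OF that]]) simp
      ultimately have "\<rho> k \<le> m" by linarith
      then show ?thesis by simp
    qed simp
  qed
qed (rule finite_set_of_finite_funs, use assms in auto)

lemma level_empty: "level a {} m = (if m = 0 then {\<lambda>_. 0} else {})"
  by (auto simp: level_def mults_def total_dim_def fun_eq_iff)

text \<open>
  Split by whether \<open>k\<close> occurs, and in the second case remove one copy of it.
\<close>

lemma card_level_insert: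
  assumes F: "finite F" "k \<notin> F" and a: "\<And>j. j \<in> insert k F \<Longrightarrow> 1 \<le> a j"
  shows "card (level a (insert k F) m) = card (level a F m) + (if a k \<le> m then card (level a (insert k F) (m - a k)) else 0)"
proof -
  let ?A = "level a (insert k F)"
  have fin: "finite (?A n)" for n by (rule finite_level) (use F a in auto)
  have nd: "total_dim a \<rho> = a k * \<rho> k + (\<Sum>j\<in>F. a j * \<rho> j)" if "\<rho> \<in> mults (insert k F)" for \<rho>
    using that F by (subst total_dim_eq_sum[of "insert k F"]) (auto simp: mults_def)
  have split: "?A m = level a F m \<union> {\<rho> \<in> ?A m. \<rho> k \<noteq> 0}"
    by (auto simp: level_def mults_def)
  have disj: "level a F m \<inter> {\<rho> \<in> ?A m. \<rho> k \<noteq> 0} = {}"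
    using F by (auto simp: level_def mults_def)
  have "card {\<rho> \<in> ?A m. \<rho> k \<noteq> 0} = (if a k \<le> m then card (?A (m - a k)) else 0)"
  proof (cases "a k \<le> m")
    case True
    have "bij_betw (\<lambda>\<rho>. \<rho>(k := Suc (\<rho> k))) (?A (m - a k)) {\<rho> \<in> ?A m. \<rho> k \<noteq> 0}"
    proof (rule bij_betw_byWitness[where f' = "\<lambda>\<rho>. \<rho>(k := \<rho> k - 1)"])
      have s: "{j. (\<rho>(k := v)) j \<noteq> 0} \<subseteq> insert k {j. \<rho> j \<noteq> 0}" for \<rho> :: "'a \<Rightarrow> nat" and v
        by auto
      have mm: "\<rho>(k := v) \<in> mults (insert k F)" if "\<rho> \<in> mults (insert k F)" for \<rho> v
        using that finite_subset[OF s, of \<rho> v] by (auto simp: mults_def)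
      have c: "(\<Sum>j\<in>F. a j * (\<rho>(k := v)) j) = (\<Sum>j\<in>F. a j * \<rho> j)" for \<rho> v
        using F by (intro sum.cong) auto
      show "(\<lambda>\<rho>. \<rho>(k := Suc (\<rho> k))) ` ?A (m - a k) \<subseteq> {\<rho> \<in> ?A m. \<rho> k \<noteq> 0}"
        using True by (auto simp: level_def mm nd c fun_upd_same simp del: fun_upd_apply)
      show "(\<lambda>\<rho>. \<rho>(k := \<rho> k - 1)) ` {\<rho> \<in> ?A m. \<rho> k \<noteq> 0} \<subseteq> ?A (m - a k)"
      proof (intro image_subsetI)
        fix \<rho> assume "\<rho> \<in> {\<rho> \<in> ?A m. \<rho> k \<noteq> 0}"
        then have \<rho>: "\<rho> \<in> mults (insert k F)" "total_dim a \<rho> = m" "\<rho> k \<noteq> 0" by (auto simp: level_def)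
        then obtain v where v: "\<rho> k = Suc v" by (cases "\<rho> k") auto
        show "\<rho>(k := \<rho> k - 1) \<in> ?A (m - a k)"
          using \<rho>(1,2) v by (simp add: level_def mm nd c fun_upd_same del: fun_upd_apply)
      qed
    qed auto
    then show ?thesis using True by (simp add: bij_betw_same_card)
  next
    case False
    have "\<rho> k = 0" if \<rho>: "\<rho> \<in> ?A m" for \<rho>
    proof (rule ccontr)
      assume "\<rho> k \<noteq> 0"
      then have "a k * 1 \<le> a k * \<rho> k" by (intro mult_left_mono) auto
      also have "\<dots> \<le> m" using \<rho> total_dim_ge[of \<rho> "insert k F" k a] \<open>\<rho> k \<noteq> 0\<close> by (auto simp: level_def)
      finally show False using False by simp
    qed
    then have "{\<rho> \<in> ?A m. \<rho> k \<noteq> 0} = {}" by auto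
    then show ?thesis using False by (simp only:) simp
  qed
  moreover have "card (?A m) = card (level a F m) + card {\<rho> \<in> ?A m. \<rho> k \<noteq> 0}"
  proof -
    have "finite (level a F m)" by (rule finite_level) (use F a in auto)
    then have "card (level a F m \<union> {\<rho> \<in> ?A m. \<rho> k \<noteq> 0}) = card (level a F m) + card {\<rho> \<in> ?A m. \<rho> k \<noteq> 0}"
      using disj fin[of m] by (intro card_Un_disjoint) auto
    then show ?thesis using arg_cong[OF split, of card] by (rule trans[rotated])
  qed
  ultimately show ?thesis by (simp only:)
qed

section \<open>Fourier inversion\<close>

text \<open>
  The characteristic function of the sum of \<open>a k\<close> times independent geometric variables of
  ratio \<open>q\<^bsup>a k\<^esup>\<close>.
\<close>

definition geom_cf :: "('k \<Rightarrow> nat) \<Rightarrow> real \<Rightarrow> 'k set \<Rightarrow> real \<Rightarrow> complex" where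
  "geom_cf a q F t = (\<Prod>k\<in>F. (1 - q ^ a k) / (1 - q ^ a k * cis (real (a k) * t)))"

text \<open>
  The probability that this sum equals \<open>m\<close>: all multiplicity vectors of total dimension \<open>m\<close> have
  the same weight.
\<close>

definition fin_prob_nat :: "('k \<Rightarrow> nat) \<Rightarrow> real \<Rightarrow> 'k set \<Rightarrow> nat \<Rightarrow> real" where
  "fin_prob_nat a q F m = (\<Prod>k\<in>F. 1 - q ^ a k) * q ^ m * real (card (level a F m))"

lemma norm_one_minus_cis:
  "(cmod (1 - of_real x * cis \<theta>))\<^sup>2 = (1 - x)\<^sup>2 + 4 * x * (sin (\<theta> / 2))\<^sup>2"
proof -
  have c: "cos \<theta> = 1 - 2 * (sin (\<theta> / 2))\<^sup>2" using cos_double_sin[of "\<theta> / 2"] by simp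
  have "(cmod (1 - of_real x * cis \<theta>))\<^sup>2 = (1 - x * cos \<theta>)\<^sup>2 + (x * sin \<theta>)\<^sup>2"
    by (simp add: cmod_power2)
  also have "\<dots> = 1 - 2 * x * cos \<theta> + x\<^sup>2 * ((cos \<theta>)\<^sup>2 + (sin \<theta>)\<^sup>2)"
    unfolding power2_eq_square by (simp only: algebra_simps)
  also have "(cos \<theta>)\<^sup>2 + (sin \<theta>)\<^sup>2 = 1" by simp
  also have "1 - 2 * x * cos \<theta> + x\<^sup>2 * 1 = (1 - x)\<^sup>2 + 4 * x * (sin (\<theta> / 2))\<^sup>2"
    unfolding c by (simp add: power2_eq_square algebra_simps)
  finally show ?thesis .
qed

lemma one_minus_cis_ge:
  assumes "0 < x" "x < 1" shows "1 - x \<le> cmod (1 - of_real x * cis \<theta>)"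
proof -
  have "cmod (1 - of_real x * cis \<theta>) \<ge> cmod 1 - cmod (of_real x * cis \<theta>)" by (rule norm_triangle_ineq2)
  then show ?thesis using assms by (simp add: norm_mult)
qed

lemma norm_geom_cf_le_1:
  assumes "0 < q" "q < 1" "\<And>k. k \<in> F \<Longrightarrow> 1 \<le> a k"
  shows "cmod (geom_cf a q F t) \<le> 1"
proof -
  have "cmod ((1 - q ^ a k) / (1 - q ^ a k * cis (real (a k) * t))) \<le> 1" if "k \<in> F" for k
  proof -
    have x: "0 < q ^ a k" "q ^ a k < 1" using assms(1,2) assms(3)[OF that] by (auto simp: power_less_one_iff)
    have "cmod (1 - of_real (q ^ a k)) = 1 - q ^ a k"
      using x by (metis abs_of_pos diff_gt_0_iff_gt norm_of_real of_real_1 of_real_diff)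
    then show ?thesis using one_minus_cis_ge[OF x, of "real (a k) * t"] x
      by (simp add: norm_divide divide_le_eq)
  qed
  then show ?thesis unfolding geom_cf_def prod_norm[symmetric] by (intro prod_le_1) auto
qed

lemma continuous_geom_cf:
  assumes "0 < q" "q < 1" "\<And>k. k \<in> F \<Longrightarrow> 1 \<le> a k"
  shows "continuous_on S (geom_cf a q F)"
proof -
  have nz: "1 - complex_of_real q ^ a k * cis (real (a k) * t) \<noteq> 0" if "k \<in> F" for k t
  proof -
    have x: "0 < q ^ a k" "q ^ a k < 1" using assms(1,2) assms(3)[OF that] by (auto simp: power_less_one_iff)
    then have "0 < cmod (1 - of_real (q ^ a k) * cis (real (a k) * t))"
      using one_minus_cis_ge[OF x, of "real (a k) * t"] by linarith
    then show ?thesis by auto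
  qed
  show ?thesis unfolding geom_cf_def[abs_def]
    by (intro continuous_intros) (use nz in auto)
qed

text \<open>
  Integer frequencies of both signs are allowed: at negative ones the integral vanishes, which
  anchors the recursion in \<open>m\<close>.
\<close>

definition fourier_int :: "('k \<Rightarrow> nat) \<Rightarrow> real \<Rightarrow> 'k set \<Rightarrow> int \<Rightarrow> complex" where
  "fourier_int a q F m = (LINT t|lborel. indicator {-pi..pi} t *\<^sub>R (cis (- of_int m * t) * geom_cf a q F t))"

lemma integrable_fourier_int:
  assumes "0 < q" "q < 1" "\<And>k. k \<in> F \<Longrightarrow> 1 \<le> a k"
  shows "integrable lborel (\<lambda>t. indicator {-pi..pi} t *\<^sub>R (cis (s * t) * geom_cf a q F t))"
proof -
  have "continuous_on {-pi..pi} (geom_cf a q F)" by (rule continuous_geom_cf) (use assms in auto)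
  then have "set_integrable lborel {-pi..pi} (\<lambda>t. cis (s * t) * geom_cf a q F t)"
    by (intro borel_integrable_atLeastAtMost' continuous_intros)
  then show ?thesis by (simp add: set_integrable_def)
qed

lemma fourier_int_empty: "fourier_int a q {} m = (if m = 0 then 2 * pi else 0)"
proof (cases "m = 0")
  case True
  have "fourier_int a q {} m = (LINT t|lborel. indicator {-pi..pi} t *\<^sub>R (1::complex))"
    by (simp add: fourier_int_def geom_cf_def True)
  also have "\<dots> = of_real pi - of_real (- pi)"
    by (rule integral_FTC_atLeastAtMost) (auto intro!: derivative_eq_intros continuous_intros simp: has_vector_derivative_of_real)
  finally show ?thesis using True by simp
next
  case False
  let ?c = "- of_int m :: real"
  have c: "?c \<noteq> 0" using False by simp
  have d: "((\<lambda>t. cis (?c * t) / (\<i> * ?c)) has_vector_derivative cis (?c * t)) (at t within S)" for t S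
  proof -
    let ?A = "\<i> * complex_of_real ?c"
    have "((\<lambda>t. exp (t *\<^sub>R ?A) * inverse ?A) has_vector_derivative exp (t *\<^sub>R ?A) * ?A * inverse ?A) (at t within S)"
      by (intro has_vector_derivative_mult_left exp_scaleR_has_vector_derivative_right)
    then show ?thesis using c by (simp add: cis_conv_exp scaleR_conv_of_real field_simps)
  qed
  have "fourier_int a q {} m = (LINT t|lborel. indicator {-pi..pi} t *\<^sub>R cis (?c * t))"
    by (simp add: fourier_int_def geom_cf_def)
  also have "\<dots> = cis (?c * pi) / (\<i> * ?c) - cis (?c * (- pi)) / (\<i> * ?c)"
    by (rule integral_FTC_atLeastAtMost[OF _ d]) (auto intro!: continuous_intros)
  also have "cis (?c * (- pi)) = cis (?c * pi)"
    using sin_npi_int[of m] by (auto simp: complex_eq_iff mult.commute)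
  finally show ?thesis using False by simp
qed

lemma norm_fourier_int_le:
  assumes "0 < q" "q < 1" "\<And>k. k \<in> F \<Longrightarrow> 1 \<le> a k"
  shows "cmod (fourier_int a q F m) \<le> 2 * pi"
proof -
  have "cmod (fourier_int a q F m) \<le> (LINT t|lborel. indicator {-pi..pi} t *\<^sub>R (1::real))"
    unfolding fourier_int_def
  proof (rule Bochner_Integration.integral_norm_bound_integral)
    show "integrable lborel (\<lambda>t. indicator {-pi..pi} t *\<^sub>R (cis (- of_int m * t) * geom_cf a q F t))"
      by (rule integrable_fourier_int[OF assms])
    show "integrable lborel (\<lambda>t. indicator {-pi..pi} t *\<^sub>R (1::real))" by simp
    show "cmod (indicator {-pi..pi} t *\<^sub>R (cis (- of_int m * t) * geom_cf a q F t)) \<le> indicator {-pi..pi} t *\<^sub>R 1" for t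
      using norm_geom_cf_le_1[where a = a and t = t, OF assms] by (auto simp: indicator_def norm_mult)
  qed
  then show ?thesis by simp
qed

text \<open>
  The recursion obtained by clearing the denominator of the factor for \<open>k\<close>.
\<close>

lemma fourier_int_insert:
  assumes q: "0 < q" "q < 1" and F: "finite F" "k \<notin> F" and a: "\<And>j. j \<in> insert k F \<Longrightarrow> 1 \<le> a j"
  shows "fourier_int a q (insert k F) m = (1 - q ^ a k) * fourier_int a q F m + q ^ a k * fourier_int a q (insert k F) (m - int (a k))"
proof -
  let ?I = "\<lambda>t. indicator {-pi..pi} t :: real"
  have x: "0 < q ^ a k" "q ^ a k < 1" using q a[of k] by (auto simp: power_less_one_iff)
  have i1: "integrable lborel (\<lambda>t. ?I t *\<^sub>R (cis (- of_int m * t) * geom_cf a q F t))" for m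
    by (rule integrable_fourier_int) (use q a in auto)
  have i2: "integrable lborel (\<lambda>t. ?I t *\<^sub>R (cis (- of_int m * t) * geom_cf a q (insert k F) t))" for m
    by (rule integrable_fourier_int) (use q a in auto)
  have eq: "cis (- of_int m * t) * geom_cf a q (insert k F) t =
     (1 - q ^ a k) * (cis (- of_int m * t) * geom_cf a q F t) + q ^ a k * (cis (- of_int (m - int (a k)) * t) * geom_cf a q (insert k F) t)" for t
  proof -
    define c where "c = cis (real (a k) * t)"
    have nz: "1 - complex_of_real (q ^ a k) * c \<noteq> 0"
      using one_minus_cis_ge[OF x, of "real (a k) * t"] x by (auto simp: c_def)
    have c1: "cis (- of_int (m - int (a k)) * t) = cis (- of_int m * t) * c"
      by (simp add: c_def cis_mult algebra_simps)
    have g: "geom_cf a q (insert k F) t * (1 - of_real (q ^ a k) * c) = (1 - q ^ a k) * geom_cf a q F t"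
      using F nz by (simp add: geom_cf_def c_def)
    have "cis (- of_int m * t) * geom_cf a q (insert k F) t =
      cis (- of_int m * t) * (geom_cf a q (insert k F) t * (1 - of_real (q ^ a k) * c)) + q ^ a k * (cis (- of_int m * t) * c * geom_cf a q (insert k F) t)"
      by (simp add: algebra_simps)
    then show ?thesis unfolding g c1 by (simp add: mult_ac)
  qed
  have "fourier_int a q (insert k F) m = (LINT t|lborel. (1 - q ^ a k) * (?I t *\<^sub>R (cis (- of_int m * t) * geom_cf a q F t))
     + q ^ a k * (?I t *\<^sub>R (cis (- of_int (m - int (a k)) * t) * geom_cf a q (insert k F) t)))"
    unfolding fourier_int_def by (rule Bochner_Integration.integral_cong[OF refl], subst eq) (simp add: scaleR_add_right)
  also have "\<dots> = (1 - q ^ a k) * fourier_int a q F m + q ^ a k * fourier_int a q (insert k F) (m - int (a k))"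
    unfolding fourier_int_def
    by (subst Bochner_Integration.integral_add[OF integrable_mult_right[OF i1] integrable_mult_right[OF i2]])
      (simp only: integral_mult_right_zero)
  finally show ?thesis by simp
qed

text \<open>
  Both sides satisfy the same recursion in \<open>m\<close>, so that their difference satisfies
  \<open>d m = q\<^bsup>a k\<^esup> d (m - a k)\<close>.  It is bounded at negative arguments, and iterating the relation makes it vanish.
  In this way no infinite sum has to be interchanged with the integral.
\<close>

lemma Fourier_inversion:
  assumes "finite F" and q: "0 < q" "q < 1" and "\<And>k. k \<in> F \<Longrightarrow> 1 \<le> a k"
  shows "fourier_int a q F m = (if m < 0 then 0 else 2 * pi * fin_prob_nat a q F (nat m))"
  using assms(1,4)
proof (induction F arbitrary: m rule: finite_induct)
  case empty
  then show ?case by (auto simp: fourier_int_empty fin_prob_nat_def level_empty)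
next
  case (insert k F)
  let ?F = "insert k F"
  define p where "p m = (if m < 0 then 0 else 2 * pi * fin_prob_nat a q ?F (nat m))" for m :: int
  define d where "d m = fourier_int a q ?F m - of_real (p m)" for m
  have x: "0 < q ^ a k" "q ^ a k < 1" using q insert.prems[of k] by (auto simp: power_less_one_iff)
  have "p m = (1 - q ^ a k) * (if m < 0 then 0 else 2 * pi * fin_prob_nat a q F (nat m)) + q ^ a k * p (m - int (a k))" for m
  proof (cases "m < int (a k)")
    case True
    then show ?thesis
      using card_level_insert[where m = "nat m", OF insert.hyps insert.prems] insert.hyps
      by (auto simp: p_def fin_prob_nat_def)
  next
    case False
    then have "card (level a ?F (nat m)) = card (level a F (nat m)) + card (level a ?F (nat m - a k))"
      using card_level_insert[where m = "nat m", OF insert.hyps insert.prems] by auto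
    moreover have "nat m = nat (m - int (a k)) + a k" "nat m - a k = nat (m - int (a k))" using False by auto
    ultimately show ?thesis
      using False insert.hyps by (simp add: p_def fin_prob_nat_def power_add algebra_simps)
  qed
  note p_rec = this
  have d_rec: "d m = q ^ a k * d (m - int (a k))" for m
  proof -
    have IH: "fourier_int a q F m = of_real (if m < 0 then 0 else 2 * pi * fin_prob_nat a q F (nat m))"
      using insert by auto
    have "d m = (1 - q ^ a k) * fourier_int a q F m + q ^ a k * fourier_int a q ?F (m - int (a k)) - of_real (p m)"
      unfolding d_def by (subst fourier_int_insert) (use q insert in auto)
    also have "of_real (p m) = (1 - q ^ a k) * fourier_int a q F m + complex_of_real (q ^ a k * p (m - int (a k)))"
      by (subst p_rec) (simp only: IH of_real_add of_real_mult of_real_diff of_real_1 of_real_power)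
    finally show ?thesis by (simp add: d_def algebra_simps)
  qed
  have it: "d m = of_real ((q ^ a k) ^ j) * d (m - int j * int (a k))" for j m
  proof (induction j)
    case (Suc j)
    have e: "m - int (Suc j) * int (a k) = m - int j * int (a k) - int (a k)" by (simp add: algebra_simps)
    have "d (m - int j * int (a k)) = of_real (q ^ a k) * d (m - int (Suc j) * int (a k))"
      unfolding e by (subst d_rec) simp
    then have "d m = of_real ((q ^ a k) ^ j) * (of_real (q ^ a k) * d (m - int (Suc j) * int (a k)))"
      using Suc by simp
    then show ?case by (simp only: power_Suc of_real_mult mult.assoc mult.left_commute)
  qed simp
  have "cmod (d m) \<le> 2 * pi * (q ^ a k) ^ j" if j: "j > nat m" for j
  proof -
    have "m < int j" using j by linarith
    also have "int j \<le> int j * int (a k)" using insert.prems[of k] by (simp add: mult_le_cancel_left1)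
    finally have "d (m - int j * int (a k)) = fourier_int a q ?F (m - int j * int (a k))"
      by (simp add: d_def p_def)
    then have "cmod (d m) = (q ^ a k) ^ j * cmod (fourier_int a q ?F (m - int j * int (a k)))"
      using it[of m j] x q(1) by (simp add: norm_mult norm_power)
    also have "\<dots> \<le> (q ^ a k) ^ j * (2 * pi)"
      by (intro mult_left_mono norm_fourier_int_le[OF q]) (use x insert.prems in auto)
    finally show ?thesis by (simp add: mult_ac)
  qed
  then have ev: "\<forall>\<^sub>F j in sequentially. cmod (d m) \<le> 2 * pi * (q ^ a k) ^ j"
    by (intro eventually_mono[OF eventually_gt_at_top[of "nat m"]])
  have "(\<lambda>j. 2 * pi * (q ^ a k) ^ j) \<longlonglongrightarrow> 2 * pi * 0"
    using x by (intro tendsto_intros) auto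
  from tendsto_lowerbound[OF this ev] have "cmod (d m) \<le> 0" by simp
  then show ?case by (simp add: d_def p_def)
qed

section \<open>The local limit theorem for finitely many weights\<close>

lemma norm_exp_minus_one_le: "cmod (exp z - 1) \<le> cmod z * exp (cmod z)"
proof -
  have "cmod (exp z - exp 0) \<le> exp (cmod z) * cmod (z - 0)"
  proof (rule field_differentiable_bound[of "closed_segment 0 z" exp exp])
    fix w assume "w \<in> closed_segment 0 z"
    then have "cmod w \<le> cmod z" by (metis closed_segment_commute segment_bound(1) diff_zero)
    then have "Re w \<le> cmod z" using complex_Re_le_cmod order_trans by blast
    then show "cmod (exp w) \<le> exp (cmod z)" by simp
  qed (auto intro: DERIV_exp has_field_derivative_at_within)
  then show ?thesis by (simp add: mult.commute)
qed

text \<open>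
  Taylor expansion of the principal logarithm of \<open>1 - x e\<^bsup>ias\<^esup>\<close> along the real axis, where its real part
  stays positive.  The bound for the remainder is that of the third derivative.
\<close>

lemma geometric_cf_log:
  fixes x t :: real and a :: nat
  assumes x: "0 < x" "x < 1"
  shows "\<exists>E. (1 - x) / (1 - x * cis (a * t)) =
     exp (\<i> * of_real (a * (x / (1 - x)) * t) - of_real (a\<^sup>2 * (x / (1 - x)\<^sup>2) * t\<^sup>2 / 2) + E) \<and>
     cmod E \<le> a ^ 3 * (2 * x / (1 - x) ^ 3) * \<bar>t\<bar> ^ 3"
proof -
  define z where "z s = of_real x * exp (\<i> * of_nat a * s)" for s :: complex
  define f where "f i s = (if i = 0 then - Ln (1 - z s)
    else if i = 1 then \<i> * of_nat a * (z s / (1 - z s))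
    else if i = 2 then (\<i> * of_nat a)\<^sup>2 * (z s / (1 - z s)\<^sup>2)
    else (\<i> * of_nat a) ^ 3 * (z s * (1 + z s) / (1 - z s) ^ 3))" for i :: nat and s
  define S where "S = range complex_of_real"
  have nz: "cmod (z s) = x" if "s \<in> S" for s
    using that x by (auto simp: z_def S_def norm_mult)
  have re: "0 < Re (1 - z s)" if "s \<in> S" for s
    using nz[OF that] complex_Re_le_cmod[of "z s"] x by simp
  have n1: "1 - z s \<noteq> 0" if "s \<in> S" for s using re[OF that] by (metis order_less_irrefl zero_complex.simps(1))
  have nle: "1 - x \<le> cmod (1 - z s)" if "s \<in> S" for s
    using norm_triangle_ineq2[of 1 "z s"] nz[OF that] by simp
  have dz: "(z has_field_derivative \<i> * of_nat a * z s) (at s within S)" for s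
    unfolding z_def by (auto intro!: derivative_eq_intros)
  have "cmod (f 0 t - (\<Sum>i\<le>2. f i 0 * (of_real t - 0) ^ i / fact i)) \<le> (a ^ 3 * (2 * x / (1 - x) ^ 3)) * cmod (of_real t - 0) ^ Suc 2 / fact 2"
  proof (rule complex_Taylor[where S = S and f = f])
    show "convex S" unfolding S_def by (rule convex_linear_image[of of_real UNIV]) (auto intro: bounded_linear.linear bounded_linear_of_real)
    show "0 \<in> S" "of_real t \<in> S" by (auto simp: S_def intro: range_eqI[of 0 _ 0])
  next
    fix i s assume s: "s \<in> S" and "i \<le> (2::nat)"
    then consider "i = 0" | "i = 1" | "i = 2" by linarith
    then show "(f i has_field_derivative f (Suc i) s) (at s within S)"
    proof cases
      case 1
      have "1 - z s \<notin> \<real>\<^sub>\<le>\<^sub>0" using re[OF s] by (auto simp: complex_nonpos_Reals_iff)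
      then have "((\<lambda>s. - Ln (1 - z s)) has_field_derivative - (inverse (1 - z s) * (0 - \<i> * of_nat a * z s))) (at s within S)"
        by (intro DERIV_minus DERIV_chain'[OF DERIV_diff[OF DERIV_const dz], of Ln] has_field_derivative_Ln)
      then show ?thesis using 1 by (simp add: f_def[abs_def] field_simps)
    next
      case 2
      have "((\<lambda>s. \<i> * of_nat a * (z s / (1 - z s))) has_field_derivative \<i> * of_nat a * ((\<i> * of_nat a * z s * (1 - z s) - z s * (0 - \<i> * of_nat a * z s)) / ((1 - z s) * (1 - z s)))) (at s within S)"
        by (intro DERIV_cmult DERIV_divide DERIV_diff DERIV_const dz n1[OF s])
      moreover have "\<i> * of_nat a * ((\<i> * of_nat a * z s * (1 - z s) - z s * (0 - \<i> * of_nat a * z s)) / ((1 - z s) * (1 - z s))) = (\<i> * of_nat a)\<^sup>2 * (z s / (1 - z s)\<^sup>2)"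
        using n1[OF s] by (simp add: power2_eq_square algebra_simps)
      ultimately show ?thesis using 2 by (simp add: f_def[abs_def])
    next
      case 3
      have "((\<lambda>s. (\<i> * of_nat a)\<^sup>2 * (z s / (1 - z s)\<^sup>2)) has_field_derivative (\<i> * of_nat a)\<^sup>2 * ((\<i> * of_nat a * z s * (1 - z s)\<^sup>2 - z s * (of_nat 2 * (0 - \<i> * of_nat a * z s) * (1 - z s) ^ (2 - 1))) / ((1 - z s)\<^sup>2 * (1 - z s)\<^sup>2))) (at s within S)"
        by (intro DERIV_cmult DERIV_divide DERIV_power DERIV_diff DERIV_const dz) (use n1[OF s] in \<open>auto intro!: derivative_eq_intros dz simp: mult_ac\<close>)
      moreover have "(\<i> * of_nat a)\<^sup>2 * ((\<i> * of_nat a * z s * (1 - z s)\<^sup>2 - z s * (of_nat 2 * (0 - \<i> * of_nat a * z s) * (1 - z s) ^ (2 - 1))) / ((1 - z s)\<^sup>2 * (1 - z s)\<^sup>2)) = (\<i> * of_nat a) ^ 3 * (z s * (1 + z s) / (1 - z s) ^ 3)"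
      proof -
        have "\<i> * of_nat a * z s * (1 - z s)\<^sup>2 - z s * (of_nat 2 * (0 - \<i> * of_nat a * z s) * (1 - z s) ^ (2 - 1)) = (\<i> * of_nat a) * (z s * (1 + z s)) * (1 - z s)"
          by (simp add: power2_eq_square algebra_simps)
        moreover have "(1 - z s)\<^sup>2 * (1 - z s)\<^sup>2 = (1 - z s) ^ 3 * (1 - z s)" by (simp add: eval_nat_numeral)
        ultimately show ?thesis using n1[OF s] by (simp add: eval_nat_numeral)
      qed
      ultimately show ?thesis using 3 by (simp add: f_def[abs_def])
    qed
  next
    fix s assume s: "s \<in> S"
    have "cmod (f (Suc 2) s) = a ^ 3 * (x * cmod (1 + z s) / cmod (1 - z s) ^ 3)"
      using nz[OF s] by (simp add: f_def norm_mult norm_divide norm_power)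
    also have "\<dots> \<le> a ^ 3 * (x * 2 / (1 - x) ^ 3)"
    proof (intro mult_left_mono frac_le power_mono nle[OF s])
      show "cmod (1 + z s) \<le> 2" using norm_triangle_ineq[of 1 "z s"] nz[OF s] x by simp
    qed (use x in auto)
    finally show "cmod (f (Suc 2) s) \<le> a ^ 3 * (2 * x / (1 - x) ^ 3)" by (simp add: mult.commute)
  qed
  moreover have "(\<Sum>i\<le>2. f i 0 * (of_real t - 0) ^ i / fact i) =
      - Ln (1 - of_real x) + \<i> * of_real (a * (x / (1 - x)) * t) - of_real (a\<^sup>2 * (x / (1 - x)\<^sup>2) * t\<^sup>2 / 2)"
  proof -
    have "(\<Sum>i\<le>2. g i) = g 0 + g 1 + g (2::nat)" for g :: "nat \<Rightarrow> complex"
      by (simp add: numeral_2_eq_2)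
    then show ?thesis
      by (simp add: f_def z_def power_mult_distrib)
  qed
  ultimately have T: "cmod (f 0 t - (- Ln (1 - of_real x) + \<i> * of_real (a * (x / (1 - x)) * t) - of_real (a\<^sup>2 * (x / (1 - x)\<^sup>2) * t\<^sup>2 / 2)))
     \<le> (a ^ 3 * (2 * x / (1 - x) ^ 3)) * \<bar>t\<bar> ^ 3 / 2" by simp
  define E where "E = f 0 t - (- Ln (1 - of_real x) + \<i> * of_real (a * (x / (1 - x)) * t) - of_real (a\<^sup>2 * (x / (1 - x)\<^sup>2) * t\<^sup>2 / 2))"
  have "cmod E \<le> (a ^ 3 * (2 * x / (1 - x) ^ 3)) * \<bar>t\<bar> ^ 3 / 2" unfolding E_def by (rule T)
  also have "\<dots> \<le> a ^ 3 * (2 * x / (1 - x) ^ 3) * \<bar>t\<bar> ^ 3"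
  proof -
    have "0 \<le> a ^ 3 * (2 * x / (1 - x) ^ 3) * \<bar>t\<bar> ^ 3" using x by simp
    moreover have "y / 2 \<le> y" if "0 \<le> y" for y :: real using that by simp
    ultimately show ?thesis by blast
  qed
  finally have E: "cmod E \<le> a ^ 3 * (2 * x / (1 - x) ^ 3) * \<bar>t\<bar> ^ 3" .
  have "\<i> * of_real (a * (x / (1 - x)) * t) - of_real (a\<^sup>2 * (x / (1 - x)\<^sup>2) * t\<^sup>2 / 2) + E = Ln (1 - of_real x) - Ln (1 - z t)"
    by (simp add: E_def f_def)
  moreover have "1 - z t \<noteq> 0" by (rule n1) (simp add: S_def)
  moreover have "1 - complex_of_real x \<noteq> 0" using x by (metis eq_iff_diff_eq_0 of_real_eq_1_iff order_less_irrefl)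
  ultimately have "exp (\<i> * of_real (a * (x / (1 - x)) * t) - of_real (a\<^sup>2 * (x / (1 - x)\<^sup>2) * t\<^sup>2 / 2) + E) = (1 - of_real x) / (1 - z t)"
    by (simp add: exp_diff)
  moreover have "z t = x * cis (a * t)" by (simp add: z_def cis_conv_exp mult_ac)
  ultimately show ?thesis using E by (intro exI[of _ E]) auto
qed

definition gmean :: "('k \<Rightarrow> nat) \<Rightarrow> real \<Rightarrow> 'k \<Rightarrow> real" where
  "gmean a q k = real (a k) * (q ^ a k / (1 - q ^ a k))"

definition gvar :: "('k \<Rightarrow> nat) \<Rightarrow> real \<Rightarrow> 'k \<Rightarrow> real" where
  "gvar a q k = (real (a k))\<^sup>2 * (q ^ a k / (1 - q ^ a k)\<^sup>2)"

text \<open>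
  A bound for the third derivative of the logarithm of the characteristic function.
\<close>

definition gthird :: "('k \<Rightarrow> nat) \<Rightarrow> real \<Rightarrow> 'k \<Rightarrow> real" where
  "gthird a q k = real (a k) ^ 3 * (2 * q ^ a k / (1 - q ^ a k) ^ 3)"

lemma geom_cf_log:
  assumes "0 < q" "q < 1" "\<And>k. k \<in> F \<Longrightarrow> 1 \<le> a k" "finite F"
  shows "\<exists>E. geom_cf a q F t = exp (\<i> * of_real (sum (gmean a q) F * t) - of_real (sum (gvar a q) F * t\<^sup>2 / 2) + E) \<and>
    cmod E \<le> sum (gthird a q) F * \<bar>t\<bar> ^ 3"
  using assms(4,3)
proof (induction F rule: finite_induct)
  case empty
  then show ?case by (intro exI[of _ 0]) (simp add: geom_cf_def)
next
  case (insert k F)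
  obtain E where E: "geom_cf a q F t = exp (\<i> * of_real (sum (gmean a q) F * t) - of_real (sum (gvar a q) F * t\<^sup>2 / 2) + E)"
    "cmod E \<le> sum (gthird a q) F * \<bar>t\<bar> ^ 3" using insert by auto
  have x: "0 < q ^ a k" "q ^ a k < 1" using assms(1,2) insert.prems[of k] by (auto simp: power_less_one_iff)
  obtain E' where E': "(1 - q ^ a k) / (1 - (q ^ a k) * cis (a k * t)) = exp (\<i> * of_real (gmean a q k * t) - of_real (gvar a q k * t\<^sup>2 / 2) + E')"
     "cmod E' \<le> gthird a q k * \<bar>t\<bar> ^ 3"
    using geometric_cf_log[OF x, of "a k" t] unfolding gmean_def gvar_def gthird_def by auto
  have "geom_cf a q (insert k F) t = ((1 - q ^ a k) / (1 - (q ^ a k) * cis (a k * t))) * geom_cf a q F t"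
    using insert.hyps by (simp add: geom_cf_def)
  also have "\<dots> = exp (\<i> * of_real (sum (gmean a q) (insert k F) * t) - of_real (sum (gvar a q) (insert k F) * t\<^sup>2 / 2) + (E' + E))"
    unfolding E E' using insert.hyps by (simp add: exp_add[symmetric] algebra_simps add_divide_distrib)
  finally show ?case
    using E(2) E'(2) norm_triangle_ineq[of E' E] insert.hyps
    by (intro exI[of _ "E' + E"]) (auto simp: algebra_simps)
qed

text \<open>
  The density of the centred normal distribution of variance \<open>v\<close>, times \<open>2\<pi>\<close>.
\<close>

definition gauss :: "real \<Rightarrow> real \<Rightarrow> real" where
  "gauss v x = sqrt (2 * pi / v) * exp (- x\<^sup>2 / (2 * v))"

lemma gauss_fourier:
  assumes v: "0 < v"
  shows "integrable lborel (\<lambda>t. cis (s * t) * of_real (exp (- v * t\<^sup>2 / 2)))"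
    and "(LINT t|lborel. cis (s * t) * of_real (exp (- v * t\<^sup>2 / 2))) = of_real (gauss v s)"
proof -
  let ?f = "\<lambda>t. cis (s * t) * of_real (exp (- v * t\<^sup>2 / 2)) :: complex"
  define c where "c = 1 / sqrt v"
  have c: "c > 0" "v * c\<^sup>2 = 1" using v by (auto simp: c_def power_divide)
  have eq: "?f (0 + c * x) = sqrt (2 * pi) * (std_normal_density x *\<^sub>R iexp ((s * c) * x))" for x
  proof -
    have "v * (c * x)\<^sup>2 = x\<^sup>2" using c by (simp add: power_mult_distrib)
    then show ?thesis by (simp add: std_normal_density_def cis_conv_exp scaleR_conv_of_real mult_ac)
  qed
  have i0: "integrable lborel (\<lambda>x. std_normal_density x *\<^sub>R iexp ((s * c) * x))"
  proof -
    interpret std: real_distribution std_normal_distribution by (rule real_dist_normal_dist)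
    have "integrable std_normal_distribution (\<lambda>x. iexp ((s * c) * x))"
      by (rule std.integrable_iexp) simp_all
    then show ?thesis by (subst (asm) integrable_density) (auto simp: normal_density_nonneg)
  qed
  have i: "integrable lborel (\<lambda>x. ?f (0 + c * x))"
    unfolding eq by (intro integrable_mult_right i0)
  show int: "integrable lborel ?f"
    using i lborel_integrable_real_affine_iff[of c ?f 0] c by simp
  have "(LINT t|lborel. ?f t) = \<bar>c\<bar> *\<^sub>R (LINT x|lborel. ?f (0 + c * x))"
    by (rule lborel_integral_real_affine) (use c in auto)
  also have "\<dots> = c *\<^sub>R (sqrt (2 * pi) * char std_normal_distribution (s * c))"
  proof -
    have "(LINT x|lborel. ?f (0 + c * x)) = sqrt (2 * pi) * (LINT x|lborel. std_normal_density x *\<^sub>R iexp ((s * c) * x))"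
      by (simp only: eq integral_mult_right_zero)
    also have "(LINT x|lborel. std_normal_density x *\<^sub>R iexp ((s * c) * x)) = char std_normal_distribution (s * c)"
      by (simp add: char_def integral_density normal_density_nonneg)
    finally show ?thesis using c by simp
  qed
  also have "\<dots> = of_real (gauss v s)"
    by (simp add: gauss_def char_std_normal_distribution c_def real_sqrt_divide scaleR_conv_of_real power_mult_distrib power_divide v real_sqrt_mult abs_of_pos less_imp_le)
  finally show "(LINT t|lborel. ?f t) = of_real (gauss v s)" .
qed

lemma gauss_third:
  assumes v: "0 < v"
  shows "integrable lborel (\<lambda>t::real. \<bar>t\<bar> ^ 3 * exp (- v * t\<^sup>2 / 4))"
    and "(LINT t|lborel. \<bar>t\<bar> ^ 3 * exp (- v * t\<^sup>2 / 4)) = 16 / v\<^sup>2"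
proof -
  let ?f = "\<lambda>t::real. \<bar>t\<bar> ^ 3 * exp (- v * t\<^sup>2 / 4)"
  define c where "c = sqrt (2 / v)"
  have c: "c > 0" "v * c\<^sup>2 = 2" using v by (auto simp: c_def)
  have c4: "c * c ^ 3 = 4 / v\<^sup>2"
  proof -
    have "c * c ^ 3 = (c\<^sup>2)\<^sup>2" by (simp add: eval_nat_numeral)
    also have "\<dots> = 4 / v\<^sup>2" using v by (simp add: c_def power_divide)
    finally show ?thesis .
  qed
  have eq: "?f (0 + c * x) = (c ^ 3 * sqrt (2 * pi)) * (std_normal_density x * \<bar>x\<bar> ^ (2 * 1 + 1))" for x
  proof -
    have "v * (c * x)\<^sup>2 = 2 * x\<^sup>2" using c by (simp add: power_mult_distrib)
    then have "exp (- v * (0 + c * x)\<^sup>2 / 4) = exp (- x\<^sup>2 / 2)" by simp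
    moreover have "\<bar>0 + c * x\<bar> ^ 3 = c ^ 3 * \<bar>x\<bar> ^ (2 * 1 + 1)"
      using c by (simp add: abs_mult power_mult_distrib)
    ultimately show ?thesis by (simp only:) (simp add: std_normal_density_def)
  qed
  note m = std_normal_moment_abs_odd[of 1, unfolded has_bochner_integral_iff]
  have i: "integrable lborel (\<lambda>x. ?f (0 + c * x))"
    unfolding eq using m by (intro integrable_mult_right) auto
  show int: "integrable lborel ?f"
    using i lborel_integrable_real_affine_iff[of c ?f 0] c by simp
  have "(LINT t|lborel. ?f t) = \<bar>c\<bar> *\<^sub>R (LINT x|lborel. ?f (0 + c * x))"
    by (rule lborel_integral_real_affine) (use c in auto)
  also have "(LINT x|lborel. ?f (0 + c * x)) = (c ^ 3 * sqrt (2 * pi)) * (sqrt (2 / pi) * 2 ^ 1 * fact 1)"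
    unfolding eq using m by (simp only: integral_mult_right_zero)
  also have "\<bar>c\<bar> *\<^sub>R (c ^ 3 * sqrt (2 * pi) * (sqrt (2 / pi) * 2 ^ 1 * fact 1)) = (c * c ^ 3) * (sqrt (2 * pi) * (sqrt (2 / pi) * 2 ^ 1 * fact 1))"
    using c by simp
  also have "sqrt (2 * pi) * (sqrt (2 / pi) * 2 ^ 1 * fact 1) = 4"
    by (simp add: real_sqrt_mult[symmetric] mult.assoc[symmetric])
  finally show "(LINT t|lborel. ?f t) = 16 / v\<^sup>2" unfolding c4 by simp
qed

text \<open>
  Extended by zero to negative arguments: then the estimate below also shows that the point where it
  is applied cannot be negative unless the Gaussian term is small.
\<close>

definition fin_prob :: "('k \<Rightarrow> nat) \<Rightarrow> real \<Rightarrow> 'k set \<Rightarrow> int \<Rightarrow> real" where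
  "fin_prob a q F m = (if m < 0 then 0 else fin_prob_nat a q F (nat m))"

text \<open>
  Compare the two Fourier integrals.  For \<open>|t| \<le> T\<close> the logarithms differ by at most \<open>\<tau> |t|\<^sup>3\<close>, which the
  condition on \<open>T\<close> keeps within half of the quadratic term.  Beyond \<open>T\<close> both integrands are small,
  the Gaussian one because \<open>1 \<le> (|t| / T)\<^sup>3\<close>.
\<close>

theorem local_limit_finite:
  assumes F: "finite F" and q: "0 < q" "q < 1" and a: "\<And>k. k \<in> F \<Longrightarrow> 1 \<le> a k"
  defines "\<mu> \<equiv> sum (gmean a q) F" and "v \<equiv> sum (gvar a q) F" and "\<tau> \<equiv> sum (gthird a q) F"
  assumes v: "0 < v" and T: "0 < T" "T \<le> pi" "\<tau> * T \<le> v / 4"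
    and minor: "\<And>t. T \<le> \<bar>t\<bar> \<Longrightarrow> \<bar>t\<bar> \<le> pi \<Longrightarrow> cmod (geom_cf a q F t) \<le> \<epsilon>"
  shows "\<bar>2 * pi * fin_prob a q F m - gauss v (real_of_int m - \<mu>)\<bar> \<le> (\<tau> + 1 / T ^ 3) * (16 / v\<^sup>2) + 2 * pi * \<epsilon>"
proof -
  define s where "s = \<mu> - real_of_int m"
  let ?G = "\<lambda>t. cis (s * t) * of_real (exp (- v * t\<^sup>2 / 2)) :: complex"
  let ?J = "\<lambda>t. indicator {-pi..pi} t *\<^sub>R (cis (- real_of_int m * t) * geom_cf a q F t)"
  let ?B = "\<lambda>t. (\<tau> + 1 / T ^ 3) * (\<bar>t\<bar> ^ 3 * exp (- v * t\<^sup>2 / 4)) + \<epsilon> * indicator {-pi..pi} t :: real"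
  have e0: "0 \<le> \<epsilon>" using minor[of T] T by (smt (verit) norm_ge_zero)
  have "0 \<le> gthird a q k" if "k \<in> F" for k
  proof -
    have "0 < q ^ a k" "q ^ a k < 1" using q a[OF that] by (auto simp: power_less_one_iff)
    then show ?thesis by (simp add: gthird_def)
  qed
  then have tau: "0 \<le> \<tau>" by (simp add: \<tau>_def sum_nonneg)
  have iJ: "integrable lborel ?J" by (rule integrable_fourier_int[OF q a])
  have iG: "integrable lborel ?G" by (rule gauss_fourier(1)[OF v])
  have i3: "integrable lborel (\<lambda>t::real. (\<tau> + 1 / T ^ 3) * (\<bar>t\<bar> ^ 3 * exp (- v * t\<^sup>2 / 4)))"
    by (intro integrable_mult_right gauss_third(1)[OF v])
  have iI: "integrable lborel (\<lambda>t. \<epsilon> * indicator {-pi..pi} t :: real)"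
    by (intro integrable_mult_right) simp
  have iB: "integrable lborel ?B" using i3 iI by (rule Bochner_Integration.integrable_add)
  have tailb: "exp (- v * t\<^sup>2 / 2) \<le> (1 / T ^ 3) * (\<bar>t\<bar> ^ 3 * exp (- v * t\<^sup>2 / 4))" if "T \<le> \<bar>t\<bar>" for t
  proof -
    have "T ^ 3 \<le> \<bar>t\<bar> ^ 3" using that T by (intro power_mono) auto
    then have "1 \<le> \<bar>t\<bar> ^ 3 / T ^ 3" using T by simp
    moreover have "exp (- v * t\<^sup>2 / 2) \<le> exp (- v * t\<^sup>2 / 4)" using v by simp
    ultimately have "1 * exp (- v * t\<^sup>2 / 2) \<le> (\<bar>t\<bar> ^ 3 / T ^ 3) * exp (- v * t\<^sup>2 / 4)"
      by (intro mult_mono) auto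
    then show ?thesis by simp
  qed
  have nG: "cmod (?G t) = exp (- v * t\<^sup>2 / 2)" for t by (simp add: norm_mult)
  have B3: "(1 / T ^ 3) * (\<bar>t\<bar> ^ 3 * exp (- v * t\<^sup>2 / 4)) \<le> (\<tau> + 1 / T ^ 3) * (\<bar>t\<bar> ^ 3 * exp (- v * t\<^sup>2 / 4))" for t
    using tau by (intro mult_right_mono) auto
  have bound: "cmod (?J t - ?G t) \<le> ?B t" for t
  proof (cases "\<bar>t\<bar> \<le> T")
    case True
    then have t: "t \<in> {-pi..pi}" using T by auto
    obtain E where E: "geom_cf a q F t = exp (\<i> * of_real (\<mu> * t) - of_real (v * t\<^sup>2 / 2) + E)"
      "cmod E \<le> \<tau> * \<bar>t\<bar> ^ 3"
      using geom_cf_log[where F = F and a = a and t = t, OF q a F] unfolding \<mu>_def v_def \<tau>_def by blast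
    have "cis (- real_of_int m * t) * geom_cf a q F t = ?G t * exp E"
    proof -
      have "cis (- real_of_int m * t) * geom_cf a q F t = exp (\<i> * of_real (- real_of_int m * t) + (\<i> * of_real (\<mu> * t) - of_real (v * t\<^sup>2 / 2) + E))"
        by (simp only: E(1) cis_conv_exp exp_add)
      also have "\<i> * of_real (- real_of_int m * t) + (\<i> * of_real (\<mu> * t) - of_real (v * t\<^sup>2 / 2) + E) = \<i> * of_real (s * t) + of_real (- v * t\<^sup>2 / 2) + E"
        by (simp add: s_def algebra_simps)
      finally show ?thesis by (simp only: cis_conv_exp exp_add exp_of_real)
    qed
    then have "cmod (?J t - ?G t) = cmod (?G t * (exp E - 1))" using t by (simp add: algebra_simps)
    also have "\<dots> = exp (- v * t\<^sup>2 / 2) * cmod (exp E - 1)" by (simp only: norm_mult norm_cis norm_of_real abs_exp_cancel mult_1)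
    also have "\<dots> \<le> exp (- v * t\<^sup>2 / 2) * (\<tau> * \<bar>t\<bar> ^ 3 * exp (v * t\<^sup>2 / 4))"
    proof (intro mult_left_mono)
      have "cmod E \<le> \<tau> * \<bar>t\<bar> ^ 3" by (rule E(2))
      also have "\<dots> = (\<tau> * \<bar>t\<bar>) * t\<^sup>2" by (simp add: eval_nat_numeral)
      also have "\<dots> \<le> (v / 4) * t\<^sup>2"
      proof (intro mult_right_mono)
        have "\<tau> * \<bar>t\<bar> \<le> \<tau> * T" using True tau by (rule mult_left_mono)
        then show "\<tau> * \<bar>t\<bar> \<le> v / 4" using T by linarith
      qed auto
      finally have E4: "cmod E \<le> v * t\<^sup>2 / 4" by simp
      have "cmod (exp E - 1) \<le> cmod E * exp (cmod E)" by (rule norm_exp_minus_one_le)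
      also have "\<dots> \<le> \<tau> * \<bar>t\<bar> ^ 3 * exp (v * t\<^sup>2 / 4)" using E(2) E4 tau by (intro mult_mono) auto
      finally show "cmod (exp E - 1) \<le> \<tau> * \<bar>t\<bar> ^ 3 * exp (v * t\<^sup>2 / 4)" .
    qed auto
    also have "\<dots> = \<tau> * \<bar>t\<bar> ^ 3 * (exp (- v * t\<^sup>2 / 2) * exp (v * t\<^sup>2 / 4))" by (simp only: mult_ac)
    also have "exp (- v * t\<^sup>2 / 2) * exp (v * t\<^sup>2 / 4) = exp (- v * t\<^sup>2 / 4)"
      by (simp add: exp_add[symmetric])
    also have "\<tau> * \<bar>t\<bar> ^ 3 * exp (- v * t\<^sup>2 / 4) \<le> (\<tau> + 1 / T ^ 3) * (\<bar>t\<bar> ^ 3 * exp (- v * t\<^sup>2 / 4))"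
      using T by (simp add: mult.assoc mult_right_mono)
    finally have "cmod (?J t - ?G t) \<le> (\<tau> + 1 / T ^ 3) * (\<bar>t\<bar> ^ 3 * exp (- v * t\<^sup>2 / 4))" .
    moreover have "0 \<le> \<epsilon> * indicator {-pi..pi} t" using e0 by simp
    ultimately show ?thesis by linarith
  next
    case False
    then have t: "T \<le> \<bar>t\<bar>" by simp
    show ?thesis
    proof (cases "\<bar>t\<bar> \<le> pi")
      case True
      then have "t \<in> {-pi..pi}" by auto
      then have "cmod (?J t) \<le> \<epsilon>" using minor[OF t True] by (simp add: norm_mult)
      then have "cmod (?J t - ?G t) \<le> \<epsilon> + exp (- v * t\<^sup>2 / 2)"
        using norm_triangle_ineq4[of "?J t" "?G t"] nG[of t] by linarith
      then show ?thesis using tailb[OF t] B3[of t] \<open>t \<in> {-pi..pi}\<close> by simp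
    next
      case False
      then have "t \<notin> {-pi..pi}" by auto
      then show ?thesis using tailb[OF t] B3[of t] nG[of t] by simp
    qed
  qed
  have "2 * pi * fin_prob a q F m = fourier_int a q F m"
    using Fourier_inversion[OF F q a] by (simp add: fin_prob_def)
  also have "\<dots> = (LINT t|lborel. ?J t)" by (simp add: fourier_int_def)
  finally have P: "(LINT t|lborel. ?J t) = of_real (2 * pi * fin_prob a q F m)" by simp
  let ?D = "2 * pi * fin_prob a q F m - gauss v s"
  have "\<bar>?D\<bar> = cmod (of_real ?D)" by (simp only: norm_of_real)
  also have "cmod (of_real ?D) = cmod (LINT t|lborel. ?J t - ?G t)"
    by (subst Bochner_Integration.integral_diff[OF iJ iG]) (simp only: P gauss_fourier(2)[OF v] of_real_diff)
  also have "\<dots> \<le> (LINT t|lborel. ?B t)"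
    by (rule Bochner_Integration.integral_norm_bound_integral[OF Bochner_Integration.integrable_diff[OF iJ iG] iB bound])
  also have "\<dots> = (\<tau> + 1 / T ^ 3) * (16 / v\<^sup>2) + \<epsilon> * (2 * pi)"
    by (subst Bochner_Integration.integral_add[OF i3 iI], simp only: integral_mult_right_zero gauss_third(2)[OF v]) simp
  finally show ?thesis by (simp add: gauss_def s_def power2_commute mult_ac)
qed

section \<open>Uniformity in the set of weights\<close>

definition irr_dim :: "nat \<Rightarrow> (nat \<Rightarrow> nat) \<Rightarrow> nat" where
  "irr_dim r k = nat \<lfloor>wdim r k\<rfloor>"

lemma real_irr_dim: "k \<in> weights r \<Longrightarrow> real (irr_dim r k) = wdim r k"
  using wdim_Ints[of r k] wdim_ge_1[of k r] by (auto simp: irr_dim_def elim!: Ints_cases)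

lemma irr_dim_ge_1: "k \<in> weights r \<Longrightarrow> 1 \<le> irr_dim r k"
  using real_irr_dim[of k r] wdim_ge_1[of k r] by linarith

text \<open>
  The parameter for which weights with coordinates of size about \<open>K\<close> have dimension about
  \<open>1 / (- ln q)\<close>.
\<close>

definition scaled_q :: "nat \<Rightarrow> real \<Rightarrow> real" where
  "scaled_q r K = exp (- 1 / K ^ wdeg r)"

lemma scaled_q_bounds: "0 < K \<Longrightarrow> 0 < scaled_q r K \<and> scaled_q r K < 1"
  by (simp add: scaled_q_def)

lemma scaled_q_power: "scaled_q r K ^ n = exp (- (real n / K ^ wdeg r))"
  by (simp add: scaled_q_def exp_of_nat_mult[symmetric])

lemma cumulant_sums_le:
  assumes r: "2 \<le> r"
  shows "\<exists>C>0. \<forall>K>0. \<forall>F. finite F \<longrightarrow> F \<subseteq> weights r \<longrightarrow>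
     sum (gmean (irr_dim r) (scaled_q r K)) F \<le> C * (K ^ wdeg r * K ^ r) \<and>
     sum (gvar (irr_dim r) (scaled_q r K)) F \<le> C * var_scale r K \<and>
     sum (gthird (irr_dim r) (scaled_q r K)) F \<le> C * (K ^ (3 * wdeg r) * K ^ r)"
proof -
  obtain C where C: "C > 0" "\<And>K F. K > 0 \<Longrightarrow> finite F \<Longrightarrow> F \<subseteq> weights r \<Longrightarrow>
     (\<Sum>k\<in>F. min 1 (K ^ wdeg r / wdim r k)) \<le> C * K ^ r"
    using sum_min_wdim_le[OF r] by blast
  have "sum (gmean (irr_dim r) (scaled_q r K)) F \<le> (96 * C) * (K ^ wdeg r * K ^ r) \<and>
     sum (gvar (irr_dim r) (scaled_q r K)) F \<le> (96 * C) * var_scale r K \<and>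
     sum (gthird (irr_dim r) (scaled_q r K)) F \<le> (96 * C) * (K ^ (3 * wdeg r) * K ^ r)"
    if K: "K > 0" and F: "finite F" "F \<subseteq> weights r" for K F
  proof -
    let ?M = "K ^ wdeg r"
    have M: "?M > 0" using K by simp
    have aux: "sum g F \<le> (96 * C) * (N * K ^ r)"
      if g: "\<And>k. k \<in> F \<Longrightarrow> g k \<le> 96 * (N * min 1 (?M / wdim r k))" and N: "N > 0" for g N
    proof -
      have "sum g F \<le> (\<Sum>k\<in>F. 96 * (N * min 1 (?M / wdim r k)))" by (rule sum_mono[OF g])
      also have "\<dots> = 96 * N * (\<Sum>k\<in>F. min 1 (?M / wdim r k))" by (simp add: sum_distrib_left mult.assoc)
      also have "\<dots> \<le> 96 * N * (C * K ^ r)" using C(2)[OF K F] N by (intro mult_left_mono) auto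
      finally show ?thesis by (simp add: mult_ac)
    qed
    have u: "0 < real (irr_dim r k) / ?M" "?M / wdim r k = 1 / (real (irr_dim r k) / ?M)"
       "real (irr_dim r k) = ?M * (real (irr_dim r k) / ?M)" "0 \<le> min 1 (?M / wdim r k)" if "k \<in> F" for k
    proof -
      have kW: "k \<in> weights r" using that F by auto
      show "0 < real (irr_dim r k) / ?M" using irr_dim_ge_1[OF kW] M by simp
      show "?M / wdim r k = 1 / (real (irr_dim r k) / ?M)" by (simp add: real_irr_dim[OF kW])
      show "real (irr_dim r k) = ?M * (real (irr_dim r k) / ?M)" using K by simp
      show "0 \<le> min 1 (?M / wdim r k)" using wdim_pos[OF kW] M by simp
    qed
    have "gmean (irr_dim r) (scaled_q r K) k \<le> 96 * (?M * min 1 (?M / wdim r k))" if k: "k \<in> F" for k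
    proof -
      define v where "v = real (irr_dim r k) / ?M"
      have v: "0 < v" "real (irr_dim r k) = ?M * v" "?M / wdim r k = 1 / v" using u[OF k] by (auto simp: v_def)
      have "gmean (irr_dim r) (scaled_q r K) k = ?M * (v * (exp (- v) / (1 - exp (- v))))"
        unfolding gmean_def scaled_q_power v_def[symmetric] v(2) by simp
      also have "\<dots> \<le> ?M * (2 * min 1 (1 / v))"
        using mean_geometric_le[OF v(1)] M by (intro mult_left_mono) auto
      also have "\<dots> \<le> ?M * (96 * min 1 (1 / v))" using u(4)[OF k] M unfolding v(3) by (intro mult_left_mono) auto
      finally show ?thesis unfolding v(3) by (simp add: mult_ac)
    qed
    moreover have "gvar (irr_dim r) (scaled_q r K) k \<le> 96 * (K ^ (2 * wdeg r) * min 1 (?M / wdim r k))" if k: "k \<in> F" for k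
    proof -
      define v where "v = real (irr_dim r k) / ?M"
      have v: "0 < v" "real (irr_dim r k) = ?M * v" "?M / wdim r k = 1 / v" using u[OF k] by (auto simp: v_def)
      have "gvar (irr_dim r) (scaled_q r K) k = ?M\<^sup>2 * (v\<^sup>2 * geom_var v)"
        unfolding gvar_def scaled_q_power v_def[symmetric] geom_var_def v(2) by (simp add: power_mult_distrib)
      also have "\<dots> \<le> ?M\<^sup>2 * (24 * min 1 (1 / v))"
        using geom_var_square_le[OF v(1)] M by (intro mult_left_mono) auto
      also have "\<dots> \<le> ?M\<^sup>2 * (96 * min 1 (1 / v))" using u(4)[OF k] M unfolding v(3) by (intro mult_left_mono) auto
      finally show ?thesis unfolding v(3) by (simp add: mult_ac power_mult[symmetric])
    qed
    moreover have "gthird (irr_dim r) (scaled_q r K) k \<le> 96 * (K ^ (3 * wdeg r) * min 1 (?M / wdim r k))" if k: "k \<in> F" for k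
    proof -
      define v where "v = real (irr_dim r k) / ?M"
      have v: "0 < v" "real (irr_dim r k) = ?M * v" "?M / wdim r k = 1 / v" using u[OF k] by (auto simp: v_def)
      have "gthird (irr_dim r) (scaled_q r K) k = ?M ^ 3 * (v ^ 3 * (2 * exp (- v) / (1 - exp (- v)) ^ 3))"
        unfolding gthird_def scaled_q_power v_def[symmetric] v(2) by (simp add: power_mult_distrib)
      also have "\<dots> \<le> ?M ^ 3 * (96 * min 1 (1 / v))"
        using third_cumulant_le[OF v(1)] M by (intro mult_left_mono) auto
      finally show ?thesis unfolding v(3) by (simp add: mult_ac power_mult[symmetric])
    qed
    ultimately show ?thesis using M K by (auto intro!: aux)
  qed
  then show ?thesis using C(1) by (intro exI[of _ "96 * C"]) auto
qed

lemma gvar_nonneg: "0 < q \<Longrightarrow> q < 1 \<Longrightarrow> 0 \<le> gvar a q k"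
  by (simp add: gvar_def)

lemma gmean_nonneg: "0 < q \<Longrightarrow> q < 1 \<Longrightarrow> 0 \<le> gmean a q k"
  by (simp add: gmean_def power_le_one)

lemma gvar_weight_box_ge:
  assumes k: "k \<in> weight_box r (B * K)" and K: "0 < K" and B: "0 < B"
  shows "exp (- ((real r * B) ^ wdeg r)) * K ^ (2 * wdeg r) \<le> gvar (irr_dim r) (scaled_q r K) k"
    and "exp (- ((real r * B) ^ wdeg r)) \<le> geom_var (real (irr_dim r k) / K ^ wdeg r)"
proof -
  define v where "v = real (irr_dim r k) / K ^ wdeg r"
  have kW: "k \<in> weights r" using k by (auto simp: weight_box_def)
  have v0: "0 < v" using irr_dim_ge_1[OF kW] K by (simp add: v_def)
  have "real (irr_dim r k) \<le> (real r * (B * K)) ^ wdeg r"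
    unfolding real_irr_dim[OF kW] using K B by (intro wdim_weight_box_le[OF k]) auto
  also have "\<dots> = (real r * B) ^ wdeg r * K ^ wdeg r" by (simp add: power_mult_distrib)
  finally have v1: "v \<le> (real r * B) ^ wdeg r" using K by (simp add: v_def field_simps)
  show "exp (- ((real r * B) ^ wdeg r)) \<le> geom_var (real (irr_dim r k) / K ^ wdeg r)"
    using geom_var_ge[OF v0 v1] by (simp add: v_def)
  have e: "real (irr_dim r k) = K ^ wdeg r * v" using K by (simp add: v_def)
  have "gvar (irr_dim r) (scaled_q r K) k = (K ^ wdeg r)\<^sup>2 * (v\<^sup>2 * geom_var v)"
    unfolding gvar_def scaled_q_power v_def[symmetric] geom_var_def e by (simp add: power_mult_distrib)
  then show "exp (- ((real r * B) ^ wdeg r)) * K ^ (2 * wdeg r) \<le> gvar (irr_dim r) (scaled_q r K) k"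
    using geom_var_ge2[OF v0 v1] K by (simp add: power_mult[symmetric] mult.commute)
qed

text \<open>
  Every weight of the box carries variance at least of order \<open>K\<^bsup>2R\<^esup>\<close>, so little missing variance means few
  missing weights.
\<close>

lemma card_missing_le:
  assumes K: "0 < K" and B: "0 < B"
    and miss: "sum (gvar (irr_dim r) (scaled_q r K)) (weight_box r (B * K) - F) \<le> d * var_scale r K"
  shows "real (card (weight_box r (B * K) - F)) \<le> d * exp ((real r * B) ^ wdeg r) * K ^ r"
proof -
  let ?e = "exp (- ((real r * B) ^ wdeg r))"
  have "real (card (weight_box r (B * K) - F)) * (?e * K ^ (2 * wdeg r)) \<le> sum (gvar (irr_dim r) (scaled_q r K)) (weight_box r (B * K) - F)"
    using sum_bounded_below[of "weight_box r (B * K) - F" "?e * K ^ (2 * wdeg r)" "gvar (irr_dim r) (scaled_q r K)"]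
      gvar_weight_box_ge(1)[OF _ K B, of _ r] by auto
  with miss have "real (card (weight_box r (B * K) - F)) * (?e * K ^ (2 * wdeg r)) \<le> d * var_scale r K" by linarith
  then have "(real (card (weight_box r (B * K) - F)) * ?e) * K ^ (2 * wdeg r) \<le> (d * K ^ r) * K ^ (2 * wdeg r)"
    by (simp only: mult_ac)
  then have "real (card (weight_box r (B * K) - F)) * ?e \<le> d * K ^ r"
    using K by (simp only: mult_le_cancel_right_pos zero_less_power)
  then show ?thesis by (simp add: exp_minus field_simps)
qed

lemma weight_box_mono: "L \<le> L' \<Longrightarrow> weight_box r L \<subseteq> weight_box r L'"
  by (auto simp: weight_box_def intro: order_trans)

text \<open>
  The squared modulus of a single factor is \<open>1 / (1 + 4 w (sin (a t / 2))\<^sup>2)\<close>, where \<open>w\<close> is the variance of the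
  geometric variable.
\<close>

lemma norm_geom_cf_le_power:
  assumes q: "0 < q" "q < 1" and F: "finite F" "G \<subseteq> F" and a: "\<And>k. k \<in> F \<Longrightarrow> 1 \<le> a k"
    and G: "\<And>k. k \<in> G \<Longrightarrow> e \<le> q ^ a k / (1 - q ^ a k)\<^sup>2" "\<And>k. k \<in> G \<Longrightarrow> s \<le> \<bar>sin (real (a k) * t / 2)\<bar>"
    and es: "0 < e" "0 < s"
  shows "cmod (geom_cf a q F t) \<le> (1 / sqrt (1 + 4 * e * s\<^sup>2)) ^ card G"
proof -
  have nb: "cmod ((1 - q ^ a k) / (1 - q ^ a k * cis (real (a k) * t))) \<le> (if k \<in> G then 1 / sqrt (1 + 4 * e * s\<^sup>2) else 1)" if k: "k \<in> F" for k
  proof -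
    have x: "0 < q ^ a k" "q ^ a k < 1" using q a[OF k] by (auto simp: power_less_one_iff)
    define x where "x = q ^ a k"
    define S where "S = sin (real (a k) * t / 2)"
    have x01: "0 < x" "x < 1" using x by (auto simp: x_def)
    have n1: "cmod (1 - complex_of_real x) = 1 - x"
      using x01 by (metis abs_of_pos diff_gt_0_iff_gt norm_of_real of_real_1 of_real_diff)
    have "(cmod ((1 - x) / (1 - x * cis (real (a k) * t))))\<^sup>2 = (1 - x)\<^sup>2 / ((1 - x)\<^sup>2 + 4 * x * S\<^sup>2)"
      unfolding norm_divide power_divide norm_one_minus_cis S_def by (simp add: n1)
    also have "\<dots> = 1 / (1 + 4 * (x / (1 - x)\<^sup>2) * S\<^sup>2)"
      using x01 by (simp add: field_simps)
    finally have sq: "(cmod ((1 - x) / (1 - x * cis (real (a k) * t))))\<^sup>2 = 1 / (1 + 4 * (x / (1 - x)\<^sup>2) * S\<^sup>2)" .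
    show ?thesis
    proof (cases "k \<in> G")
      case True
      have "s\<^sup>2 \<le> S\<^sup>2" using G(2)[OF True] es by (simp add: S_def abs_le_square_iff[symmetric])
      then have "4 * e * s\<^sup>2 \<le> 4 * (x / (1 - x)\<^sup>2) * S\<^sup>2"
        using G(1)[OF True] es by (intro mult_mono) (auto simp: x_def)
      moreover have "0 \<le> 4 * e * s\<^sup>2" using es by simp
      ultimately have "1 / (1 + 4 * (x / (1 - x)\<^sup>2) * S\<^sup>2) \<le> 1 / (1 + 4 * e * s\<^sup>2)"
        by (intro divide_left_mono mult_pos_pos) linarith+
      then have "(cmod ((1 - x) / (1 - x * cis (real (a k) * t))))\<^sup>2 \<le> (1 / sqrt (1 + 4 * e * s\<^sup>2))\<^sup>2"
        unfolding sq using \<open>0 \<le> 4 * e * s\<^sup>2\<close> by (simp add: power_divide)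
      then have "cmod ((1 - x) / (1 - x * cis (real (a k) * t))) \<le> 1 / sqrt (1 + 4 * e * s\<^sup>2)"
        by (rule power2_le_imp_le) (use \<open>0 \<le> 4 * e * s\<^sup>2\<close> in auto)
      then show ?thesis using True by (simp add: x_def)
    next
      case False
      have "0 \<le> 4 * (x / (1 - x)\<^sup>2) * S\<^sup>2" using x01 by simp
      then have "(cmod ((1 - x) / (1 - x * cis (real (a k) * t))))\<^sup>2 \<le> 1\<^sup>2" unfolding sq by simp
      then have "cmod ((1 - x) / (1 - x * cis (real (a k) * t))) \<le> 1" by (rule power2_le_imp_le) simp
      then show ?thesis using False by (simp add: x_def)
    qed
  qed
  have "cmod (geom_cf a q F t) = (\<Prod>k\<in>F. cmod ((1 - q ^ a k) / (1 - q ^ a k * cis (real (a k) * t))))"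
    by (simp add: geom_cf_def prod_norm)
  also have "\<dots> \<le> (\<Prod>k\<in>F. if k \<in> G then 1 / sqrt (1 + 4 * e * s\<^sup>2) else 1)"
    using nb by (intro prod_mono) auto
  also have "\<dots> = (1 / sqrt (1 + 4 * e * s\<^sup>2)) ^ card G"
    using F by (simp add: prod.If_cases Int_absorb1)
  finally show ?thesis .
qed

text \<open>
  The cut-off \<open>T = c\<^sub>0 / K\<^sup>R\<close> must be small enough for the Taylor estimate, which needs a lower bound for the
  variance.  That bound comes from a first use of \<open>card_good_weights_ge\<close>, at the frequency \<open>\<pi>\<close>; a second use, with
  \<open>c\<^sub>0\<close> fixed, then handles the frequencies beyond \<open>T\<close>.
\<close>

lemma local_limit_uniform_finite:
  assumes r: "2 \<le> r"
  shows "\<exists>B>0. \<exists>d>0. \<exists>c>0. \<exists>C>0. \<forall>K\<ge>1. \<forall>F. finite F \<longrightarrow> F \<subseteq> weights r \<longrightarrow>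
     sum (gvar (irr_dim r) (scaled_q r K)) (weight_box r (B * K) - F) \<le> d * var_scale r K \<longrightarrow>
     c * var_scale r K \<le> sum (gvar (irr_dim r) (scaled_q r K)) F \<and>
     (\<forall>m. \<bar>2 * pi * fin_prob (irr_dim r) (scaled_q r K) F m - gauss (sum (gvar (irr_dim r) (scaled_q r K)) F) (real_of_int m - sum (gmean (irr_dim r) (scaled_q r K)) F)\<bar>
        \<le> C / (K ^ wdeg r * K ^ r) + 2 * pi * exp (- c * K ^ r))"
proof -
  let ?R = "wdeg r"
  have r1: "1 \<le> r" using r by simp
  obtain C3 where C3: "C3 > 0" "\<And>K F. K > 0 \<Longrightarrow> finite F \<Longrightarrow> F \<subseteq> weights r \<Longrightarrow>
      sum (gthird (irr_dim r) (scaled_q r K)) F \<le> C3 * (K ^ (3 * ?R) * K ^ r)"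
    using cumulant_sums_le[OF r] by blast
  obtain B1 s1 c1 where 1: "B1 > 0" "s1 > 0" "c1 > 0" "\<And>K t. K \<ge> 1 \<Longrightarrow> 1 / K ^ ?R \<le> \<bar>t\<bar> \<Longrightarrow> \<bar>t\<bar> \<le> pi \<Longrightarrow>
     c1 * K ^ r \<le> real (card {k \<in> weight_box r (B1 * K). s1 \<le> \<bar>sin (wdim r k * t / 2)\<bar>})"
    using card_good_weights_ge[OF r1, of 1] by auto
  define e1 where "e1 = exp (- ((real r * B1) ^ ?R))"
  define cv where "cv = c1 * e1 / 2"
  have cv: "cv > 0" using 1 by (simp add: cv_def e1_def)
  \<comment> \<open>Chosen so that the third cumulant times \<open>T\<close> is at most a quarter of the variance.\<close>
  define c0 where "c0 = min 1 (cv / (4 * C3))"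
  have c0: "0 < c0" "c0 \<le> 1" "c0 \<le> cv / (4 * C3)" using cv C3 by (auto simp: c0_def)
  obtain B2 s2 c2 where 2: "B2 > 0" "s2 > 0" "c2 > 0" "\<And>K t. K \<ge> 1 \<Longrightarrow> c0 / K ^ ?R \<le> \<bar>t\<bar> \<Longrightarrow> \<bar>t\<bar> \<le> pi \<Longrightarrow>
     c2 * K ^ r \<le> real (card {k \<in> weight_box r (B2 * K). s2 \<le> \<bar>sin (wdim r k * t / 2)\<bar>})"
    using card_good_weights_ge[OF r1, of c0] c0 by auto
  define e2 where "e2 = exp (- ((real r * B2) ^ ?R))"
  define B where "B = max B1 B2"
  \<comment> \<open>With this much missing variance at least half of the good weights remain.\<close>
  define d where "d = min (c1 * e1 / 2) (c2 * e2 / 2)"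
  define rho where "rho = 1 / sqrt (1 + 4 * e2 * s2\<^sup>2)"
  have rho: "0 < rho" "rho < 1"
  proof -
    have "1 < sqrt (1 + 4 * e2 * s2\<^sup>2)" using 2 by (simp add: e2_def)
    then show "0 < rho" "rho < 1" by (auto simp: rho_def)
  qed
  define c where "c = min cv (- ln rho * c2 / 2)"
  define C where "C = (C3 + 1 / c0 ^ 3) * (16 / cv\<^sup>2)"
  have "c > 0" using cv rho 2 by (simp add: c_def ln_less_zero mult_neg_pos)
  have "C > 0" unfolding C_def using C3 c0 cv by (intro mult_pos_pos add_pos_pos divide_pos_pos zero_less_power) auto
  have "d > 0" using 1 2 by (simp add: d_def e1_def e2_def)
  have "B > 0" using 1 by (simp add: B_def)
  have main: "c * var_scale r K \<le> sum (gvar (irr_dim r) (scaled_q r K)) F \<and>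
     (\<forall>m. \<bar>2 * pi * fin_prob (irr_dim r) (scaled_q r K) F m - gauss (sum (gvar (irr_dim r) (scaled_q r K)) F) (real_of_int m - sum (gmean (irr_dim r) (scaled_q r K)) F)\<bar>
        \<le> C / (K ^ ?R * K ^ r) + 2 * pi * exp (- c * K ^ r))"
    if K: "K \<ge> 1" and F: "finite F" "F \<subseteq> weights r" and
      miss: "sum (gvar (irr_dim r) (scaled_q r K)) (weight_box r (B * K) - F) \<le> d * var_scale r K" for K F
  proof -
    let ?q = "scaled_q r K"
    let ?v = "sum (gvar (irr_dim r) ?q) F"
    have K0: "K > 0" using K by simp
    have q: "0 < ?q" "?q < 1" using scaled_q_bounds[OF K0] by auto
    have aF: "1 \<le> irr_dim r k" if "k \<in> F" for k using irr_dim_ge_1 F that by auto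
    have miss': "sum (gvar (irr_dim r) ?q) (weight_box r (b * K) - F) \<le> d * var_scale r K" if "b \<le> B" for b
    proof -
      have "weight_box r (b * K) \<subseteq> weight_box r (B * K)" using that K0 by (intro weight_box_mono mult_right_mono) auto
      then have "sum (gvar (irr_dim r) ?q) (weight_box r (b * K) - F) \<le> sum (gvar (irr_dim r) ?q) (weight_box r (B * K) - F)"
        by (intro sum_mono2) (auto intro: gvar_nonneg[OF q])
      with miss show ?thesis by linarith
    qed
    have good: "cc * K ^ r / 2 \<le> real (card (G \<inter> F))"
      if G: "G \<subseteq> weight_box r (b * K)" "cc * K ^ r \<le> real (card G)" and b: "0 < b" "b \<le> B"
        and dd: "d \<le> cc * exp (- ((real r * b) ^ ?R)) / 2" for G b cc
    proof -
      have fG: "finite G" using G finite_subset finite_weight_box by blast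
      have "real (card (G - F)) \<le> real (card (weight_box r (b * K) - F))"
        using G by (intro of_nat_mono card_mono) auto
      also have "\<dots> \<le> d * exp ((real r * b) ^ ?R) * K ^ r"
        by (rule card_missing_le[OF K0 b(1) miss'[OF b(2)]])
      also have "\<dots> \<le> (cc * exp (- ((real r * b) ^ ?R)) / 2) * exp ((real r * b) ^ ?R) * K ^ r"
        using dd K0 by (intro mult_right_mono) auto
      also have "\<dots> = cc * K ^ r / 2" by (simp add: exp_minus)
      finally have "real (card (G - F)) \<le> cc * K ^ r / 2" .
      moreover have "card G = card (G \<inter> F) + card (G - F)" using fG
        by (metis Int_Diff_Un Int_Diff_disjoint card_Un_disjoint finite_Diff finite_Int)
      ultimately show ?thesis using G(2) by simp
    qed
    have v: "cv * var_scale r K \<le> ?v"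
    proof -
      define G where "G = {k \<in> weight_box r (B1 * K). s1 \<le> \<bar>sin (wdim r k * pi / 2)\<bar>}"
      have "1 / K ^ ?R \<le> \<bar>pi\<bar>" using K pi_ge_two one_le_power[OF K, of ?R]
        by (smt (verit) divide_le_eq_1 pi_gt_zero)
      then have "c1 * K ^ r \<le> real (card G)" unfolding G_def using 1(4)[OF K, of pi] by simp
      then have "c1 * K ^ r / 2 \<le> real (card (G \<inter> F))"
        using 1(1) by (intro good[of G B1]) (auto simp: G_def B_def d_def e1_def)
      then have "c1 * K ^ r / 2 * (e1 * K ^ (2 * ?R)) \<le> real (card (G \<inter> F)) * (e1 * K ^ (2 * ?R))"
        using K0 by (intro mult_right_mono) (auto simp: e1_def)
      also have "\<dots> \<le> sum (gvar (irr_dim r) ?q) (G \<inter> F)"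
        using gvar_weight_box_ge(1)[OF _ K0 1(1), of _ r] unfolding e1_def
        by (intro sum_bounded_below) (auto simp: G_def)
      also have "\<dots> \<le> ?v" using F by (intro sum_mono2) (auto intro: gvar_nonneg[OF q])
      finally show ?thesis by (simp add: cv_def mult_ac)
    qed
    have KK: "0 < K ^ (2 * ?R) * K ^ r" using K0 by simp
    have v0: "0 < ?v" using v cv KK by (smt (verit) mult_pos_pos)
    define T where "T = c0 / K ^ ?R"
    have T0: "0 < T" using c0 K0 by (simp add: T_def)
    have "T \<le> 1" using c0 one_le_power[OF K, of ?R] by (simp add: T_def divide_le_eq)
    then have Tpi: "T \<le> pi" using pi_ge_two by linarith
    let ?tau = "sum (gthird (irr_dim r) ?q) F"
    have tau: "?tau \<le> C3 * (K ^ (3 * ?R) * K ^ r)" by (rule C3(2)[OF K0 F])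
    have K3: "K ^ (3 * ?R) = K ^ ?R * K ^ (2 * ?R)" by (simp add: power_add[symmetric])
    have tauT: "?tau * T \<le> ?v / 4"
    proof -
      have "?tau * T \<le> (C3 * (K ^ (3 * ?R) * K ^ r)) * T" using tau T0 by (intro mult_right_mono) auto
      also have "\<dots> = C3 * c0 * var_scale r K" unfolding K3 T_def using K0 by simp
      also have "\<dots> \<le> cv / 4 * var_scale r K"
      proof (intro mult_right_mono)
        show "C3 * c0 \<le> cv / 4" using c0(3) C3(1) by (simp add: field_simps)
      qed (use K0 in auto)
      also have "\<dots> \<le> ?v / 4" using v by simp
      finally show ?thesis .
    qed
    have minor: "cmod (geom_cf (irr_dim r) ?q F t) \<le> exp (- c * K ^ r)" if t: "T \<le> \<bar>t\<bar>" "\<bar>t\<bar> \<le> pi" for t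
    proof -
      define G where "G = {k \<in> weight_box r (B2 * K). s2 \<le> \<bar>sin (wdim r k * t / 2)\<bar>}"
      have "c2 * K ^ r \<le> real (card G)" unfolding G_def using 2(4)[OF K _ t(2)] t(1) by (simp add: T_def)
      then have cG: "c2 * K ^ r / 2 \<le> real (card (G \<inter> F))"
        using 2(1) by (intro good[of G B2]) (auto simp: G_def B_def d_def e2_def)
      have "cmod (geom_cf (irr_dim r) ?q F t) \<le> rho ^ card (G \<inter> F)"
        unfolding rho_def
      proof (rule norm_geom_cf_le_power[OF q F(1) _ aF])
        fix k assume k: "k \<in> G \<inter> F"
        then have kW: "k \<in> weights r" using F by auto
        show "e2 \<le> ?q ^ irr_dim r k / (1 - ?q ^ irr_dim r k)\<^sup>2"
          using gvar_weight_box_ge(2)[of k r B2 K] k K0 2(1) unfolding e2_def scaled_q_power geom_var_def G_def by auto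
        show "s2 \<le> \<bar>sin (real (irr_dim r k) * t / 2)\<bar>" using k unfolding G_def real_irr_dim[OF kW] by auto
      qed (use 2 in \<open>auto simp: e2_def\<close>)
      also have "\<dots> = exp (real (card (G \<inter> F)) * ln rho)" using rho by (simp add: exp_of_nat_mult)
      also have "\<dots> \<le> exp (c2 * K ^ r / 2 * ln rho)"
        using cG rho by (simp add: mult_right_mono_neg ln_less_zero less_imp_le)
      also have "\<dots> \<le> exp (- c * K ^ r)"
      proof -
        have "c * K ^ r \<le> (- ln rho * c2 / 2) * K ^ r" using K0 by (intro mult_right_mono) (auto simp: c_def)
        then show ?thesis by simp (simp add: mult_ac)
      qed
      finally show ?thesis .
    qed
    have err: "(?tau + 1 / T ^ 3) * (16 / ?v\<^sup>2) \<le> C / (K ^ ?R * K ^ r)"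
    proof -
      have "1 / T ^ 3 = 1 / c0 ^ 3 * K ^ (3 * ?R)" by (simp add: T_def power_divide power_mult[symmetric] mult.commute)
      also have "\<dots> \<le> 1 / c0 ^ 3 * (K ^ (3 * ?R) * K ^ r)"
        using c0 K by (intro mult_left_mono) (auto simp: mult_le_cancel_left1 one_le_power)
      finally have "?tau + 1 / T ^ 3 \<le> (C3 + 1 / c0 ^ 3) * (K ^ (3 * ?R) * K ^ r)"
        using tau by (simp add: distrib_right)
      moreover have "16 / ?v\<^sup>2 \<le> 16 / (cv * var_scale r K)\<^sup>2"
        using v v0 cv KK
        by (intro divide_left_mono power_mono mult_pos_pos[OF zero_less_power zero_less_power] mult_pos_pos[OF cv KK]) auto
      ultimately have "(?tau + 1 / T ^ 3) * (16 / ?v\<^sup>2) \<le> ((C3 + 1 / c0 ^ 3) * (K ^ (3 * ?R) * K ^ r)) * (16 / (cv * var_scale r K)\<^sup>2)"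
        using C3 c0 K0 by (intro mult_mono) auto
      also have "\<dots> = C * ((K ^ ?R * K ^ (2 * ?R) * K ^ r) / (K ^ (2 * ?R) * K ^ r)\<^sup>2)"
        unfolding C_def K3 power_mult_distrib by simp
      also have "(K ^ (2 * ?R) * K ^ r)\<^sup>2 = (K ^ ?R * K ^ (2 * ?R) * K ^ r) * (K ^ ?R * K ^ r)"
        by (simp add: power_add[symmetric] power_mult[symmetric] power_mult_distrib mult.commute)
      also have "C * ((K ^ ?R * K ^ (2 * ?R) * K ^ r) / ((K ^ ?R * K ^ (2 * ?R) * K ^ r) * (K ^ ?R * K ^ r))) = C / (K ^ ?R * K ^ r)"
        using K0 by simp
      finally show ?thesis .
    qed
    have "c * var_scale r K \<le> cv * var_scale r K"
      using KK by (intro mult_right_mono) (auto simp: c_def)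
    then have "c * var_scale r K \<le> ?v" using v by linarith
    moreover have "\<bar>2 * pi * fin_prob (irr_dim r) ?q F m - gauss ?v (real_of_int m - sum (gmean (irr_dim r) ?q) F)\<bar>
        \<le> C / (K ^ ?R * K ^ r) + 2 * pi * exp (- c * K ^ r)" for m
    proof -
      note local_limit_finite[where F = F and q = ?q and a = "irr_dim r" and T = T and m = m and \<epsilon> = "exp (- c * K ^ r)",
          OF F(1) q aF v0 T0 Tpi tauT minor]
      then show ?thesis using err by linarith
    qed
    ultimately show ?thesis by blast
  qed
  show ?thesis
    by (rule exI[of _ B], rule conjI[OF \<open>B > 0\<close>], rule exI[of _ d], rule conjI[OF \<open>d > 0\<close>],
        rule exI[of _ c], rule conjI[OF \<open>c > 0\<close>], rule exI[of _ C], rule conjI[OF \<open>C > 0\<close>],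
        intro allI impI, rule main)
qed

section \<open>Infinitely many weights\<close>

definition norm_const :: "('k \<Rightarrow> nat) \<Rightarrow> real \<Rightarrow> 'k set \<Rightarrow> real" where
  "norm_const a q A = Lim (finite_subsets_at_top A) (\<lambda>F. \<Prod>k\<in>F. 1 - q ^ a k)"

definition dim_prob :: "('k \<Rightarrow> nat) \<Rightarrow> real \<Rightarrow> 'k set \<Rightarrow> int \<Rightarrow> real" where
  "dim_prob a q A m = (if m < 0 then 0 else norm_const a q A * q ^ nat m * real (card (level a A (nat m))))"

text \<open>
  The partial products decrease, and \<open>1 - x \<ge> exp (- x / (1 - x))\<close> bounds them away from zero.
\<close>

lemma norm_const_tendsto:
  assumes q: "0 < q" "q < 1" and a: "\<And>k. k \<in> A \<Longrightarrow> 1 \<le> a k" and s: "gmean a q summable_on A"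
  shows "((\<lambda>F. \<Prod>k\<in>F. 1 - q ^ a k) \<longlongrightarrow> norm_const a q A) (finite_subsets_at_top A)"
    and "0 < norm_const a q A"
    and "\<And>F. finite F \<Longrightarrow> F \<subseteq> A \<Longrightarrow> norm_const a q A \<le> (\<Prod>k\<in>F. 1 - q ^ a k)"
proof -
  let ?p = "\<lambda>F. \<Prod>k\<in>F. 1 - q ^ a k"
  let ?S = "{F. finite F \<and> F \<subseteq> A}"
  have x: "0 < q ^ a k" "q ^ a k < 1" if "k \<in> A" for k
    using q a[OF that] by (auto simp: power_less_one_iff)
  have lb: "exp (- infsum (gmean a q) A) \<le> ?p F" if F: "finite F" "F \<subseteq> A" for F
  proof -
    have "sum (gmean a q) F \<le> infsum (gmean a q) A"
      using F q by (intro finite_sum_le_infsum s) (auto intro: gmean_nonneg)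
    then have "exp (- infsum (gmean a q) A) \<le> exp (- sum (gmean a q) F)" by simp
    also have "\<dots> = (\<Prod>k\<in>F. exp (- gmean a q k))" using F by (simp add: exp_sum sum_negf[symmetric])
    also have "\<dots> \<le> ?p F"
    proof (intro prod_mono conjI)
      fix k assume "k \<in> F"
      then have k: "k \<in> A" using F by auto
      let ?x = "q ^ a k"
      have "1 / (1 - ?x) = 1 + 1 * (?x / (1 - ?x))" using x[OF k] by (simp add: field_simps)
      also have "\<dots> \<le> 1 + gmean a q k"
        unfolding gmean_def using x[OF k] a[OF k] by (intro add_left_mono mult_right_mono) auto
      also have "\<dots> \<le> exp (gmean a q k)" by (rule exp_ge_add_one_self)
      finally show "exp (- gmean a q k) \<le> 1 - ?x" using x[OF k] by (simp add: exp_minus field_simps)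
    qed auto
    finally show ?thesis .
  qed
  define L where "L = Inf (?p ` ?S)"
  have bdd: "bdd_below (?p ` ?S)" by (rule bdd_belowI[of _ "exp (- infsum (gmean a q) A)"]) (use lb in auto)
  have ne: "?p ` ?S \<noteq> {}" by auto
  have Lle: "L \<le> ?p F" if "finite F" "F \<subseteq> A" for F
    unfolding L_def using that by (intro cInf_lower bdd) auto
  have "exp (- infsum (gmean a q) A) \<le> L" unfolding L_def using lb by (intro cInf_greatest ne) auto
  then have Lpos: "0 < L" using exp_gt_zero less_le_trans by blast
  have lim: "(?p \<longlongrightarrow> L) (finite_subsets_at_top A)"
  proof (rule order_tendstoI)
    fix y assume "y < L"
    then show "\<forall>\<^sub>F F in finite_subsets_at_top A. y < ?p F"
      using Lle by (intro eventually_finite_subsets_at_top_weakI) (auto intro: less_le_trans)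
  next
    fix y assume "L < y"
    then obtain F0 where F0: "finite F0" "F0 \<subseteq> A" "?p F0 < y"
      unfolding L_def using cInf_lessD[OF ne, of y] by auto
    show "\<forall>\<^sub>F F in finite_subsets_at_top A. ?p F < y"
      unfolding eventually_finite_subsets_at_top
    proof (intro exI[of _ F0] conjI allI impI F0)
      fix F assume F: "finite F \<and> F0 \<subseteq> F \<and> F \<subseteq> A"
      have "?p F = ?p F0 * ?p (F - F0)" using F prod.subset_diff[of F0 F "\<lambda>k. 1 - q ^ a k"] by (simp add: mult.commute)
      also have "\<dots> \<le> ?p F0 * 1"
        using F F0 x by (intro mult_left_mono prod_le_1 prod_nonneg) (auto simp: subset_iff less_imp_le)
      finally show "?p F < y" using F0 by simp
    qed
  qed
  have "norm_const a q A = L" unfolding norm_const_def using lim by (intro tendsto_Lim) auto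
  then show "(?p \<longlongrightarrow> norm_const a q A) (finite_subsets_at_top A)" "0 < norm_const a q A"
    "\<And>F. finite F \<Longrightarrow> F \<subseteq> A \<Longrightarrow> norm_const a q A \<le> ?p F" using lim Lpos Lle by auto
qed

lemma finite_small_weights:
  assumes q: "0 < q" "q < 1" and a: "\<And>k. k \<in> A \<Longrightarrow> 1 \<le> a k" and s: "gmean a q summable_on A"
  shows "finite {k \<in> A. a k \<le> m}"
proof -
  have ge: "q ^ m \<le> gmean a q k" if k: "k \<in> A" "a k \<le> m" for k
  proof -
    have x: "0 < q ^ a k" "q ^ a k < 1" using q a[OF k(1)] by (auto simp: power_less_one_iff)
    have "q ^ m \<le> q ^ a k" using q k by (intro power_decreasing) auto
    also have "\<dots> \<le> 1 * (q ^ a k / (1 - q ^ a k))" using x by (simp add: field_simps)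
    also have "\<dots> \<le> gmean a q k" unfolding gmean_def using x a[OF k(1)] by (intro mult_right_mono) auto
    finally show ?thesis .
  qed
  let ?I = "infsum (gmean a q) A"
  have "card G \<le> nat \<lfloor>?I / q ^ m\<rfloor>" if G: "G \<subseteq> {k \<in> A. a k \<le> m}" "finite G" for G
  proof -
    have "real (card G) * q ^ m \<le> sum (gmean a q) G"
      using G ge by (intro sum_bounded_below) auto
    also have "\<dots> \<le> ?I"
      using G q by (intro finite_sum_le_infsum s) (auto intro: gmean_nonneg)
    finally have "real (card G) \<le> ?I / q ^ m" using q by (simp add: field_simps)
    then show ?thesis by (simp add: le_nat_floor)
  qed
  then show ?thesis using finite_if_finite_subsets_card_bdd by blast
qed

text \<open>
  Vectors of total dimension \<open>m\<close> use only weights of dimension at most \<open>m\<close>.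
\<close>

lemma level_eq:
  assumes a: "\<And>k. k \<in> A \<Longrightarrow> 1 \<le> a k" and F: "{k \<in> A. a k \<le> m} \<subseteq> F" "F \<subseteq> A"
  shows "level a F m = level a A m"
proof
  show "level a F m \<subseteq> level a A m" using F by (auto simp: level_def mults_def)
  show "level a A m \<subseteq> level a F m"
  proof
    fix \<rho> assume \<rho>: "\<rho> \<in> level a A m"
    have "k \<in> F" if "\<rho> k \<noteq> 0" for k
    proof -
      have "k \<in> A" using \<rho> that by (auto simp: level_def mults_def)
      have "a k * 1 \<le> a k * \<rho> k" using that by (intro mult_left_mono) auto
      also have "\<dots> \<le> m" using total_dim_ge[of \<rho> A k a] \<rho> that by (auto simp: level_def)
      finally show ?thesis using F \<open>k \<in> A\<close> by auto
    qed
    then show "\<rho> \<in> level a F m" using \<rho> by (auto simp: level_def mults_def)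
  qed
qed

lemma fin_prob_tendsto_dim_prob:
  assumes q: "0 < q" "q < 1" and a: "\<And>k. k \<in> A \<Longrightarrow> 1 \<le> a k" and s: "gmean a q summable_on A"
  shows "((\<lambda>F. fin_prob a q F m) \<longlongrightarrow> dim_prob a q A m) (finite_subsets_at_top A)"
proof (cases "m < 0")
  case True
  then show ?thesis by (simp add: fin_prob_def dim_prob_def)
next
  case False
  have "((\<lambda>F. (\<Prod>k\<in>F. 1 - q ^ a k) * q ^ nat m * real (card (level a A (nat m)))) \<longlongrightarrow>
      norm_const a q A * q ^ nat m * real (card (level a A (nat m)))) (finite_subsets_at_top A)"
    by (intro tendsto_intros norm_const_tendsto[OF q a s])
  moreover have "\<forall>\<^sub>F F in finite_subsets_at_top A. fin_prob a q F m = (\<Prod>k\<in>F. 1 - q ^ a k) * q ^ nat m * real (card (level a A (nat m)))"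
    unfolding eventually_finite_subsets_at_top
  proof (intro exI[of _ "{k \<in> A. a k \<le> nat m}"] conjI allI impI)
    show "finite {k \<in> A. a k \<le> nat m}" by (rule finite_small_weights[OF q a s])
    fix F assume "finite F \<and> {k \<in> A. a k \<le> nat m} \<subseteq> F \<and> F \<subseteq> A"
    then have "level a F (nat m) = level a A (nat m)" by (intro level_eq a) auto
    then show "fin_prob a q F m = (\<Prod>k\<in>F. 1 - q ^ a k) * q ^ nat m * real (card (level a A (nat m)))"
      using False by (simp add: fin_prob_def fin_prob_nat_def)
  qed auto
  ultimately show ?thesis using False by (simp add: dim_prob_def tendsto_cong)
qed

lemma summable_cumulants:
  assumes r: "2 \<le> r" and K: "0 < K" and A: "A \<subseteq> weights r"
  shows "gmean (irr_dim r) (scaled_q r K) summable_on A" "gvar (irr_dim r) (scaled_q r K) summable_on A"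
proof -
  obtain C where C: "\<And>F. finite F \<Longrightarrow> F \<subseteq> weights r \<Longrightarrow>
     sum (gmean (irr_dim r) (scaled_q r K)) F \<le> C * (K ^ wdeg r * K ^ r) \<and>
     sum (gvar (irr_dim r) (scaled_q r K)) F \<le> C * var_scale r K"
    using cumulant_sums_le[OF r] K by blast
  show "gmean (irr_dim r) (scaled_q r K) summable_on A"
    using C A scaled_q_bounds[OF K, of r]
    by (intro nonneg_bdd_above_summable_on bdd_aboveI[of _ "C * (K ^ wdeg r * K ^ r)"]) (auto intro: gmean_nonneg)
  show "gvar (irr_dim r) (scaled_q r K) summable_on A"
    using C A scaled_q_bounds[OF K, of r]
    by (intro nonneg_bdd_above_summable_on bdd_aboveI[of _ "C * var_scale r K"]) (auto intro: gvar_nonneg)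
qed

lemma infsum_gvar_le:
  assumes r: "2 \<le> r"
  shows "\<exists>C>0. \<forall>K>0. infsum (gvar (irr_dim r) (scaled_q r K)) (weights r) \<le> C * var_scale r K"
proof -
  obtain C where C: "C > 0" "\<And>K F. K > 0 \<Longrightarrow> finite F \<Longrightarrow> F \<subseteq> weights r \<Longrightarrow>
     sum (gvar (irr_dim r) (scaled_q r K)) F \<le> C * var_scale r K"
    using cumulant_sums_le[OF r] by blast
  then show ?thesis using summable_cumulants[OF r]
    by (intro exI[of _ C]) (auto intro!: infsum_le_finite_sums)
qed

lemma exp_neg_le_power:
  fixes c :: real
  assumes c: "0 < c"
  shows "\<exists>C>0. \<forall>K\<ge>1. exp (- c * K ^ r) \<le> C / (K ^ wdeg r * K ^ (r::nat))"
proof (cases "r = 0")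
  case True
  then show ?thesis by (intro exI[of _ 1]) (use c in auto)
next
  case False
  define N where "N = wdeg r + 1"
  define C where "C = (real N / c) ^ N"
  have "exp (- c * K ^ r) \<le> C / (K ^ wdeg r * K ^ r)" if K: "K \<ge> 1" for K
  proof -
    define y where "y = c * K ^ r"
    have y: "y > 0" using c K by (simp add: y_def)
    have N: "N > 0" by (simp add: N_def)
    have "(y / real N) ^ N \<le> exp (y / real N) ^ N"
      using y exp_ge_add_one_self[of "y / real N"] by (intro power_mono) (linarith, simp)
    also have "\<dots> = exp y" using N by (simp add: exp_of_nat_mult[symmetric])
    finally have "exp (- y) \<le> 1 / (y / real N) ^ N"
      using y N by (simp add: exp_minus divide_simps mult.commute)
    also have "\<dots> = C / (K ^ r) ^ N"
      using c N by (simp add: C_def y_def power_mult_distrib power_divide)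
    finally have 1: "exp (- c * K ^ r) \<le> C / (K ^ r) ^ N" by (simp add: y_def)
    have "K ^ wdeg r * K ^ r \<le> (K ^ r) ^ N"
    proof -
      have "K ^ wdeg r \<le> K ^ (r * wdeg r)" using K False by (intro power_increasing) auto
      then show ?thesis using K by (simp add: N_def power_add power_mult mult_right_mono)
    qed
    then have "C / (K ^ r) ^ N \<le> C / (K ^ wdeg r * K ^ r)"
      using K c by (intro divide_left_mono mult_pos_pos) (auto simp: C_def)
    with 1 show ?thesis by linarith
  qed
  moreover have "C > 0" unfolding C_def
  proof (intro zero_less_power divide_pos_pos c)
    show "0 < real N" unfolding N_def by linarith
  qed
  ultimately show ?thesis by blast
qed

text \<open>
  The finite estimate passes to the limit along the finite subsets of \<open>A\<close>, because those containing
  the part of the box inside \<open>A\<close> satisfy its hypothesis.  The exponentially small term is absorbed into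
  the polynomial error.
\<close>

theorem local_limit_uniform:
  assumes r: "2 \<le> r"
  shows "\<exists>d>0. \<exists>c>0. \<exists>C>0. \<forall>K\<ge>1. \<forall>A. A \<subseteq> weights r \<longrightarrow>
     infsum (gvar (irr_dim r) (scaled_q r K)) (weights r - A) \<le> d * var_scale r K \<longrightarrow>
     c * var_scale r K \<le> infsum (gvar (irr_dim r) (scaled_q r K)) A \<and>
     (\<forall>m. \<bar>2 * pi * dim_prob (irr_dim r) (scaled_q r K) A m - gauss (infsum (gvar (irr_dim r) (scaled_q r K)) A) (real_of_int m - infsum (gmean (irr_dim r) (scaled_q r K)) A)\<bar>
        \<le> C / (K ^ wdeg r * K ^ r))"
proof -
  obtain B d c C where BC: "B > 0" "d > 0" "c > 0" "C > 0" and
    main0: "\<forall>K\<ge>1. \<forall>F. finite F \<longrightarrow> F \<subseteq> weights r \<longrightarrow>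
     sum (gvar (irr_dim r) (scaled_q r K)) (weight_box r (B * K) - F) \<le> d * var_scale r K \<longrightarrow>
     c * var_scale r K \<le> sum (gvar (irr_dim r) (scaled_q r K)) F \<and>
     (\<forall>m. \<bar>2 * pi * fin_prob (irr_dim r) (scaled_q r K) F m - gauss (sum (gvar (irr_dim r) (scaled_q r K)) F) (real_of_int m - sum (gmean (irr_dim r) (scaled_q r K)) F)\<bar>
        \<le> C / (K ^ wdeg r * K ^ r) + 2 * pi * exp (- c * K ^ r))"
    using local_limit_uniform_finite[OF r] by (elim exE conjE) (rule that)
  note main = main0[rule_format]
  obtain C2 where C2: "C2 > 0" "\<And>K. K \<ge> 1 \<Longrightarrow> exp (- c * K ^ r) \<le> C2 / (K ^ wdeg r * K ^ r)"
    using exp_neg_le_power[OF BC(3), of r] by blast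
  define C' where "C' = C + 2 * pi * C2"
  have C': "C' > 0" using BC C2 by (simp add: C'_def add_pos_pos)
  have "c * var_scale r K \<le> infsum (gvar (irr_dim r) (scaled_q r K)) A \<and>
     (\<forall>m. \<bar>2 * pi * dim_prob (irr_dim r) (scaled_q r K) A m - gauss (infsum (gvar (irr_dim r) (scaled_q r K)) A) (real_of_int m - infsum (gmean (irr_dim r) (scaled_q r K)) A)\<bar>
        \<le> C' / (K ^ wdeg r * K ^ r))"
    if K: "K \<ge> 1" and A: "A \<subseteq> weights r" and
      miss: "infsum (gvar (irr_dim r) (scaled_q r K)) (weights r - A) \<le> d * var_scale r K" for K A
  proof -
    let ?q = "scaled_q r K"
    let ?gv = "gvar (irr_dim r) ?q" and ?gm = "gmean (irr_dim r) ?q"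
    let ?Fi = "finite_subsets_at_top A"
    have K0: "K > 0" using K by simp
    have q: "0 < ?q" "?q < 1" using scaled_q_bounds[OF K0] by auto
    have a: "1 \<le> irr_dim r k" if "k \<in> A" for k using irr_dim_ge_1 A that by auto
    note sm = summable_cumulants[OF r K0 A]
    have tv: "(sum ?gv \<longlongrightarrow> infsum ?gv A) ?Fi" and tm: "(sum ?gm \<longlongrightarrow> infsum ?gm A) ?Fi"
      using has_sum_infsum[OF sm(1)] has_sum_infsum[OF sm(2)] by (auto simp: has_sum_def)
    have tP: "((\<lambda>F. fin_prob (irr_dim r) ?q F m) \<longlongrightarrow> dim_prob (irr_dim r) ?q A m) ?Fi" for m
      by (rule fin_prob_tendsto_dim_prob[OF q a sm(1)])
    have ev: "\<forall>\<^sub>F F in ?Fi. finite F \<and> F \<subseteq> A \<and> sum ?gv (weight_box r (B * K) - F) \<le> d * var_scale r K"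
      unfolding eventually_finite_subsets_at_top
    proof (intro exI[of _ "weight_box r (B * K) \<inter> A"] conjI allI impI)
      fix F assume F: "finite F \<and> weight_box r (B * K) \<inter> A \<subseteq> F \<and> F \<subseteq> A"
      have "sum ?gv (weight_box r (B * K) - F) \<le> infsum ?gv (weights r - A)"
        using F weight_box_subset by (intro finite_sum_le_infsum summable_cumulants[OF r K0]) (auto intro: gvar_nonneg q)
      then show "sum ?gv (weight_box r (B * K) - F) \<le> d * var_scale r K" using miss by linarith
    qed auto
    have ev1: "\<forall>\<^sub>F F in ?Fi. c * var_scale r K \<le> sum ?gv F"
      using ev by eventually_elim (rule main[OF K, THEN conjunct1], use A in auto)
    have vlow: "c * var_scale r K \<le> infsum ?gv A"
      by (rule tendsto_lowerbound[OF tv ev1]) simp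
    have v0: "0 < infsum ?gv A" using vlow BC K0 by (smt (verit) mult_pos_pos zero_less_power)
    have "\<bar>2 * pi * dim_prob (irr_dim r) ?q A m - gauss (infsum ?gv A) (real_of_int m - infsum ?gm A)\<bar> \<le> C' / (K ^ wdeg r * K ^ r)" for m
    proof (rule tendsto_upperbound)
      show "((\<lambda>F. \<bar>2 * pi * fin_prob (irr_dim r) ?q F m - gauss (sum ?gv F) (real_of_int m - sum ?gm F)\<bar>) \<longlongrightarrow>
         \<bar>2 * pi * dim_prob (irr_dim r) ?q A m - gauss (infsum ?gv A) (real_of_int m - infsum ?gm A)\<bar>) ?Fi"
        unfolding gauss_def by (intro tendsto_intros tv tm tP) (use v0 in auto)
      show "\<forall>\<^sub>F F in ?Fi. \<bar>2 * pi * fin_prob (irr_dim r) ?q F m - gauss (sum ?gv F) (real_of_int m - sum ?gm F)\<bar>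
          \<le> C' / (K ^ wdeg r * K ^ r)"
        using ev
      proof eventually_elim
        case (elim F)
        then have "\<bar>2 * pi * fin_prob (irr_dim r) ?q F m - gauss (sum ?gv F) (real_of_int m - sum ?gm F)\<bar>
          \<le> C / (K ^ wdeg r * K ^ r) + 2 * pi * exp (- c * K ^ r)"
          using main[OF K, of F, THEN conjunct2, THEN spec, of m] A by auto
        also have "\<dots> \<le> C / (K ^ wdeg r * K ^ r) + 2 * pi * (C2 / (K ^ wdeg r * K ^ r))"
          using C2(2)[OF K] by (intro add_left_mono mult_left_mono) auto
        finally show ?case by (simp add: C'_def add_divide_distrib)
      qed
    qed simp
    then show ?thesis using vlow by blast
  qed
  note main' = this
  show ?thesis
    by (rule exI[of _ d], rule conjI[OF BC(2)], rule exI[of _ c], rule conjI[OF BC(3)],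
        rule exI[of _ C'], rule conjI[OF C'], intro allI impI, rule main')
qed

section \<open>Sums over multiplicity vectors\<close>

definition boltzmann_sum :: "('k \<Rightarrow> nat) \<Rightarrow> real \<Rightarrow> 'k set \<Rightarrow> ennreal" where
  "boltzmann_sum a q A = (\<integral>\<^sup>+\<rho>. ennreal (q ^ total_dim a \<rho>) \<partial>count_space (mults A))"

lemma mults_plus:
  assumes "x \<in> mults A" "y \<in> mults B"
  shows "(\<lambda>k. x k + y k) \<in> mults (A \<union> B)"
proof -
  have "{k. x k + y k \<noteq> 0} \<subseteq> {k. x k \<noteq> 0} \<union> {k. y k \<noteq> 0}" by auto
  then show ?thesis using assms by (auto simp: mults_def intro: finite_subset)
qed

lemma marginal_mults: "\<rho> \<in> mults A \<Longrightarrow> marginal I \<rho> \<in> mults (A \<inter> I)"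
  unfolding mults_def marginal_def by (auto elim!: rev_finite_subset)

lemma total_dim_plus:
  assumes "x \<in> mults A" "y \<in> mults B"
  shows "total_dim a (\<lambda>k. x k + y k) = total_dim a x + total_dim a y"
proof -
  let ?F = "{k. x k \<noteq> 0} \<union> {k. y k \<noteq> 0}"
  have f: "finite ?F" using assms by (auto simp: mults_def)
  show ?thesis
    by (subst (1 2 3) total_dim_eq_sum[OF f]) (auto simp: sum.distrib[symmetric] algebra_simps)
qed

lemma measurable_marginal:
  assumes "I \<subseteq> A" "space M \<subseteq> mults A" "sets M = Pow (space M)"
  shows "marginal I \<in> measurable M (count_space (mults I))"
proof (rule measurableI)
  fix \<rho> assume "\<rho> \<in> space M"
  then show "marginal I \<rho> \<in> space (count_space (mults I))"
    using marginal_mults[of \<rho> A I] assms by (auto simp: Int_absorb1)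
qed (use assms in auto)

lemma bij_mults_split:
  assumes "A \<inter> B = {}"
  shows "bij_betw (\<lambda>(x, y) k. x k + y k) (mults A \<times> mults B) (mults (A \<union> B))"
proof (rule bij_betw_byWitness[where f' = "\<lambda>\<rho>. (marginal A \<rho>, marginal B \<rho>)"])
  show "\<forall>z\<in>mults A \<times> mults B. (\<lambda>\<rho>. (marginal A \<rho>, marginal B \<rho>)) ((\<lambda>(x, y) k. x k + y k) z) = z"
    using assms by (fastforce simp: marginal_def mults_def fun_eq_iff)
  show "\<forall>\<rho>\<in>mults (A \<union> B). (\<lambda>(x, y) k. x k + y k) (marginal A \<rho>, marginal B \<rho>) = \<rho>"
    using assms by (fastforce simp: marginal_def mults_def fun_eq_iff)
  show "(\<lambda>(x, y) k. x k + y k) ` (mults A \<times> mults B) \<subseteq> mults (A \<union> B)"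
    by (auto intro: mults_plus)
  show "(\<lambda>\<rho>. (marginal A \<rho>, marginal B \<rho>)) ` mults (A \<union> B) \<subseteq> mults A \<times> mults B"
    using marginal_mults[of _ "A \<union> B" A] marginal_mults[of _ "A \<union> B" B] by (auto simp: Int_absorb1 Int_commute)
qed

text \<open>
  The independence of complementary parts of a representation, in the form of Tonelli's theorem for
  counting measures.
\<close>

lemma nn_integral_mults_split:
  assumes "A \<inter> B = {}"
  shows "(\<integral>\<^sup>+\<rho>. f \<rho> \<partial>count_space (mults (A \<union> B))) =
     (\<integral>\<^sup>+x. (\<integral>\<^sup>+y. f (\<lambda>k. x k + y k) \<partial>count_space (mults B)) \<partial>count_space (mults A))"
proof -
  let ?g = "\<lambda>(x, y). f (\<lambda>k. x k + y k)"
  have "(\<integral>\<^sup>+\<rho>. f \<rho> \<partial>count_space (mults (A \<union> B))) = (\<integral>\<^sup>+z. f ((\<lambda>(x, y) k. x k + y k) z) \<partial>count_space (mults A \<times> mults B))"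
    by (rule nn_integral_bij_count_space[OF bij_mults_split[OF assms], symmetric])
  also have "\<dots> = (\<integral>\<^sup>+z. ?g z * indicator (mults A \<times> mults B) z \<partial>count_space UNIV)"
    by (subst nn_integral_count_space_indicator) (auto intro!: nn_integral_cong)
  also have "\<dots> = (\<integral>\<^sup>+x. \<integral>\<^sup>+y. ?g (x, y) * indicator (mults A \<times> mults B) (x, y) \<partial>count_space UNIV \<partial>count_space UNIV)"
    by (rule nn_integral_fst_count_space[symmetric])
  also have "\<dots> = (\<integral>\<^sup>+x. (\<integral>\<^sup>+y. f (\<lambda>k. x k + y k) \<partial>count_space (mults B)) * indicator (mults A) x \<partial>count_space UNIV)"
    by (intro nn_integral_cong) (auto simp: nn_integral_count_space_indicator indicator_def intro!: nn_integral_cong)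
  also have "\<dots> = (\<integral>\<^sup>+x. (\<integral>\<^sup>+y. f (\<lambda>k. x k + y k) \<partial>count_space (mults B)) \<partial>count_space (mults A))"
    by (simp add: nn_integral_count_space_indicator)
  finally show ?thesis .
qed

lemma boltzmann_sum_Un:
  assumes "A \<inter> B = {}" "0 \<le> q"
  shows "boltzmann_sum a q (A \<union> B) = boltzmann_sum a q A * boltzmann_sum a q B"
proof -
  have "boltzmann_sum a q (A \<union> B) = (\<integral>\<^sup>+x. (\<integral>\<^sup>+y. ennreal (q ^ total_dim a x) * ennreal (q ^ total_dim a y) \<partial>count_space (mults B)) \<partial>count_space (mults A))"
    unfolding boltzmann_sum_def nn_integral_mults_split[OF assms(1)]
    using assms(2) by (intro nn_integral_cong) (auto simp: total_dim_plus power_add ennreal_mult)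
  then show ?thesis by (simp add: boltzmann_sum_def nn_integral_cmult nn_integral_multc)
qed

lemma boltzmann_sum_empty: "boltzmann_sum a q {} = 1"
proof -
  have "mults {} = {\<lambda>_::'a. 0::nat}" by (auto simp: mults_def fun_eq_iff)
  then show ?thesis by (simp add: boltzmann_sum_def nn_integral_count_space_finite total_dim_def)
qed

lemma boltzmann_sum_singleton:
  assumes "0 < q" "q < 1" "1 \<le> a k"
  shows "boltzmann_sum a q {k} = ennreal (1 / (1 - q ^ a k))"
proof -
  have x: "0 < q ^ a k" "q ^ a k < 1" using assms by (auto simp: power_less_one_iff)
  have "bij_betw (\<lambda>n. (\<lambda>_. 0)(k := n)) UNIV (mults {k} :: ('a \<Rightarrow> nat) set)"
    by (rule bij_betw_byWitness[where f' = "\<lambda>\<rho>. \<rho> k"]) (auto simp: mults_def fun_eq_iff split: if_splits)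
  then have "boltzmann_sum a q {k} = (\<integral>\<^sup>+n. ennreal (q ^ total_dim a ((\<lambda>_. 0)(k := n))) \<partial>count_space UNIV)"
    unfolding boltzmann_sum_def by (rule nn_integral_bij_count_space[symmetric])
  also have "\<dots> = (\<integral>\<^sup>+n. ennreal ((q ^ a k) ^ n) \<partial>count_space UNIV)"
  proof (intro nn_integral_cong)
    fix n
    have "total_dim a ((\<lambda>_. 0)(k := n)) = a k * n" by (subst total_dim_eq_sum[of "{k}"]) auto
    then show "ennreal (q ^ total_dim a ((\<lambda>_. 0)(k := n))) = ennreal ((q ^ a k) ^ n)" by (simp add: power_mult)
  qed
  also have "\<dots> = (\<Sum>n. ennreal ((q ^ a k) ^ n))" by (rule nn_integral_count_space_nat)
  also have "\<dots> = ennreal (1 / (1 - q ^ a k))"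
    using x by (intro suminf_ennreal_eq geometric_sums) auto
  finally show ?thesis .
qed

lemma boltzmann_sum_finite:
  assumes "finite F" "0 < q" "q < 1" "\<And>k. k \<in> F \<Longrightarrow> 1 \<le> a k"
  shows "boltzmann_sum a q F = ennreal (1 / (\<Prod>k\<in>F. 1 - q ^ a k))"
  using assms(1,4)
proof (induction F rule: finite_induct)
  case empty
  then show ?case by (simp add: boltzmann_sum_empty)
next
  case (insert k F)
  have p: "0 < (\<Prod>k\<in>F. 1 - q ^ a k)" "0 < 1 - q ^ a k"
  proof -
    have x: "0 < 1 - q ^ a j" if "j \<in> insert k F" for j
    proof -
      have "0 < a j" using insert.prems[OF that] by simp
      then show ?thesis using assms(2,3) by (simp add: power_less_one_iff)
    qed
    show "0 < (\<Prod>k\<in>F. 1 - q ^ a k)" "0 < 1 - q ^ a k" using x by (auto intro!: prod_pos)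
  qed
  have "boltzmann_sum a q ({k} \<union> F) = boltzmann_sum a q {k} * boltzmann_sum a q F"
    using insert assms by (intro boltzmann_sum_Un) auto
  also have "\<dots> = ennreal (1 / (1 - q ^ a k)) * ennreal (1 / (\<Prod>k\<in>F. 1 - q ^ a k))"
    using insert assms by (simp add: boltzmann_sum_singleton)
  also have "\<dots> = ennreal (1 / (\<Prod>k\<in>insert k F. 1 - q ^ a k))"
    using insert p by (subst ennreal_mult[symmetric]) auto
  finally show ?case by simp
qed

text \<open>
  Every vector is supported on finitely many weights, so the sum over \<open>A\<close> is the increasing limit of the
  sums over the finite sets of weights of bounded dimension.
\<close>

lemma boltzmann_sum_eq:
  assumes q: "0 < q" "q < 1" and a: "\<And>k. k \<in> A \<Longrightarrow> 1 \<le> a k" and s: "gmean a q summable_on A"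
  shows "boltzmann_sum a q A = ennreal (1 / norm_const a q A)"
proof (rule antisym)
  note C = norm_const_tendsto[where a = a and A = A, OF q a s]
  have mono: "boltzmann_sum a q B \<le> boltzmann_sum a q A" if "B \<subseteq> A" for B
  proof -
    have "mults B \<subseteq> mults A" using that by (auto simp: mults_def)
    then show ?thesis unfolding boltzmann_sum_def
      by (simp add: nn_integral_count_space_indicator) (intro nn_integral_mono, auto simp: indicator_def)
  qed
  let ?F = "\<lambda>n. {k \<in> A. a k \<le> n}"
  have fin: "finite (?F n)" for n by (rule finite_small_weights[OF q a s])
  have ind: "indicator (mults A) \<rho> = (SUP n. indicator (mults (?F n)) \<rho> :: ennreal)" for \<rho> :: "'a \<Rightarrow> nat"
  proof (cases "\<rho> \<in> mults A")
    case True
    have "\<rho> \<in> mults (?F (Max (insert 0 (a ` {k. \<rho> k \<noteq> 0}))))"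
      using True by (auto simp: mults_def)
    then have "1 \<le> (SUP n. indicator (mults (?F n)) \<rho> :: ennreal)"
      by (intro SUP_upper2[of "Max (insert 0 (a ` {k. \<rho> k \<noteq> 0}))"]) auto
    moreover have "(SUP n. indicator (mults (?F n)) \<rho> :: ennreal) \<le> 1"
      by (intro SUP_least) (auto simp: indicator_def)
    ultimately have "(SUP n. indicator (mults (?F n)) \<rho> :: ennreal) = 1" by (intro antisym)
    then show ?thesis using True by simp
  next
    case False
    then have "\<rho> \<notin> mults (?F n)" for n by (auto simp: mults_def)
    then show ?thesis using False by simp
  qed
  have "boltzmann_sum a q A = (\<integral>\<^sup>+\<rho>. (SUP n. ennreal (q ^ total_dim a \<rho>) * indicator (mults (?F n)) \<rho>) \<partial>count_space UNIV)"
    unfolding boltzmann_sum_def by (subst nn_integral_count_space_indicator) (auto simp: ind SUP_mult_left_ennreal)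
  also have "\<dots> = (SUP n. \<integral>\<^sup>+\<rho>. ennreal (q ^ total_dim a \<rho>) * indicator (mults (?F n)) \<rho> \<partial>count_space UNIV)"
    by (intro nn_integral_monotone_convergence_SUP)
      (auto simp: incseq_def le_fun_def mults_def indicator_def)
  also have "\<dots> = (SUP n. boltzmann_sum a q (?F n))"
    by (simp add: boltzmann_sum_def nn_integral_count_space_indicator)
  also have "\<dots> \<le> ennreal (1 / norm_const a q A)"
  proof (rule SUP_least)
    fix n
    have "boltzmann_sum a q (?F n) = ennreal (1 / (\<Prod>k\<in>?F n. 1 - q ^ a k))" by (rule boltzmann_sum_finite) (use fin q a in auto)
    also have "\<dots> \<le> ennreal (1 / norm_const a q A)"
      using C(2) C(3)[OF _ fin, of n] by (intro ennreal_leI divide_left_mono mult_pos_pos) auto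
    finally show "boltzmann_sum a q (?F n) \<le> ennreal (1 / norm_const a q A)" .
  qed
  finally show "boltzmann_sum a q A \<le> ennreal (1 / norm_const a q A)" .
  show "ennreal (1 / norm_const a q A) \<le> boltzmann_sum a q A"
  proof (rule tendsto_upperbound)
    show "((\<lambda>F. ennreal (1 / (\<Prod>k\<in>F. 1 - q ^ a k))) \<longlongrightarrow> ennreal (1 / norm_const a q A)) (finite_subsets_at_top A)"
      by (intro tendsto_intros C(1)) (use C(2) in auto)
    show "\<forall>\<^sub>F F in finite_subsets_at_top A. ennreal (1 / (\<Prod>k\<in>F. 1 - q ^ a k)) \<le> boltzmann_sum a q A"
    proof (rule eventually_finite_subsets_at_top_weakI)
      fix F assume F: "finite F" "F \<subseteq> A"
      have "ennreal (1 / (\<Prod>k\<in>F. 1 - q ^ a k)) = boltzmann_sum a q F" by (rule boltzmann_sum_finite[symmetric]) (use F q a in auto)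
      then show "ennreal (1 / (\<Prod>k\<in>F. 1 - q ^ a k)) \<le> boltzmann_sum a q A" using mono[OF F(2)] by simp
    qed
  qed simp
qed

lemma norm_const_Un:
  assumes q: "0 < q" "q < 1" and a: "\<And>k. k \<in> A \<union> B \<Longrightarrow> 1 \<le> a k" and s: "gmean a q summable_on A \<union> B"
    and d: "A \<inter> B = {}"
  shows "norm_const a q (A \<union> B) = norm_const a q A * norm_const a q B"
proof -
  have sA: "gmean a q summable_on A" and sB: "gmean a q summable_on B"
    using s by (auto intro: summable_on_subset_banach)
  have pos: "0 < norm_const a q A" "0 < norm_const a q B" "0 < norm_const a q (A \<union> B)"
    using norm_const_tendsto(2)[OF q _ sA] norm_const_tendsto(2)[OF q _ sB] norm_const_tendsto(2)[OF q _ s] a by auto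
  have "ennreal (1 / norm_const a q (A \<union> B)) = ennreal (1 / norm_const a q A) * ennreal (1 / norm_const a q B)"
    using boltzmann_sum_Un[OF d, of q a] boltzmann_sum_eq[OF q _ sA] boltzmann_sum_eq[OF q _ sB] boltzmann_sum_eq[OF q _ s] a q by auto
  also have "\<dots> = ennreal (1 / (norm_const a q A * norm_const a q B))"
    using pos by (subst ennreal_mult[symmetric]) auto
  finally have "1 / norm_const a q (A \<union> B) = 1 / (norm_const a q A * norm_const a q B)"
    using pos by (subst (asm) ennreal_inj) auto
  then show ?thesis using pos by (simp add: field_simps)
qed

section \<open>Moments and marginals of the Boltzmann measure\<close>

definition boltzmann_weight :: "nat \<Rightarrow> real \<Rightarrow> ((nat \<Rightarrow> nat) \<Rightarrow> nat) \<Rightarrow> real" where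
  "boltzmann_weight r q \<rho> = q ^ total_dim (irr_dim r) \<rho> * norm_const (irr_dim r) q (weights r)"


lemma pdim_eq:
  assumes "\<rho> \<in> reps r" "I \<subseteq> weights r"
  shows "pdim r I \<rho> = real (total_dim (irr_dim r) (marginal I \<rho>))"
proof -
  have "{k. marginal I \<rho> k \<noteq> 0} = {k \<in> I. \<rho> k \<noteq> 0}" by (auto simp: marginal_def)
  then show ?thesis
    using assms by (auto simp: pdim_def total_dim_def marginal_def real_irr_dim intro!: sum.cong)
qed

lemma rdim_eq: "\<rho> \<in> reps r \<Longrightarrow> rdim r \<rho> = real (total_dim (irr_dim r) \<rho>)"
proof -
  assume \<rho>: "\<rho> \<in> reps r"
  then have "marginal (weights r) \<rho> = \<rho>" by (auto simp: marginal_def reps_def mults_def fun_eq_iff)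
  then show ?thesis using pdim_eq[OF \<rho> order_refl] by (simp add: rdim_def)
qed

lemma Qconst_eq:
  assumes "0 < q" shows "Qconst r q = norm_const (irr_dim r) q (weights r)"
proof -
  have "(\<Prod>k\<in>F. 1 - q powr wdim r k) = (\<Prod>k\<in>F. 1 - q ^ irr_dim r k)" if "F \<subseteq> weights r" for F
    using that assms by (intro prod.cong refl) (auto simp: real_irr_dim[symmetric] powr_realpow subset_iff)
  then have "\<forall>\<^sub>F F in finite_subsets_at_top (weights r). (\<Prod>k\<in>F. 1 - q powr wdim r k) = (\<Prod>k\<in>F. 1 - q ^ irr_dim r k)"
    by (intro eventually_finite_subsets_at_top_weakI) auto
  then show ?thesis unfolding Qconst_def norm_const_def Topological_Spaces.Lim_def
    by (simp add: tendsto_cong)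
qed

lemma Q_eq:
  assumes "0 < q" shows "Q r q = density (count_space (reps r)) (\<lambda>\<rho>. ennreal (boltzmann_weight r q \<rho>))"
  unfolding Q_def point_measure_def
  by (intro density_cong) (auto simp: AE_count_space boltzmann_weight_def rdim_eq powr_realpow assms Qconst_eq)

lemma nn_integral_Q:
  assumes "0 < q"
  shows "(\<integral>\<^sup>+\<rho>. f \<rho> \<partial>Q r q) = (\<integral>\<^sup>+\<rho>. ennreal (boltzmann_weight r q \<rho>) * f \<rho> \<partial>count_space (reps r))"
  unfolding Q_eq[OF assms] by (subst nn_integral_density) auto

lemma space_Q [simp]: "space (Q r q) = reps r" "sets (Q r q) = Pow (reps r)"
  by (auto simp: Q_def space_point_measure sets_point_measure)

lemma measurable_Q [simp, measurable]: "f \<in> borel_measurable (Q r q)" "g \<in> measurable (Q r q) (count_space UNIV)"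
  unfolding Q_def by (auto simp: measurable_point_measure_eq1)

lemma countable_weights: "countable (weights r)"
  unfolding weights_def by (intro countable_PiE) auto

text \<open>
  So summability for every \<open>q\<close> follows from the estimates at scale \<open>K\<close>.
\<close>

lemma scaled_q_surj:
  assumes "1 \<le> r" "0 < q" "q < 1"
  shows "\<exists>K>0. q = scaled_q r K"
proof -
  let ?K = "root (wdeg r) (1 / (- ln q))"
  have R: "0 < wdeg r" using assms by (auto intro!: sum_pos)
  have l: "0 < 1 / (- ln q)" using assms by (simp add: ln_less_zero)
  have "?K ^ wdeg r = 1 / (- ln q)" using R l by (intro real_root_pow_pos2) auto
  then have "scaled_q r ?K = q" using assms by (simp add: scaled_q_def ln_less_zero)
  moreover have "0 < ?K" using R l by simp
  ultimately show ?thesis by metis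
qed

lemma finite_level_all:
  assumes q: "0 < q" "q < 1" and a: "\<And>k. k \<in> A \<Longrightarrow> 1 \<le> a k" and s: "gmean a q summable_on A"
  shows "finite (level a A m)"
proof -
  have "level a {k \<in> A. a k \<le> m} m = level a A m" by (rule level_eq) (use a in auto)
  moreover have "finite (level a {k \<in> A. a k \<le> m} m)"
    by (rule finite_level, rule finite_small_weights[OF q a s]) (use a in auto)
  ultimately show ?thesis by simp
qed

lemma total_dim_shift:
  assumes "\<rho> \<in> mults A"
  shows "total_dim a (\<rho>(k := \<rho> k + j)) = total_dim a \<rho> + a k * j" "k \<in> A \<Longrightarrow> \<rho>(k := \<rho> k + j) \<in> mults A"
proof -
  let ?y = "(\<lambda>_. 0)(k := j)"
  have y: "?y \<in> mults {k}" by (auto simp: mults_def split: if_splits)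
  have e: "\<rho>(k := \<rho> k + j) = (\<lambda>i. \<rho> i + ?y i)" by auto
  have "total_dim a ?y = a k * j" by (subst total_dim_eq_sum[of "{k}"]) auto
  then show "total_dim a (\<rho>(k := \<rho> k + j)) = total_dim a \<rho> + a k * j"
    unfolding e by (subst total_dim_plus[OF assms y]) simp
  show "\<rho>(k := \<rho> k + j) \<in> mults A" if "k \<in> A"
    unfolding e using mults_plus[OF assms y] that by (simp add: insert_absorb)
qed

lemma nn_integral_count_space_infsum:
  fixes g :: "'a \<Rightarrow> real"
  assumes "g summable_on A" "\<And>x. x \<in> A \<Longrightarrow> 0 \<le> g x"
  shows "(\<integral>\<^sup>+x. ennreal (g x) \<partial>count_space A) = ennreal (infsum g A)"
proof -
  have "(\<lambda>x. norm (g x)) summable_on A" using assms by (subst summable_on_cong[of _ _ g]) auto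
  then have s: "Infinite_Set_Sum.abs_summable_on g A" using abs_summable_equivalent[of g A] by blast
  show ?thesis using nn_integral_conv_infsetsum[OF s assms(2)] infsetsum_infsum[OF s] by simp
qed

context
  fixes r :: nat and q :: real
  assumes r: "2 \<le> r" and q: "0 < q" "q < 1"
begin

lemma summable_cumulants_q:
  assumes "A \<subseteq> weights r"
  shows "gmean (irr_dim r) q summable_on A" "gvar (irr_dim r) q summable_on A"
proof -
  obtain K where "K > 0" "q = scaled_q r K" using scaled_q_surj[of r q] r q by auto
  then show "gmean (irr_dim r) q summable_on A" "gvar (irr_dim r) q summable_on A"
    using summable_cumulants[OF r _ assms] by auto
qed

lemma irr_dim_ge_1_subset: "A \<subseteq> weights r \<Longrightarrow> k \<in> A \<Longrightarrow> 1 \<le> irr_dim r k"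
  using irr_dim_ge_1 by auto

lemma irr_power_bounds: "k \<in> weights r \<Longrightarrow> 0 < q ^ irr_dim r k" "k \<in> weights r \<Longrightarrow> q ^ irr_dim r k < 1"
proof -
  assume "k \<in> weights r"
  then have "0 < irr_dim r k" using irr_dim_ge_1[of k r] by simp
  then show "0 < q ^ irr_dim r k" "q ^ irr_dim r k < 1" using q by (auto simp: power_less_one_iff)
qed

lemma norm_const_pos: "A \<subseteq> weights r \<Longrightarrow> 0 < norm_const (irr_dim r) q A"
  by (rule norm_const_tendsto(2)[OF q _ summable_cumulants_q(1)]) (use irr_dim_ge_1_subset in auto)

lemma boltzmann_sum_weights: "A \<subseteq> weights r \<Longrightarrow> boltzmann_sum (irr_dim r) q A = ennreal (1 / norm_const (irr_dim r) q A)"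
  by (rule boltzmann_sum_eq[OF q _ summable_cumulants_q(1)]) (use irr_dim_ge_1_subset in auto)

lemma boltzmann_weight_nonneg: "0 \<le> boltzmann_weight r q \<rho>"
  using q norm_const_pos[OF order_refl] by (simp add: boltzmann_weight_def)

lemma prob_space_Q: "prob_space (Q r q)"
proof
  have "emeasure (Q r q) (space (Q r q)) = (\<integral>\<^sup>+\<rho>. 1 \<partial>Q r q)" by simp
  also have "\<dots> = (\<integral>\<^sup>+\<rho>. ennreal (q ^ total_dim (irr_dim r) \<rho>) * ennreal (norm_const (irr_dim r) q (weights r)) \<partial>count_space (reps r))"
    unfolding nn_integral_Q[OF q(1)] boltzmann_weight_def
    using q norm_const_pos[OF order_refl] by (intro nn_integral_cong) (simp add: ennreal_mult)
  also have "\<dots> = boltzmann_sum (irr_dim r) q (weights r) * ennreal (norm_const (irr_dim r) q (weights r))"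
    by (simp add: nn_integral_multc boltzmann_sum_def reps_def)
  also have "\<dots> = 1"
    using norm_const_pos[OF order_refl] by (simp add: boltzmann_sum_weights ennreal_mult[symmetric])
  finally show "emeasure (Q r q) (space (Q r q)) = 1" .
qed

text \<open>
  Memorylessness: adding \<open>j\<close> copies of \<open>k\<close> multiplies the Boltzmann weight by \<open>q\<^bsup>a(k) j\<^esup>\<close>.
\<close>

lemma nn_integral_Q_shift:
  assumes k: "k \<in> weights r"
  shows "(\<integral>\<^sup>+\<rho>. of_bool (j \<le> \<rho> k) * f \<rho> \<partial>Q r q) =
    ennreal ((q ^ irr_dim r k) ^ j) * (\<integral>\<^sup>+\<rho>. f (\<rho>(k := \<rho> k + j)) \<partial>Q r q)"
proof -
  let ?S = "{\<rho> \<in> reps r. j \<le> \<rho> k}"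
  have bij: "bij_betw (\<lambda>\<rho>. \<rho>(k := \<rho> k + j)) (reps r) ?S"
  proof (rule bij_betw_byWitness[where f' = "\<lambda>\<rho>. \<rho>(k := \<rho> k - j)"])
    show "(\<lambda>\<rho>. \<rho>(k := \<rho> k + j)) ` reps r \<subseteq> ?S"
      using k by (auto simp: reps_def intro: total_dim_shift)
    show "(\<lambda>\<rho>. \<rho>(k := \<rho> k - j)) ` ?S \<subseteq> reps r"
    proof (intro image_subsetI)
      fix \<rho> assume "\<rho> \<in> ?S"
      moreover have "{i. (\<rho>(k := \<rho> k - j)) i \<noteq> 0} \<subseteq> {i. \<rho> i \<noteq> 0}" by auto
      ultimately show "\<rho>(k := \<rho> k - j) \<in> reps r"
        unfolding reps_def mults_def using finite_subset by blast
    qed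
  qed auto
  have "(\<integral>\<^sup>+\<rho>. of_bool (j \<le> \<rho> k) * f \<rho> \<partial>Q r q) = (\<integral>\<^sup>+\<rho>. ennreal (boltzmann_weight r q \<rho>) * f \<rho> \<partial>count_space ?S)"
    unfolding nn_integral_Q[OF q(1)]
    by (simp add: nn_integral_count_space_indicator) (intro nn_integral_cong, auto simp: indicator_def)
  also have "\<dots> = (\<integral>\<^sup>+\<rho>. ennreal (boltzmann_weight r q (\<rho>(k := \<rho> k + j))) * f (\<rho>(k := \<rho> k + j)) \<partial>count_space (reps r))"
    by (rule nn_integral_bij_count_space[OF bij, symmetric])
  also have "\<dots> = (\<integral>\<^sup>+\<rho>. ennreal ((q ^ irr_dim r k) ^ j) * (ennreal (boltzmann_weight r q \<rho>) * f (\<rho>(k := \<rho> k + j))) \<partial>count_space (reps r))"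
  proof (intro nn_integral_cong)
    fix \<rho> assume "\<rho> \<in> space (count_space (reps r))"
    then have "\<rho> \<in> mults (weights r)" by (simp add: reps_def)
    then have "boltzmann_weight r q (\<rho>(k := \<rho> k + j)) = (q ^ irr_dim r k) ^ j * boltzmann_weight r q \<rho>"
      by (simp add: boltzmann_weight_def total_dim_shift(1) power_add power_mult)
    then show "ennreal (boltzmann_weight r q (\<rho>(k := \<rho> k + j))) * f (\<rho>(k := \<rho> k + j)) =
      ennreal ((q ^ irr_dim r k) ^ j) * (ennreal (boltzmann_weight r q \<rho>) * f (\<rho>(k := \<rho> k + j)))"
      using q boltzmann_weight_nonneg[of \<rho>] by (simp add: ennreal_mult mult.assoc)
  qed
  also have "\<dots> = ennreal ((q ^ irr_dim r k) ^ j) * (\<integral>\<^sup>+\<rho>. f (\<rho>(k := \<rho> k + j)) \<partial>Q r q)"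
    unfolding nn_integral_Q[OF q(1)] by (simp add: nn_integral_cmult)
  finally show ?thesis .
qed

text \<open>
  Obtained from memorylessness by writing a multiplicity as the number of thresholds that it
  reaches.  This formula yields first and second moments directly, including all
  covariances.
\<close>

lemma nn_integral_Q_multiplicity:
  assumes k: "k \<in> weights r"
  shows "(\<integral>\<^sup>+\<rho>. ennreal (real (\<rho> k)) * f \<rho> \<partial>Q r q) =
    (\<Sum>j. ennreal ((q ^ irr_dim r k) ^ Suc j) * (\<integral>\<^sup>+\<rho>. f (\<rho>(k := \<rho> k + Suc j)) \<partial>Q r q))"
proof -
  have n: "ennreal (real n) = (\<Sum>j. of_bool (Suc j \<le> n))" for n
  proof -
    have "(\<Sum>j. of_bool (Suc j \<le> n) :: ennreal) = (\<Sum>j<n. of_bool (Suc j \<le> n))"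
      by (rule suminf_finite) auto
    also have "\<dots> = (\<Sum>j<n. 1)" by (intro sum.cong) auto
    finally show ?thesis by (simp add: ennreal_of_nat_eq_real_of_nat)
  qed
  have "(\<integral>\<^sup>+\<rho>. ennreal (real (\<rho> k)) * f \<rho> \<partial>Q r q) = (\<integral>\<^sup>+\<rho>. (\<Sum>j. of_bool (Suc j \<le> \<rho> k) * f \<rho>) \<partial>Q r q)"
    by (subst n, subst ennreal_suminf_multc) simp
  also have "\<dots> = (\<Sum>j. \<integral>\<^sup>+\<rho>. of_bool (Suc j \<le> \<rho> k) * f \<rho> \<partial>Q r q)"
    by (rule nn_integral_suminf) simp
  finally show ?thesis by (simp only: nn_integral_Q_shift[OF k])
qed

lemma geometric_ennreal_sums:
  assumes k: "k \<in> weights r" and m: "0 \<le> m"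
  shows "(\<Sum>j. ennreal ((q ^ irr_dim r k) ^ Suc j * (m + real (irr_dim r k) * real (Suc j)))) =
    ennreal (q ^ irr_dim r k / (1 - q ^ irr_dim r k) * m + real (irr_dim r k) * (q ^ irr_dim r k / (1 - q ^ irr_dim r k)\<^sup>2))"
proof -
  define x where "x = q ^ irr_dim r k"
  have x: "0 < x" "x < 1" using irr_power_bounds[OF k] by (auto simp: x_def)
  have 1: "(\<lambda>j. x * m * x ^ j) sums (x * m * (1 / (1 - x)))"
    using x by (intro sums_mult geometric_sums) auto
  have 2: "(\<lambda>j. real (irr_dim r k) * x * (of_nat (Suc j) * x ^ j)) sums (real (irr_dim r k) * x * (1 / (1 - x)\<^sup>2))"
    using x by (intro sums_mult geometric_deriv_sums) auto
  have "(\<lambda>j. x ^ Suc j * (m + real (irr_dim r k) * real (Suc j))) sums (x / (1 - x) * m + real (irr_dim r k) * (x / (1 - x)\<^sup>2))"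
    using sums_add[OF 1 2] by (simp add: algebra_simps)
  then show ?thesis unfolding x_def[symmetric]
    using x m by (intro suminf_ennreal_eq) auto
qed

lemma pdim_nn_integral:
  assumes "\<rho> \<in> reps r" "I \<subseteq> weights r"
  shows "ennreal (pdim r I \<rho>) = (\<integral>\<^sup>+k. ennreal (real (irr_dim r k)) * ennreal (real (\<rho> k)) \<partial>count_space I)"
proof -
  let ?S = "{k \<in> I. \<rho> k \<noteq> 0}"
  have fin: "finite ?S" using assms by (auto simp: reps_def mults_def intro: rev_finite_subset)
  have "(\<integral>\<^sup>+k. ennreal (real (irr_dim r k)) * ennreal (real (\<rho> k)) \<partial>count_space I) = (\<Sum>k\<in>?S. ennreal (real (irr_dim r k)) * ennreal (real (\<rho> k)))"
    using fin by (intro nn_integral_count_space') auto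
  also have "\<dots> = (\<Sum>k\<in>?S. ennreal (wdim r k * real (\<rho> k)))"
    using assms by (intro sum.cong refl) (auto simp: real_irr_dim[symmetric] ennreal_mult)
  also have "\<dots> = ennreal (pdim r I \<rho>)"
    unfolding pdim_def using assms by (intro sum_ennreal) (auto intro!: mult_nonneg_nonneg less_imp_le[OF wdim_pos])
  finally show ?thesis by simp
qed

lemma pdim_nonneg: "\<rho> \<in> reps r \<Longrightarrow> I \<subseteq> weights r \<Longrightarrow> 0 \<le> pdim r I \<rho>"
  by (simp add: pdim_eq)

lemma pdim_shift:
  assumes "\<rho> \<in> reps r" "I \<subseteq> weights r" "k \<in> I"
  shows "pdim r I (\<rho>(k := \<rho> k + j)) = pdim r I \<rho> + real (irr_dim r k) * real j"
proof -
  have k: "k \<in> weights r" using assms by auto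
  have "\<rho>(k := \<rho> k + j) \<in> reps r" using assms k total_dim_shift(2)[of \<rho> "weights r" k j] by (simp add: reps_def)
  then have "pdim r I (\<rho>(k := \<rho> k + j)) = real (total_dim (irr_dim r) (marginal I (\<rho>(k := \<rho> k + j))))"
    using assms by (simp add: pdim_eq)
  also have "marginal I (\<rho>(k := \<rho> k + j)) = (marginal I \<rho>)(k := marginal I \<rho> k + j)"
    using assms by (auto simp: marginal_def)
  also have "total_dim (irr_dim r) \<dots> = total_dim (irr_dim r) (marginal I \<rho>) + irr_dim r k * j"
    using marginal_mults[of \<rho> "weights r" I] assms(1) by (intro total_dim_shift) (auto simp: reps_def)
  finally show ?thesis using assms(1,2) by (simp only: pdim_eq of_nat_add of_nat_mult)
qed

lemma nn_integral_pdim_times: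
  assumes I: "I \<subseteq> weights r"
  shows "(\<integral>\<^sup>+\<rho>. ennreal (pdim r I \<rho>) * f \<rho> \<partial>Q r q) =
    (\<integral>\<^sup>+k. ennreal (real (irr_dim r k)) * (\<integral>\<^sup>+\<rho>. ennreal (real (\<rho> k)) * f \<rho> \<partial>Q r q) \<partial>count_space I)"
proof -
  have "(\<integral>\<^sup>+\<rho>. ennreal (pdim r I \<rho>) * f \<rho> \<partial>Q r q) =
      (\<integral>\<^sup>+\<rho>. (\<integral>\<^sup>+k. ennreal (real (irr_dim r k)) * (ennreal (real (\<rho> k)) * f \<rho>) \<partial>count_space I) \<partial>Q r q)"
    by (intro nn_integral_cong) (simp add: pdim_nn_integral I nn_integral_multc[symmetric] mult.assoc)
  also have "\<dots> = (\<integral>\<^sup>+k. (\<integral>\<^sup>+\<rho>. ennreal (real (irr_dim r k)) * (ennreal (real (\<rho> k)) * f \<rho>) \<partial>Q r q) \<partial>count_space I)"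
    using countable_subset[OF I countable_weights] by (intro nn_integral_count_space_nn_integral) auto
  finally show ?thesis by (simp add: nn_integral_cmult)
qed

lemma nn_integral_pdim:
  assumes I: "I \<subseteq> weights r"
  shows "(\<integral>\<^sup>+\<rho>. ennreal (pdim r I \<rho>) \<partial>Q r q) = ennreal (infsum (gmean (irr_dim r) q) I)"
proof -
  interpret prob_space "Q r q" by (rule prob_space_Q)
  have "(\<integral>\<^sup>+\<rho>. ennreal (pdim r I \<rho>) \<partial>Q r q) = (\<integral>\<^sup>+k. ennreal (gmean (irr_dim r) q k) \<partial>count_space I)"
  proof -
    have "ennreal (real (irr_dim r k)) * (\<integral>\<^sup>+\<rho>. ennreal (real (\<rho> k)) * 1 \<partial>Q r q) = ennreal (gmean (irr_dim r) q k)" if "k \<in> I" for k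
    proof -
      have k: "k \<in> weights r" using that I by auto
      define x where "x = q ^ irr_dim r k"
      have x: "0 < x" "x < 1" using irr_power_bounds[OF k] by (auto simp: x_def)
      have s: "(\<lambda>j. x * x ^ j) sums (x * (1 / (1 - x)))" using x by (intro sums_mult geometric_sums) auto
      have "(\<integral>\<^sup>+\<rho>. ennreal (real (\<rho> k)) * 1 \<partial>Q r q) = (\<Sum>j. ennreal (x ^ Suc j))"
        unfolding nn_integral_Q_multiplicity[OF k] by (simp add: x_def emeasure_space_1 del: space_Q power_Suc)
      also have "\<dots> = ennreal (x / (1 - x))" using s x by (intro suminf_ennreal_eq) auto
      finally show ?thesis using x by (simp add: gmean_def x_def[symmetric] ennreal_mult[symmetric])
    qed
    then have "(\<integral>\<^sup>+k. ennreal (real (irr_dim r k)) * (\<integral>\<^sup>+\<rho>. ennreal (real (\<rho> k)) * 1 \<partial>Q r q) \<partial>count_space I) =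
        (\<integral>\<^sup>+k. ennreal (gmean (irr_dim r) q k) \<partial>count_space I)"
      by (intro nn_integral_cong) simp
    then show ?thesis using nn_integral_pdim_times[OF I, of "\<lambda>_. 1"] by simp
  qed
  also have "\<dots> = ennreal (infsum (gmean (irr_dim r) q) I)"
    by (intro nn_integral_count_space_infsum summable_cumulants_q I gmean_nonneg q)
  finally show ?thesis .
qed

text \<open>
  Apply the multiplicity formula to \<open>f = pdim r I\<close>: shifting by \<open>j\<close> copies of \<open>k\<close> adds \<open>a(k) j\<close>, so the \<open>k\<close>-th term is
  the product of the means plus the variance contributed by \<open>k\<close>.
\<close>

lemma nn_integral_pdim_square:
  assumes I: "I \<subseteq> weights r"
  shows "(\<integral>\<^sup>+\<rho>. ennreal ((pdim r I \<rho>)\<^sup>2) \<partial>Q r q) =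
     ennreal ((infsum (gmean (irr_dim r) q) I)\<^sup>2 + infsum (gvar (irr_dim r) q) I)"
proof -
  interpret prob_space "Q r q" by (rule prob_space_Q)
  let ?\<mu> = "infsum (gmean (irr_dim r) q) I"
  have mu: "0 \<le> ?\<mu>" by (intro infsum_nonneg gmean_nonneg q)
  have in1: "ennreal (real (irr_dim r k)) * (\<integral>\<^sup>+\<rho>. ennreal (real (\<rho> k)) * ennreal (pdim r I \<rho>) \<partial>Q r q) =
      ennreal (?\<mu> * gmean (irr_dim r) q k + gvar (irr_dim r) q k)" if "k \<in> I" for k
  proof -
    have k: "k \<in> weights r" using that I by auto
    have "(\<integral>\<^sup>+\<rho>. ennreal (pdim r I (\<rho>(k := \<rho> k + Suc j))) \<partial>Q r q) = ennreal (?\<mu> + real (irr_dim r k) * real (Suc j))" for j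
    proof -
      have "(\<integral>\<^sup>+\<rho>. ennreal (pdim r I (\<rho>(k := \<rho> k + Suc j))) \<partial>Q r q) =
         (\<integral>\<^sup>+\<rho>. ennreal (pdim r I \<rho>) + ennreal (real (irr_dim r k) * real (Suc j)) \<partial>Q r q)"
        by (intro nn_integral_cong) (simp add: pdim_shift I that pdim_nonneg ennreal_plus[symmetric] del: ennreal_plus fun_upd_apply of_nat_Suc add_Suc_right)
      also have "\<dots> = ennreal ?\<mu> + ennreal (real (irr_dim r k) * real (Suc j))"
        by (subst nn_integral_add) (simp_all add: nn_integral_pdim[OF I] emeasure_space_1 del: space_Q of_nat_Suc)
      finally show ?thesis using mu by (simp add: ennreal_plus[symmetric] del: ennreal_plus of_nat_Suc)
    qed
    then have "(\<integral>\<^sup>+\<rho>. ennreal (real (\<rho> k)) * ennreal (pdim r I \<rho>) \<partial>Q r q) =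
       (\<Sum>j. ennreal ((q ^ irr_dim r k) ^ Suc j * (?\<mu> + real (irr_dim r k) * real (Suc j))))"
      unfolding nn_integral_Q_multiplicity[OF k] using mu q by (simp only:) (intro suminf_cong, subst ennreal_mult, auto)
    also have "\<dots> = ennreal (q ^ irr_dim r k / (1 - q ^ irr_dim r k) * ?\<mu> + real (irr_dim r k) * (q ^ irr_dim r k / (1 - q ^ irr_dim r k)\<^sup>2))"
      by (rule geometric_ennreal_sums[OF k mu])
    finally have e: "(\<integral>\<^sup>+\<rho>. ennreal (real (\<rho> k)) * ennreal (pdim r I \<rho>) \<partial>Q r q) = ennreal (q ^ irr_dim r k / (1 - q ^ irr_dim r k) * ?\<mu> + real (irr_dim r k) * (q ^ irr_dim r k / (1 - q ^ irr_dim r k)\<^sup>2))"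
      (is "_ = ennreal ?X") .
    have "0 \<le> ?X" using irr_power_bounds[OF k] mu by (intro add_nonneg_nonneg mult_nonneg_nonneg) auto
    then have "ennreal (real (irr_dim r k)) * ennreal ?X = ennreal (real (irr_dim r k) * ?X)" by (simp only: ennreal_mult of_nat_0_le_iff)
    also have "real (irr_dim r k) * ?X = ?\<mu> * gmean (irr_dim r) q k + gvar (irr_dim r) q k"
      unfolding gmean_def gvar_def distrib_left by (simp only: power2_eq_square[of "real (irr_dim r k)"] mult_ac)
    finally show ?thesis unfolding e .
  qed
  have "(\<integral>\<^sup>+\<rho>. ennreal ((pdim r I \<rho>)\<^sup>2) \<partial>Q r q) = (\<integral>\<^sup>+\<rho>. ennreal (pdim r I \<rho>) * ennreal (pdim r I \<rho>) \<partial>Q r q)"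
    by (intro nn_integral_cong) (simp add: power2_eq_square ennreal_mult pdim_nonneg I)
  also have "\<dots> = (\<integral>\<^sup>+k. ennreal (?\<mu> * gmean (irr_dim r) q k + gvar (irr_dim r) q k) \<partial>count_space I)"
    unfolding nn_integral_pdim_times[OF I] using in1 by (intro nn_integral_cong) auto
  also have "\<dots> = ennreal (infsum (\<lambda>k. ?\<mu> * gmean (irr_dim r) q k + gvar (irr_dim r) q k) I)"
    using summable_cumulants_q[OF I] mu
    by (intro nn_integral_count_space_infsum summable_on_add summable_on_cmult_right)
      (auto intro!: add_nonneg_nonneg mult_nonneg_nonneg gmean_nonneg gvar_nonneg q)
  also have "infsum (\<lambda>k. ?\<mu> * gmean (irr_dim r) q k + gvar (irr_dim r) q k) I = ?\<mu>\<^sup>2 + infsum (gvar (irr_dim r) q) I"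
    using summable_cumulants_q[OF I] by (subst infsum_add) (auto intro!: summable_on_cmult_right simp: infsum_cmult_right power2_eq_square)
  finally show ?thesis .
qed

lemma pdim_moments:
  assumes I: "I \<subseteq> weights r"
  shows "integrable (Q r q) (pdim r I)" "integrable (Q r q) (\<lambda>\<rho>. (pdim r I \<rho>)\<^sup>2)"
    "prob_space.expectation (Q r q) (pdim r I) = infsum (gmean (irr_dim r) q) I"
    "prob_space.variance (Q r q) (pdim r I) = infsum (gvar (irr_dim r) q) I"
proof -
  interpret prob_space "Q r q" by (rule prob_space_Q)
  have mu: "0 \<le> infsum (gmean (irr_dim r) q) I" by (intro infsum_nonneg gmean_nonneg q)
  have v: "0 \<le> infsum (gvar (irr_dim r) q) I" by (intro infsum_nonneg gvar_nonneg q)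
  have 1: "has_bochner_integral (Q r q) (pdim r I) (infsum (gmean (irr_dim r) q) I)"
    by (rule has_bochner_integral_nn_integral) (use mu in \<open>auto simp: nn_integral_pdim[OF I] pdim_nonneg I intro!: AE_I2\<close>)
  have 2: "has_bochner_integral (Q r q) (\<lambda>\<rho>. (pdim r I \<rho>)\<^sup>2) ((infsum (gmean (irr_dim r) q) I)\<^sup>2 + infsum (gvar (irr_dim r) q) I)"
    by (rule has_bochner_integral_nn_integral) (use v in \<open>auto simp: nn_integral_pdim_square[OF I]\<close>)
  show i: "integrable (Q r q) (pdim r I)" "integrable (Q r q) (\<lambda>\<rho>. (pdim r I \<rho>)\<^sup>2)"
    using 1 2 by (auto simp: has_bochner_integral_iff)
  show e: "expectation (pdim r I) = infsum (gmean (irr_dim r) q) I"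
    using 1 by (simp add: has_bochner_integral_iff)
  show "variance (pdim r I) = infsum (gvar (irr_dim r) q) I"
    using variance_eq[OF i] 2 e by (simp add: has_bochner_integral_iff)
qed

lemma level_weights: "{\<rho> \<in> reps r. rdim r \<rho> = real n} = level (irr_dim r) (weights r) n"
  by (auto simp: level_def rdim_eq) (auto simp: reps_def rdim_eq)

lemma finite_level_weights: "A \<subseteq> weights r \<Longrightarrow> finite (level (irr_dim r) A n)"
  by (rule finite_level_all[OF q _ summable_cumulants_q(1)]) (use irr_dim_ge_1_subset in auto)

lemma measure_dim_eq: "measure (Q r q) {\<rho> \<in> reps r. rdim r \<rho> = real n} = dim_prob (irr_dim r) q (weights r) (int n)"
proof -
  let ?L = "level (irr_dim r) (weights r) n"
  have L: "?L \<subseteq> reps r" by (auto simp: level_def reps_def)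
  have "emeasure (Q r q) ?L = (\<integral>\<^sup>+\<rho>. indicator ?L \<rho> \<partial>Q r q)" using L by simp
  also have "\<dots> = (\<integral>\<^sup>+\<rho>. ennreal (boltzmann_weight r q \<rho>) * indicator ?L \<rho> \<partial>count_space (reps r))"
    by (rule nn_integral_Q[OF q(1)])
  also have "\<dots> = (\<Sum>\<rho>\<in>?L. ennreal (boltzmann_weight r q \<rho>) * indicator ?L \<rho>)"
    using L finite_level_weights[OF order_refl] by (intro nn_integral_count_space') auto
  also have "\<dots> = (\<Sum>\<rho>\<in>?L. ennreal (q ^ n * norm_const (irr_dim r) q (weights r)))"
    by (intro sum.cong) (auto simp: boltzmann_weight_def level_def)
  also have "\<dots> = ennreal (dim_prob (irr_dim r) q (weights r) (int n))"
    using q norm_const_pos[OF order_refl] by (simp add: dim_prob_def ennreal_of_nat_eq_real_of_nat ennreal_mult[symmetric] mult_ac)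
  finally show ?thesis
    unfolding level_weights using q norm_const_pos[OF order_refl] by (simp add: measure_def dim_prob_def)
qed

text \<open>
  Summing out the weights outside \<open>I\<close> cancels their part of the normalising constant.
\<close>

lemma emeasure_law_Q:
  assumes I: "I \<subseteq> weights r" and B: "B \<subseteq> mults I"
  shows "emeasure (law I (Q r q)) B = (\<integral>\<^sup>+x. ennreal (norm_const (irr_dim r) q I * q ^ total_dim (irr_dim r) x) * indicator B x \<partial>count_space (mults I))"
proof -
  let ?A = "weights r - I"
  have WI: "weights r = I \<union> ?A" "I \<inter> ?A = {}" using I by auto
  have meas: "marginal I \<in> measurable (Q r q) (count_space (mults I))"
    by (rule measurable_marginal[OF I]) (auto simp: reps_def)
  have RR: "reps r = mults (I \<union> ?A)" using WI(1) by (simp add: reps_def)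
  have C: "norm_const (irr_dim r) q (weights r) = norm_const (irr_dim r) q I * norm_const (irr_dim r) q ?A"
    using norm_const_Un[OF q, of I ?A "irr_dim r"] WI summable_cumulants_q(1)[OF order_refl] irr_dim_ge_1 by auto
  have pos: "0 < norm_const (irr_dim r) q I" "0 < norm_const (irr_dim r) q ?A" using norm_const_pos I by auto
  have ZA: "(\<integral>\<^sup>+y. ennreal (q ^ total_dim (irr_dim r) y) \<partial>count_space (mults ?A)) = ennreal (1 / norm_const (irr_dim r) q ?A)"
    using boltzmann_sum_weights[of ?A] by (simp add: boltzmann_sum_def)
  have mI: "marginal I (\<lambda>k. x k + y k) = x" if "x \<in> mults I" "y \<in> mults ?A" for x y
    using that by (fastforce simp: marginal_def mults_def fun_eq_iff)
  have "emeasure (law I (Q r q)) B = emeasure (Q r q) (marginal I -` B \<inter> reps r)"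
    unfolding law_def using B by (subst emeasure_distr[OF meas]) auto
  also have "\<dots> = (\<integral>\<^sup>+\<rho>. indicator (marginal I -` B \<inter> reps r) \<rho> \<partial>Q r q)" by simp
  also have "\<dots> = (\<integral>\<^sup>+\<rho>. ennreal (boltzmann_weight r q \<rho>) * indicator (marginal I -` B \<inter> reps r) \<rho> \<partial>count_space (reps r))"
    by (rule nn_integral_Q[OF q(1)])
  also have "\<dots> = (\<integral>\<^sup>+\<rho>. ennreal (boltzmann_weight r q \<rho>) * indicator B (marginal I \<rho>) \<partial>count_space (mults (I \<union> ?A)))"
    unfolding RR by (intro nn_integral_cong) (auto simp: indicator_def)
  also have "\<dots> = (\<integral>\<^sup>+x. \<integral>\<^sup>+y. ennreal (norm_const (irr_dim r) q I * q ^ total_dim (irr_dim r) x) * indicator B x * (ennreal (norm_const (irr_dim r) q ?A) * ennreal (q ^ total_dim (irr_dim r) y)) \<partial>count_space (mults ?A) \<partial>count_space (mults I))"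
    unfolding nn_integral_mults_split[OF WI(2)]
  proof (intro nn_integral_cong)
    fix x y assume "x \<in> space (count_space (mults I))" "y \<in> space (count_space (mults ?A))"
    then have xy: "x \<in> mults I" "y \<in> mults ?A" by auto
    have "boltzmann_weight r q (\<lambda>k. x k + y k) = (norm_const (irr_dim r) q I * q ^ total_dim (irr_dim r) x) * (norm_const (irr_dim r) q ?A * q ^ total_dim (irr_dim r) y)"
      unfolding boltzmann_weight_def C by (simp add: total_dim_plus[OF xy] power_add mult_ac)
    then show "ennreal (boltzmann_weight r q (\<lambda>k. x k + y k)) * indicator B (marginal I (\<lambda>k. x k + y k)) =
       ennreal (norm_const (irr_dim r) q I * q ^ total_dim (irr_dim r) x) * indicator B x * (ennreal (norm_const (irr_dim r) q ?A) * ennreal (q ^ total_dim (irr_dim r) y))"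
      using pos q by (simp add: mI[OF xy] ennreal_mult mult_ac)
  qed
  also have "\<dots> = (\<integral>\<^sup>+x. ennreal (norm_const (irr_dim r) q I * q ^ total_dim (irr_dim r) x) * indicator B x \<partial>count_space (mults I))"
    using pos by (simp add: nn_integral_cmult ZA ennreal_mult[symmetric])
  finally show ?thesis .
qed

lemma card_level_marginal:
  assumes I: "I \<subseteq> weights r" and B: "B \<subseteq> mults I"
  shows "ennreal (real (card {\<rho> \<in> level (irr_dim r) (weights r) n. marginal I \<rho> \<in> B})) =
    (\<integral>\<^sup>+x. ennreal (if total_dim (irr_dim r) x \<le> n then real (card (level (irr_dim r) (weights r - I) (n - total_dim (irr_dim r) x))) else 0) * indicator B x \<partial>count_space (mults I))"
proof -
  let ?A = "weights r - I" and ?L = "level (irr_dim r) (weights r) n"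
  have WI: "weights r = I \<union> ?A" "I \<inter> ?A = {}" using I by auto
  have mI: "marginal I (\<lambda>k. x k + y k) = x" if "x \<in> mults I" "y \<in> mults ?A" for x y
    using that by (fastforce simp: marginal_def mults_def fun_eq_iff)
  let ?S = "{\<rho> \<in> ?L. marginal I \<rho> \<in> B}"
  have fin: "finite ?S" using finite_level_weights[OF order_refl, of n] by auto
  have sub: "?S \<subseteq> mults (I \<union> ?A)" using WI by (auto simp: level_def)
  have "ennreal (real (card ?S)) = (\<Sum>\<rho>\<in>?S. indicator ?S \<rho>)"
    by (simp add: ennreal_of_nat_eq_real_of_nat)
  also have "\<dots> = (\<integral>\<^sup>+\<rho>. indicator ?S \<rho> \<partial>count_space (mults (I \<union> ?A)))"
    using fin sub by (intro nn_integral_count_space'[symmetric]) auto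
  also have "\<dots> = (\<integral>\<^sup>+x. \<integral>\<^sup>+y. indicator ?S (\<lambda>k. x k + y k) \<partial>count_space (mults ?A) \<partial>count_space (mults I))"
    by (rule nn_integral_mults_split[OF WI(2)])
  also have "\<dots> = (\<integral>\<^sup>+x. ennreal (if total_dim (irr_dim r) x \<le> n then real (card (level (irr_dim r) ?A (n - total_dim (irr_dim r) x))) else 0) * indicator B x \<partial>count_space (mults I))"
  proof (intro nn_integral_cong)
    fix x assume "x \<in> space (count_space (mults I))"
    then have x: "x \<in> mults I" by simp
    let ?T = "if total_dim (irr_dim r) x \<le> n \<and> x \<in> B then level (irr_dim r) ?A (n - total_dim (irr_dim r) x) else {}"
    have finT: "finite ?T" using finite_level_weights[of ?A] by auto
    have eq: "indicator ?S (\<lambda>k. x k + y k) = (indicator ?T y :: ennreal)" if "y \<in> mults ?A" for y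
    proof -
      have "(\<lambda>k. x k + y k) \<in> ?S \<longleftrightarrow> y \<in> ?T"
        using mults_plus[OF x that] WI(1) total_dim_plus[OF x that, of "irr_dim r"] mI[OF x that] that
        by (auto simp: level_def)
      then show ?thesis by (simp add: indicator_def)
    qed
    have "(\<integral>\<^sup>+y. indicator ?S (\<lambda>k. x k + y k) \<partial>count_space (mults ?A)) = (\<integral>\<^sup>+y. indicator ?T y \<partial>count_space (mults ?A))"
      by (intro nn_integral_cong) (use eq in auto)
    also have "\<dots> = (\<Sum>y\<in>?T. indicator ?T y)"
      using finT by (intro nn_integral_count_space') (auto simp: level_def split: if_splits)
    also have "\<dots> = ennreal (real (card ?T))" by (simp add: ennreal_of_nat_eq_real_of_nat)
    finally show "(\<integral>\<^sup>+y. indicator ?S (\<lambda>k. x k + y k) \<partial>count_space (mults ?A)) =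
      ennreal (if total_dim (irr_dim r) x \<le> n then real (card (level (irr_dim r) ?A (n - total_dim (irr_dim r) x))) else 0) * indicator B x"
      by (auto simp: indicator_def)
  qed
  finally show ?thesis .
qed

end

section \<open>Comparison in total variation\<close>

text \<open>
  If \<open>N\<close> dominates \<open>\<theta> M\<close> on a set that carries most of \<open>M\<close>, then \<open>M B - N B\<close> is small for every \<open>B\<close>, and taking
  complements bounds the absolute value.
\<close>

lemma dTV_le:
  assumes M: "prob_space M" "sets M = Pow (mults I)" and N: "prob_space N" "sets N = Pow (mults I)"
    and G: "G \<subseteq> mults I" and \<theta>: "\<theta> \<le> 1"
    and dom: "\<And>B. B \<subseteq> G \<Longrightarrow> \<theta> * measure M B \<le> measure N B"
    and out: "measure M (mults I - G) \<le> \<kappa>"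
  shows "0 \<le> dTV I M N" "dTV I M N \<le> \<kappa> + (1 - \<theta>)"
proof -
  interpret M: prob_space M by fact
  interpret N: prob_space N by fact
  let ?X = "mults I"
  have sp: "space M = ?X" "space N = ?X"
    using sets_eq_imp_space_eq[of M "count_space ?X"] sets_eq_imp_space_eq[of N "count_space ?X"] M(2) N(2)
    by auto
  have one: "measure M B - measure N B \<le> \<kappa> + (1 - \<theta>)" if B: "B \<subseteq> ?X" for B
  proof -
    have "measure M B = measure M (B \<inter> G) + measure M (B - G)"
      using M(2) B G by (subst M.finite_measure_Union[symmetric]) (auto intro!: arg_cong[where f = "measure M"])
    moreover have "measure M (B - G) \<le> measure M (?X - G)"
      using M(2) B by (intro M.finite_measure_mono) auto
    moreover have "measure N (B \<inter> G) \<le> measure N B"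
      using N(2) B by (intro N.finite_measure_mono) auto
    moreover have "\<theta> * measure M (B \<inter> G) \<le> measure N (B \<inter> G)" by (rule dom) auto
    moreover have "(1 - \<theta>) * measure M (B \<inter> G) \<le> (1 - \<theta>) * 1"
      using \<theta> by (intro mult_left_mono) auto
    ultimately show ?thesis using out by (simp add: algebra_simps)
  qed
  have two: "\<bar>measure M B - measure N B\<bar> \<le> \<kappa> + (1 - \<theta>)" if B: "B \<subseteq> ?X" for B
  proof -
    have "measure M (?X - B) = 1 - measure M B" "measure N (?X - B) = 1 - measure N B"
      using M.prob_compl[of B] N.prob_compl[of B] B M(2) N(2) by (auto simp: sp)
    then have "measure N B - measure M B \<le> \<kappa> + (1 - \<theta>)" using one[of "?X - B"] by auto
    then show ?thesis using one[OF B] by linarith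
  qed
  show "dTV I M N \<le> \<kappa> + (1 - \<theta>)"
    unfolding dTV_def using two by (intro cSUP_least) auto
  have "\<bar>measure M {} - measure N {}\<bar> \<le> dTV I M N"
    unfolding dTV_def using two by (intro cSUP_upper bdd_aboveI[of _ "\<kappa> + (1 - \<theta>)"]) auto
  then show "0 \<le> dTV I M N" by simp
qed

context
  fixes r :: nat and q :: real
  assumes r: "2 \<le> r" and q: "0 < q" "q < 1"
begin

lemma P_eq_level: "P r n = uniform_count_measure (level (irr_dim r) (weights r) n)"
  unfolding P_def level_weights[OF r q] ..

lemma measurable_marginal_Q:
  "I \<subseteq> weights r \<Longrightarrow> marginal I \<in> measurable (Q r q) (count_space (mults I))"
  by (rule measurable_marginal[of I "weights r"]) (auto simp: reps_def)

lemma measurable_marginal_P: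
  "I \<subseteq> weights r \<Longrightarrow> marginal I \<in> measurable (P r n) (count_space (mults I))"
  by (rule measurable_marginal[of I "weights r"])
     (auto simp: P_eq_level sets_uniform_count_measure space_uniform_count_measure level_def)

lemma prob_space_law_Q: "I \<subseteq> weights r \<Longrightarrow> prob_space (law I (Q r q))"
  unfolding law_def
  by (rule prob_space.prob_space_distr[OF prob_space_Q[OF r q] measurable_marginal_Q])

text \<open>
  Pointwise, the density of the conditioned marginal relative to the Boltzmann marginal is the ratio of the two
  probabilities in the hypothesis.  If the dimension of \<open>x\<close> exceeds \<open>n\<close>, the hypothesis forces \<open>\<theta> = 0\<close>.
\<close>

lemma law_domination:
  assumes I: "I \<subseteq> weights r" and B: "B \<subseteq> mults I" and \<theta>: "0 \<le> \<theta>"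
    and pos: "0 < dim_prob (irr_dim r) q (weights r) (int n)"
    and dom: "\<And>x. x \<in> B \<Longrightarrow> \<theta> * dim_prob (irr_dim r) q (weights r) (int n) \<le> dim_prob (irr_dim r) q (weights r - I) (int n - int (total_dim (irr_dim r) x))"
  shows "\<theta> * measure (law I (Q r q)) B \<le> measure (law I (P r n)) B"
proof -
  let ?A = "weights r - I" and ?L = "level (irr_dim r) (weights r) n"
  let ?S = "{\<rho> \<in> ?L. marginal I \<rho> \<in> B}"
  have WI: "weights r = I \<union> ?A" "I \<inter> ?A = {}" using I by auto
  have Cp: "0 < norm_const (irr_dim r) q I" "0 < norm_const (irr_dim r) q ?A" "0 < norm_const (irr_dim r) q (weights r)" using norm_const_pos[OF r q] I by auto
  have C: "norm_const (irr_dim r) q (weights r) = norm_const (irr_dim r) q I * norm_const (irr_dim r) q ?A"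
    using norm_const_Un[OF q, of I ?A "irr_dim r"] WI summable_cumulants_q(1)[OF r q order_refl] irr_dim_ge_1 by auto
  have finL: "finite ?L" by (rule finite_level_weights[OF r q order_refl])
  have cL: "0 < card ?L" using pos by (cases "card ?L = 0") (auto simp: dim_prob_def)
  have pw: "norm_const (irr_dim r) q I * q ^ total_dim (irr_dim r) x * (\<theta> * real (card ?L)) \<le>
      (if total_dim (irr_dim r) x \<le> n then real (card (level (irr_dim r) ?A (n - total_dim (irr_dim r) x))) else 0)" if x: "x \<in> B" for x
  proof (cases "total_dim (irr_dim r) x \<le> n")
    case True
    then have n: "nat (int n - int (total_dim (irr_dim r) x)) = n - total_dim (irr_dim r) x" "\<not> int n - int (total_dim (irr_dim r) x) < 0" by auto
    let ?m = "n - total_dim (irr_dim r) x"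
    have "q ^ n = q ^ total_dim (irr_dim r) x * q ^ ?m" using True by (simp add: power_add[symmetric])
    then have "\<theta> * ((norm_const (irr_dim r) q I * norm_const (irr_dim r) q ?A) * (q ^ total_dim (irr_dim r) x * q ^ ?m) * real (card ?L)) \<le> norm_const (irr_dim r) q ?A * q ^ ?m * real (card (level (irr_dim r) ?A ?m))"
      using dom[OF x] n by (simp add: dim_prob_def C)
    then have "(norm_const (irr_dim r) q ?A * q ^ ?m) * (norm_const (irr_dim r) q I * q ^ total_dim (irr_dim r) x * (\<theta> * real (card ?L))) \<le> (norm_const (irr_dim r) q ?A * q ^ ?m) * real (card (level (irr_dim r) ?A ?m))"
      by (simp only: mult_ac)
    moreover have "0 < norm_const (irr_dim r) q ?A * q ^ ?m" using Cp q by simp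
    ultimately show ?thesis using True by (simp only: mult_le_cancel_left_pos if_True)
  next
    case False
    then have "dim_prob (irr_dim r) q ?A (int n - int (total_dim (irr_dim r) x)) = 0" by (simp add: dim_prob_def)
    then have "\<theta> * dim_prob (irr_dim r) q (weights r) (int n) \<le> 0" using dom[OF x] by simp
    then have "\<theta> = 0" using pos \<theta> by (auto simp: mult_le_0_iff)
    then show ?thesis using False by simp
  qed
  have eS: "emeasure (law I (Q r q)) B * ennreal (\<theta> * real (card ?L)) \<le> ennreal (real (card ?S))"
  proof -
    have "emeasure (law I (Q r q)) B * ennreal (\<theta> * real (card ?L)) =
       (\<integral>\<^sup>+x. ennreal (norm_const (irr_dim r) q I * q ^ total_dim (irr_dim r) x) * indicator B x * ennreal (\<theta> * real (card ?L)) \<partial>count_space (mults I))"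
      unfolding emeasure_law_Q[OF r q I B] by (rule nn_integral_multc[symmetric]) simp
    also have "\<dots> \<le> (\<integral>\<^sup>+x. ennreal (if total_dim (irr_dim r) x \<le> n then real (card (level (irr_dim r) ?A (n - total_dim (irr_dim r) x))) else 0) * indicator B x \<partial>count_space (mults I))"
    proof (intro nn_integral_mono)
      fix x
      show "ennreal (norm_const (irr_dim r) q I * q ^ total_dim (irr_dim r) x) * indicator B x * ennreal (\<theta> * real (card ?L)) \<le>
        ennreal (if total_dim (irr_dim r) x \<le> n then real (card (level (irr_dim r) ?A (n - total_dim (irr_dim r) x))) else 0) * indicator B x"
      proof (cases "x \<in> B")
        case True
        have "ennreal (norm_const (irr_dim r) q I * q ^ total_dim (irr_dim r) x) * ennreal (\<theta> * real (card ?L)) = ennreal (norm_const (irr_dim r) q I * q ^ total_dim (irr_dim r) x * (\<theta> * real (card ?L)))"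
          using Cp q \<theta> by (intro ennreal_mult[symmetric]) auto
        also have "\<dots> \<le> ennreal (if total_dim (irr_dim r) x \<le> n then real (card (level (irr_dim r) ?A (n - total_dim (irr_dim r) x))) else 0)"
          by (rule ennreal_leI[OF pw[OF True]])
        finally show ?thesis using True by simp
      qed simp
    qed
    also have "\<dots> = ennreal (real (card ?S))" by (rule card_level_marginal[OF r q I B, symmetric])
    finally show ?thesis .
  qed
  interpret LQ: prob_space "law I (Q r q)" by (rule prob_space_law_Q[OF I])
  have "ennreal (measure (law I (Q r q)) B * (\<theta> * real (card ?L))) \<le> ennreal (real (card ?S))"
    using eS unfolding LQ.emeasure_eq_measure using \<theta> by (subst ennreal_mult) auto
  then have 1: "measure (law I (Q r q)) B * (\<theta> * real (card ?L)) \<le> real (card ?S)" by (simp add: ennreal_le_iff)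
  have "measure (law I (P r n)) B = measure (uniform_count_measure ?L) (marginal I -` B \<inter> ?L)"
    unfolding law_def using B
    by (subst measure_distr[OF measurable_marginal_P[OF I]]) (auto simp: P_eq_level space_uniform_count_measure)
  also have "marginal I -` B \<inter> ?L = ?S" by auto
  also have "measure (uniform_count_measure ?L) ?S = real (card ?S) / real (card ?L)"
    using finL by (subst measure_uniform_count_measure) auto
  finally have "measure (law I (P r n)) B = real (card ?S) / real (card ?L)" .
  moreover have "\<theta> * measure (law I (Q r q)) B * real (card ?L) \<le> real (card ?S)" using 1 by (simp only: mult_ac)
  ultimately show ?thesis using cL by (simp add: pos_le_divide_eq)
qed

lemma law_tail_bound:
  assumes I: "I \<subseteq> weights r" and e: "0 < e"
  shows "measure (law I (Q r q)) {x \<in> mults I. e \<le> \<bar>real (total_dim (irr_dim r) x) - infsum (gmean (irr_dim r) q) I\<bar>} \<le> infsum (gvar (irr_dim r) q) I / e\<^sup>2"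
proof -
  interpret prob_space "Q r q" by (rule prob_space_Q[OF r q])
  note mom = pdim_moments[OF r q I]
  have "measure (law I (Q r q)) {x \<in> mults I. e \<le> \<bar>real (total_dim (irr_dim r) x) - infsum (gmean (irr_dim r) q) I\<bar>} =
    prob (marginal I -` {x \<in> mults I. e \<le> \<bar>real (total_dim (irr_dim r) x) - infsum (gmean (irr_dim r) q) I\<bar>} \<inter> space (Q r q))"
    unfolding law_def by (rule measure_distr[OF measurable_marginal_Q[OF I]]) auto
  also have "\<dots> = prob {\<rho> \<in> space (Q r q). e \<le> \<bar>pdim r I \<rho> - expectation (pdim r I)\<bar>}"
    unfolding mom(3) using marginal_mults[of _ "weights r" I] I
    by (intro arg_cong[where f = prob]) (auto simp: pdim_eq reps_def Int_absorb1)
  also have "\<dots> \<le> variance (pdim r I) / e\<^sup>2"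
    by (rule Chebyshev_inequality[OF _ mom(2) e]) simp
  finally show ?thesis unfolding mom(4) .
qed

lemma dTV_law_le:
  assumes I: "I \<subseteq> weights r" and e: "0 < e" and \<theta>: "0 \<le> \<theta>" "\<theta> \<le> 1"
    and pos: "0 < dim_prob (irr_dim r) q (weights r) (int n)"
    and dom: "\<And>j. \<bar>real j - infsum (gmean (irr_dim r) q) I\<bar> < e \<Longrightarrow>
       \<theta> * dim_prob (irr_dim r) q (weights r) (int n) \<le> dim_prob (irr_dim r) q (weights r - I) (int n - int j)"
  shows "0 \<le> dTV I (law I (Q r q)) (law I (P r n))"
    "dTV I (law I (Q r q)) (law I (P r n)) \<le> infsum (gvar (irr_dim r) q) I / e\<^sup>2 + (1 - \<theta>)"
proof -
  let ?L = "level (irr_dim r) (weights r) n"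
  have finL: "finite ?L" by (rule finite_level_weights[OF r q order_refl])
  have "0 < card ?L" using pos by (cases "card ?L = 0") (auto simp: dim_prob_def)
  then have Lne: "?L \<noteq> {}" by auto
  have M: "prob_space (law I (Q r q))" by (rule prob_space_law_Q[OF I])
  have N: "prob_space (law I (P r n))"
    unfolding law_def
    by (rule prob_space.prob_space_distr[OF _ measurable_marginal_P[OF I]])
       (simp add: P_eq_level prob_space_uniform_count_measure finL Lne)
  let ?G = "{x \<in> mults I. \<bar>real (total_dim (irr_dim r) x) - infsum (gmean (irr_dim r) q) I\<bar> < e}"
  have out: "measure (law I (Q r q)) (mults I - ?G) \<le> infsum (gvar (irr_dim r) q) I / e\<^sup>2"
  proof -
    have "mults I - ?G = {x \<in> mults I. e \<le> \<bar>real (total_dim (irr_dim r) x) - infsum (gmean (irr_dim r) q) I\<bar>}" by auto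
    then show ?thesis using law_tail_bound[OF I e] by simp
  qed
  have dm: "\<theta> * measure (law I (Q r q)) B \<le> measure (law I (P r n)) B" if "B \<subseteq> ?G" for B
    by (rule law_domination[OF I _ \<theta>(1) pos dom]) (use that in auto)
  have sets: "sets (law I X) = Pow (mults I)" for X by (simp add: law_def)
  show "0 \<le> dTV I (law I (Q r q)) (law I (P r n))"
    by (rule dTV_le(1)[OF M sets N sets _ \<theta>(2) dm out]) auto
  show "dTV I (law I (Q r q)) (law I (P r n)) \<le> infsum (gvar (irr_dim r) q) I / e\<^sup>2 + (1 - \<theta>)"
    by (rule dTV_le(2)[OF M sets N sets _ \<theta>(2) dm out]) auto
qed

end

section \<open>The parameter with prescribed mean dimension\<close>

definition mean_dim :: "nat \<Rightarrow> real \<Rightarrow> real" where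
  "mean_dim r q = infsum (gmean (irr_dim r) q) (weights r)"

lemma gmean_mono:
  assumes "0 < q" "q \<le> q'" "q' < 1" "1 \<le> a k"
  shows "gmean a q k \<le> gmean a q' k"
proof -
  have "q ^ a k \<le> q' ^ a k" using assms by (intro power_mono) auto
  moreover have "q' ^ a k < 1" using assms by (simp add: power_less_one_iff)
  ultimately have "q ^ a k / (1 - q ^ a k) \<le> q' ^ a k / (1 - q' ^ a k)"
    using assms by (intro frac_le) auto
  then show ?thesis unfolding gmean_def by (intro mult_left_mono) auto
qed

lemma gmean_strict_mono:
  assumes "0 < q" "q < q'" "q' < 1" "1 \<le> a k"
  shows "gmean a q k < gmean a q' k"
proof -
  have "q ^ a k < q' ^ a k" using assms by (intro power_strict_mono) auto
  moreover have "q' ^ a k < 1" using assms by (simp add: power_less_one_iff)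
  ultimately have "q ^ a k / (1 - q ^ a k) < q' ^ a k / (1 - q' ^ a k)"
    using assms by (intro frac_less) auto
  then show ?thesis unfolding gmean_def using assms by (intro mult_strict_left_mono) auto
qed

text \<open>
  A single weight whose contribution makes the mean dimension strictly increasing and
  unbounded.
\<close>

definition all_ones :: "nat \<Rightarrow> nat \<Rightarrow> nat" where "all_ones r = (\<lambda>i\<in>{1..r}. 1)"

lemma all_ones_in_weights: "all_ones r \<in> weights r"
  by (auto simp: all_ones_def weights_def)

context
  fixes r :: nat
  assumes r: "2 \<le> r"
begin

lemma mean_dim_strict_mono:
  assumes "0 < q" "q < q'" "q' < 1"
  shows "mean_dim r q < mean_dim r q'"
proof -
  have s: "gmean (irr_dim r) q summable_on weights r" "gmean (irr_dim r) q' summable_on weights r"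
    using summable_cumulants_q(1)[OF r _ _ order_refl] assms by auto
  have nn: "0 \<le> gmean (irr_dim r) q' k - gmean (irr_dim r) q k" if "k \<in> weights r" for k
    using gmean_mono[of q q' "irr_dim r" k] assms irr_dim_ge_1[OF that] by simp
  have "0 < gmean (irr_dim r) q' (all_ones r) - gmean (irr_dim r) q (all_ones r)"
    using gmean_strict_mono[of q q' "irr_dim r" "all_ones r"] assms irr_dim_ge_1[OF all_ones_in_weights] by simp
  also have "\<dots> \<le> infsum (\<lambda>k. gmean (irr_dim r) q' k - gmean (irr_dim r) q k) (weights r)"
  proof -
    have "(\<lambda>k. gmean (irr_dim r) q' k - gmean (irr_dim r) q k) summable_on weights r"
      using summable_on_add[OF s(2) iffD2[OF summable_on_uminus s(1)]] by simp
    then have "(\<Sum>k\<in>{all_ones r}. gmean (irr_dim r) q' k - gmean (irr_dim r) q k) \<le> infsum (\<lambda>k. gmean (irr_dim r) q' k - gmean (irr_dim r) q k) (weights r)"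
      by (rule finite_sum_le_infsum) (use nn all_ones_in_weights in auto)
    then show ?thesis by simp
  qed
  also have "\<dots> = mean_dim r q' - mean_dim r q"
    unfolding mean_dim_def using infsum_add[OF s(2) iffD2[OF summable_on_uminus s(1)]] by (simp add: infsum_uminus)
  finally show ?thesis by simp
qed

text \<open>
  Uniform convergence of the defining sum, dominated by its terms at the right end point.
\<close>

lemma mean_dim_continuous:
  assumes "0 < c" "b < 1"
  shows "continuous_on {c..b} (mean_dim r)"
proof (cases "c \<le> b")
  case True
  have ul: "uniform_limit {c..b} (\<lambda>F q. \<Sum>k\<in>F. gmean (irr_dim r) q k) (\<lambda>q. infsum (\<lambda>k. gmean (irr_dim r) q k) (weights r)) (finite_subsets_at_top (weights r))"
  proof (rule Weierstrass_m_test_general)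
    show "gmean (irr_dim r) b summable_on weights r"
      using summable_cumulants_q(1)[OF r _ _ order_refl] assms True by auto
    show "norm (gmean (irr_dim r) q k) \<le> gmean (irr_dim r) b k" if "k \<in> weights r" "q \<in> {c..b}" for k q
      using gmean_mono[of q b "irr_dim r" k] gmean_nonneg[of q "irr_dim r" k] that assms irr_dim_ge_1[OF that(1)] by auto
  qed
  have cont: "\<forall>\<^sub>F F in finite_subsets_at_top (weights r). continuous_on {c..b} (\<lambda>q. \<Sum>k\<in>F. gmean (irr_dim r) q k)"
  proof (rule eventually_finite_subsets_at_top_weakI)
    fix F assume F: "finite F" "F \<subseteq> weights r"
    have "1 - q ^ irr_dim r k \<noteq> 0" if "q \<in> {c..b}" "k \<in> F" for q k
    proof -
      have "q ^ irr_dim r k < 1" using that assms F irr_dim_ge_1[of k r] by (auto simp: power_less_one_iff subset_iff)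
      then show ?thesis by simp
    qed
    then show "continuous_on {c..b} (\<lambda>q. \<Sum>k\<in>F. gmean (irr_dim r) q k)"
      unfolding gmean_def by (intro continuous_intros) auto
  qed
  have "continuous_on {c..b} (\<lambda>q. infsum (\<lambda>k. gmean (irr_dim r) q k) (weights r))"
    by (rule uniform_limit_theorem[OF cont ul]) simp
  then show ?thesis by (simp add: mean_dim_def[abs_def])
qed simp

lemma mean_dim_small:
  assumes "0 < q" "q \<le> 1 / 2"
  shows "mean_dim r q \<le> 2 * q * mean_dim r (1 / 2)"
proof -
  have s: "gmean (irr_dim r) q summable_on weights r" "gmean (irr_dim r) (1/2) summable_on weights r"
    using summable_cumulants_q(1)[OF r _ _ order_refl] assms by auto
  have "gmean (irr_dim r) q k \<le> (2 * q) * gmean (irr_dim r) (1 / 2) k" if k: "k \<in> weights r" for k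
  proof -
    have a: "1 \<le> irr_dim r k" using irr_dim_ge_1[OF k] .
    have "(2 * q * (1 / 2)) ^ irr_dim r k = (2 * q) ^ irr_dim r k * (1 / 2) ^ irr_dim r k" by (rule power_mult_distrib)
    moreover have "2 * q * (1 / 2) = q" by simp
    ultimately have "q ^ irr_dim r k = (2 * q) ^ irr_dim r k * (1 / 2) ^ irr_dim r k" by (simp only:)
    also have "\<dots> \<le> (2 * q) ^ 1 * (1 / 2) ^ irr_dim r k"
      using assms a by (intro mult_right_mono power_decreasing) auto
    finally have 1: "q ^ irr_dim r k \<le> (2 * q) * (1 / 2) ^ irr_dim r k" by simp
    have "q ^ irr_dim r k \<le> (1 / 2) ^ irr_dim r k" using assms by (intro power_mono) auto
    moreover have "(1 / 2 :: real) ^ irr_dim r k < 1" using a by (simp add: power_less_one_iff)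
    ultimately have "q ^ irr_dim r k / (1 - q ^ irr_dim r k) \<le> ((2 * q) * (1 / 2) ^ irr_dim r k) / (1 - (1 / 2) ^ irr_dim r k)"
      using 1 assms by (intro frac_le) auto
    then have "real (irr_dim r k) * (q ^ irr_dim r k / (1 - q ^ irr_dim r k)) \<le> real (irr_dim r k) * (((2 * q) * (1 / 2) ^ irr_dim r k) / (1 - (1 / 2) ^ irr_dim r k))"
      by (rule mult_left_mono) simp
    also have "\<dots> = (2 * q) * (real (irr_dim r k) * ((1 / 2) ^ irr_dim r k / (1 - (1 / 2) ^ irr_dim r k)))"
      by (simp only: mult_ac times_divide_eq_right)
    finally show ?thesis unfolding gmean_def .
  qed
  then have "mean_dim r q \<le> infsum (\<lambda>k. (2 * q) * gmean (irr_dim r) (1 / 2) k) (weights r)"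
    unfolding mean_dim_def using s by (intro infsum_mono summable_on_cmult_right) auto
  then show ?thesis by (simp add: mean_dim_def infsum_cmult_right s)
qed

lemma mean_dim_large: "\<exists>q. 1 / 2 \<le> q \<and> q < 1 \<and> real n \<le> mean_dim r q"
proof -
  define a where "a = irr_dim r (all_ones r)"
  have a: "1 \<le> a" unfolding a_def by (rule irr_dim_ge_1[OF all_ones_in_weights])
  \<comment> \<open>Then \<open>y / (1 - y) = n + 1\<close>.\<close>
  define y where "y = real (n + 1) / real (n + 2)"
  have y: "0 < y" "y < 1" by (auto simp: y_def)
  define q where "q = root a y"
  have qa: "q ^ a = y" unfolding q_def using a y by (intro real_root_pow_pos2) auto
  have q: "0 < q" "q < 1" using a y by (auto simp: q_def)
  have "y / (1 - y) = real (n + 1)" by (simp add: y_def field_simps)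
  then have "real n \<le> gmean (irr_dim r) q (all_ones r)"
    unfolding gmean_def a_def[symmetric] qa using a mult_mono[of 1 "real a" "real n" "real (n + 1)"] by simp
  also have "\<dots> \<le> mean_dim r q"
  proof -
    have "sum (gmean (irr_dim r) q) {all_ones r} \<le> mean_dim r q"
      unfolding mean_dim_def
      by (rule finite_sum_le_infsum[OF summable_cumulants_q(1)[OF r q order_refl]]) (use all_ones_in_weights gmean_nonneg[OF q] in auto)
    then show ?thesis by simp
  qed
  finally have 1: "real n \<le> mean_dim r q" .
  show ?thesis
  proof (cases "1 / 2 \<le> q")
    case True
    then show ?thesis using 1 q by auto
  next
    case False
    then have "mean_dim r q < mean_dim r (1 / 2)" using q by (intro mean_dim_strict_mono) auto
    then show ?thesis using 1 by (intro exI[of _ "1 / 2"]) auto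
  qed
qed

text \<open>
  The intermediate value theorem gives existence and strict monotonicity uniqueness, so that the
  definite description in \<open>qn\<close> is meaningful.
\<close>

lemma qn_props:
  assumes n: "1 \<le> n"
  shows "0 < qn r n" "qn r n < 1" "mean_dim r (qn r n) = real n"
proof -
  have ex: "prob_space.expectation (Q r q) (rdim r) = mean_dim r q" if "0 < q" "q < 1" for q
    using pdim_moments(3)[OF r that order_refl] by (simp add: mean_dim_def rdim_def[abs_def])
  have m0: "0 \<le> mean_dim r (1 / 2)" unfolding mean_dim_def by (intro infsum_nonneg gmean_nonneg) auto
  \<comment> \<open>Small enough for the linear bound near zero to give a mean dimension of at most one.\<close>
  define c where "c = 1 / (2 * (mean_dim r (1 / 2) + 1))"
  have c: "0 < c" "c \<le> 1 / 2" using m0 by (auto simp: c_def field_simps)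
  have "mean_dim r c \<le> 2 * c * mean_dim r (1 / 2)" by (rule mean_dim_small[OF c])
  also have "\<dots> \<le> 1" using m0 by (simp add: c_def field_simps)
  finally have mc: "mean_dim r c \<le> real n" using n by linarith
  obtain b where b: "1 / 2 \<le> b" "b < 1" "real n \<le> mean_dim r b" using mean_dim_large by blast
  have "\<exists>q\<ge>c. q \<le> b \<and> mean_dim r q = real n"
    using mc b c by (intro IVT' mean_dim_continuous) auto
  then obtain q where q: "c \<le> q" "q \<le> b" "mean_dim r q = real n" by blast
  have "\<exists>!q. 0 < q \<and> q < 1 \<and> prob_space.expectation (Q r q) (rdim r) = real n"
  proof (rule ex1I[of _ q])
    show "0 < q \<and> q < 1 \<and> prob_space.expectation (Q r q) (rdim r) = real n"
      using q b c ex[of q] by auto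
    fix q' assume q': "0 < q' \<and> q' < 1 \<and> prob_space.expectation (Q r q') (rdim r) = real n"
    then have "mean_dim r q' = mean_dim r q" using ex[of q'] q by auto
    then show "q' = q" using mean_dim_strict_mono[of q q'] mean_dim_strict_mono[of q' q] q' q b c
      by (cases q q' rule: linorder_cases) auto
  qed
  from theI'[OF this] have th: "0 < qn r n \<and> qn r n < 1 \<and> prob_space.expectation (Q r (qn r n)) (rdim r) = real n"
    unfolding qn_def .
  then show "0 < qn r n" "qn r n < 1" "mean_dim r (qn r n) = real n" using ex[of "qn r n"] by auto
qed

text \<open>
  The mean dimension at a fixed scale is finite, so a mean tending to infinity forces the scale to
  do so.
\<close>

lemma qn_scale:
  "\<exists>K. filterlim K at_top sequentially \<and> (\<forall>n\<ge>1. 0 < K n \<and> qn r n = scaled_q r (K n))"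
proof -
  have "\<forall>n. \<exists>K. 1 \<le> n \<longrightarrow> 0 < K \<and> qn r n = scaled_q r K"
    using scaled_q_surj[of r] qn_props(1,2) r by (metis le_trans one_le_numeral)
  then obtain K where K: "\<And>n. 1 \<le> n \<Longrightarrow> 0 < K n \<and> qn r n = scaled_q r (K n)" by metis
  have "filterlim K at_top sequentially"
    unfolding filterlim_at_top_gt[where c = 0]
  proof (intro allI impI)
    fix L :: real assume L: "0 < L"
    have qL: "0 < scaled_q r L" "scaled_q r L < 1" using scaled_q_bounds[OF L] by auto
    obtain N :: nat where N: "mean_dim r (scaled_q r L) < real N" using reals_Archimedean2 by blast
    show "\<forall>\<^sub>F n in sequentially. L \<le> K n"
    proof (rule eventually_sequentiallyI[of "max 1 N"])
      fix n assume n: "max 1 N \<le> n"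
      then have n1: "1 \<le> n" by simp
      show "L \<le> K n"
      proof (rule ccontr)
        assume "\<not> L \<le> K n"
        then have KL: "0 < K n" "K n \<le> L" using K[OF n1] by auto
        then have "K n ^ wdeg r \<le> L ^ wdeg r" by (intro power_mono) auto
        then have "scaled_q r (K n) \<le> scaled_q r L" unfolding scaled_q_def using KL by (simp add: frac_le)
        then have "qn r n \<le> scaled_q r L" using K[OF n1] by simp
        then have "mean_dim r (qn r n) \<le> mean_dim r (scaled_q r L)"
          using mean_dim_strict_mono[of "qn r n" "scaled_q r L"] qn_props[OF n1] qL by (cases "qn r n = scaled_q r L") auto
        then show False using qn_props(3)[OF n1] N n by simp
      qed
    qed
  qed
  then show ?thesis using K by blast
qed

end

section \<open>The limit theorem\<close>

text \<open>
  The scale \<open>K n\<close> with \<open>qn r n = scaled_q r (K n)\<close> tends to infinity, and both claims follow from the uniform local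
  limit theorem: for all weights, and for the complement of \<open>I n\<close>.
\<close>

theorem proposition4p4:
  fixes r :: nat and I :: "nat \<Rightarrow> (nat \<Rightarrow> nat) set"
  assumes "r \<ge> 2"
    and "\<And>n. n \<ge> 1 \<Longrightarrow> I n \<subseteq> weights r"
    and "(\<lambda>n. prob_space.variance (Q r (qn r n)) (pdim r (I n))) \<in> o[sequentially](\<lambda>n. sigma2 r n)"
  shows "(\<lambda>n. dTV (I n) (law (I n) (Q r (qn r n))) (law (I n) (P r n))) \<longlonglongrightarrow> 0
    \<and> asymp_equiv (\<lambda>n. measure (Q r (qn r n)) {\<rho> \<in> reps r. rdim r \<rho> = real n}) sequentially
        (\<lambda>n. 1 / sqrt (2 * pi * sigma2 r n))"
proof -
  note r = assms(1)
  let ?R = "wdeg r"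
  obtain K where K: "filterlim K at_top sequentially" "\<And>n. 1 \<le> n \<Longrightarrow> 0 < K n \<and> qn r n = scaled_q r (K n)"
    using qn_scale[OF r] by blast
  obtain d c C where dcC: "d > 0" "c > 0" "C > 0" and
    llt0: "\<forall>K\<ge>1. \<forall>A. A \<subseteq> weights r \<longrightarrow>
     infsum (gvar (irr_dim r) (scaled_q r K)) (weights r - A) \<le> d * var_scale r K \<longrightarrow>
     c * var_scale r K \<le> infsum (gvar (irr_dim r) (scaled_q r K)) A \<and>
     (\<forall>m. \<bar>2 * pi * dim_prob (irr_dim r) (scaled_q r K) A m - gauss (infsum (gvar (irr_dim r) (scaled_q r K)) A) (real_of_int m - infsum (gmean (irr_dim r) (scaled_q r K)) A)\<bar>
        \<le> C / (K ^ ?R * K ^ r))"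
    using local_limit_uniform[OF r] by (elim exE conjE) (rule that)
  note llt = llt0[rule_format]
  obtain C2 where C2: "C2 > 0" "\<And>K. K > 0 \<Longrightarrow> infsum (gvar (irr_dim r) (scaled_q r K)) (weights r) \<le> C2 * var_scale r K"
    using infsum_gvar_le[OF r] by blast
  define s where "s n = infsum (gvar (irr_dim r) (qn r n)) (weights r)" for n
  define v where "v n = infsum (gvar (irr_dim r) (qn r n)) (I n)" for n
  define T where "T n = K n ^ (2 * ?R) * K n ^ r" for n
  define E where "E n = C / (K n ^ ?R * K n ^ r)" for n
  define g where "g n = sqrt (2 * pi / s n)" for n
  define p where "p n = dim_prob (irr_dim r) (qn r n) (weights r) (int n)" for n
  have ev1: "\<forall>\<^sub>F n in sequentially. 1 \<le> n \<and> 1 \<le> K n"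
    using K(1) by (auto simp: filterlim_at_top intro!: eventually_conj eventually_ge_at_top)
  have qn: "0 < qn r n" "qn r n < 1" "mean_dim r (qn r n) = real n" if "1 \<le> n" for n
    using qn_props[OF r that] by auto
  have sig: "sigma2 r n = s n" if "1 \<le> n" for n
    using pdim_moments(4)[OF r qn(1,2)[OF that] order_refl] by (simp add: sigma2_def s_def rdim_def[abs_def])
  have var: "prob_space.variance (Q r (qn r n)) (pdim r (I n)) = v n" if "1 \<le> n" for n
    using pdim_moments(4)[OF r qn(1,2)[OF that] assms(2)[OF that]] by (simp add: v_def)
  have prb: "measure (Q r (qn r n)) {\<rho> \<in> reps r. rdim r \<rho> = real n} = p n" if "1 \<le> n" for n
    using measure_dim_eq[OF r qn(1,2)[OF that]] by (simp add: p_def)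
  have v0: "0 \<le> v n" if "1 \<le> n" for n
    unfolding v_def by (intro infsum_nonneg gvar_nonneg qn that)
  have full: "c * T n \<le> s n" "s n \<le> C2 * T n" "\<bar>2 * pi * p n - g n\<bar> \<le> E n" "0 < s n" "0 < T n" if n: "1 \<le> n \<and> 1 \<le> K n" for n
  proof -
    have q: "qn r n = scaled_q r (K n)" using K(2) n by simp
    have T0: "0 < T n" using n by (simp add: T_def)
    then show "0 < T n" .
    have miss: "infsum (gvar (irr_dim r) (scaled_q r (K n))) (weights r - weights r) \<le> d * (K n ^ (2 * ?R) * K n ^ r)"
      using n dcC by simp
    note L = llt[OF _ order_refl miss]
    show "c * T n \<le> s n" using L n by (simp add: T_def s_def q)
    then show "0 < s n" using T0 dcC by (smt (verit) mult_pos_pos)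
    show "s n \<le> C2 * T n" using C2(2)[of "K n"] n by (simp add: T_def s_def q)
    have "infsum (gmean (irr_dim r) (scaled_q r (K n))) (weights r) = real n"
      using qn(3)[of n] n by (simp add: mean_dim_def q)
    then show "\<bar>2 * pi * p n - g n\<bar> \<le> E n"
      using L[THEN conjunct2, rule_format, of "int n"] n by (simp add: p_def g_def E_def s_def q gauss_def)
  qed
  have g0: "0 < g n" if "1 \<le> n \<and> 1 \<le> K n" for n using full(4)[OF that] by (simp add: g_def)
  \<comment> \<open>The error is small relative to the Gaussian peak: their quotient is of order \<open>K\<^bsup>- r/2\<^esup>\<close>.\<close>
  have e_lim: "(\<lambda>n. E n / g n) \<longlonglongrightarrow> 0"
  proof (rule tendsto_sandwich)
    show "(\<lambda>n. 0) \<longlonglongrightarrow> (0::real)" by simp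
    have "filterlim (\<lambda>n. sqrt (K n ^ r)) at_top sequentially"
      by (intro filterlim_compose[OF sqrt_at_top] filterlim_pow_at_top K) (use r in auto)
    then show "(\<lambda>n. sqrt C2 * C / sqrt (K n ^ r)) \<longlonglongrightarrow> 0"
      by (rule real_tendsto_divide_at_top[OF tendsto_const])
    show "\<forall>\<^sub>F n in sequentially. 0 \<le> E n / g n"
      using ev1 by eventually_elim (use dcC g0 in \<open>auto simp: E_def less_imp_le\<close>)
    show "\<forall>\<^sub>F n in sequentially. E n / g n \<le> sqrt C2 * C / sqrt (K n ^ r)"
      using ev1
    proof eventually_elim
      case (elim n)
      have K0: "0 < K n" using elim by simp
      have E0: "0 \<le> E n" using dcC K0 by (simp add: E_def)
      have "1 \<le> sqrt (2 * pi)" using pi_ge_two by simp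
      then have "1 / g n \<le> sqrt (s n)"
        using full(4)[OF elim] by (simp add: g_def real_sqrt_divide divide_le_eq)
      also have "\<dots> \<le> sqrt (C2 * T n)" using full(2)[OF elim] by simp
      also have "\<dots> = sqrt C2 * (K n ^ ?R * sqrt (K n ^ r))"
        using K0 by (simp add: T_def real_sqrt_mult power_mult real_sqrt_power[symmetric] mult.commute[of 2])
      finally have "E n * (1 / g n) \<le> E n * (sqrt C2 * (K n ^ ?R * sqrt (K n ^ r)))"
        using E0 by (rule mult_left_mono)
      also have "\<dots> = sqrt C2 * C * (sqrt (K n ^ r) / K n ^ r)" using K0 by (simp add: E_def)
      also have "sqrt (K n ^ r) / K n ^ r = 1 / sqrt (K n ^ r)"
        using K0 by (simp add: sqrt_divide_self_eq inverse_eq_divide)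
      finally show ?case by simp
    qed
  qed
  have lim1: "(\<lambda>n. 2 * pi * p n / g n) \<longlonglongrightarrow> 1"
  proof -
    have "\<forall>\<^sub>F n in sequentially. norm (2 * pi * p n / g n - 1) \<le> E n / g n"
      using ev1
    proof eventually_elim
      case (elim n)
      have "2 * pi * p n / g n - 1 = (2 * pi * p n - g n) / g n" using g0[OF elim] by (simp add: field_simps)
      then show ?case using full(3)[OF elim] g0[OF elim] by (simp add: divide_right_mono)
    qed
    from Lim_null_comparison[OF this e_lim] show ?thesis by (simp add: LIM_zero_iff)
  qed
  have second: "asymp_equiv (\<lambda>n. measure (Q r (qn r n)) {\<rho> \<in> reps r. rdim r \<rho> = real n}) sequentially
        (\<lambda>n. 1 / sqrt (2 * pi * sigma2 r n))"
  proof (rule asymp_equivI')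
    have "\<forall>\<^sub>F n in sequentially. 2 * pi * p n / g n =
       measure (Q r (qn r n)) {\<rho> \<in> reps r. rdim r \<rho> = real n} / (1 / sqrt (2 * pi * sigma2 r n))"
      using ev1
    proof eventually_elim
      case (elim n)
      have e: "2 * pi / g n = sqrt (2 * pi * s n)"
        using full(4)[OF elim] by (simp add: g_def real_sqrt_divide real_sqrt_mult field_simps)
      have "2 * pi * p n / g n = p n * (2 * pi / g n)" by (simp only: times_divide_eq_right mult_ac)
      also have "\<dots> = p n / (1 / sqrt (2 * pi * s n))" unfolding e by simp
      finally show ?case using elim by (simp only: prb sig)
    qed
    with lim1 show "(\<lambda>n. measure (Q r (qn r n)) {\<rho> \<in> reps r. rdim r \<rho> = real n} / (1 / sqrt (2 * pi * sigma2 r n))) \<longlonglongrightarrow> 1"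
      by (rule Lim_transform_eventually)
  qed
  have small: "\<forall>\<^sub>F n in sequentially. v n \<le> x * s n" if "0 < x" for x
    using landau_o.smallD[OF assms(3) that] ev1
  proof eventually_elim
    case (elim n)
    then show ?case using sig[of n] var[of n] v0[of n] full(4)[of n] by simp
  qed
  have first: "(\<lambda>n. dTV (I n) (law (I n) (Q r (qn r n))) (law (I n) (P r n))) \<longlonglongrightarrow> 0"
  proof (rule tendstoI)
    fix \<eta> :: real assume \<eta>: "0 < \<eta>"
    define \<delta> where "\<delta> = min (1 / 2) (\<eta> / 5)"
    have \<delta>: "0 < \<delta>" "\<delta> \<le> 1 / 2" "4 * \<delta> < \<eta>" using \<eta> by (auto simp: \<delta>_def)
    \<comment> \<open>The numerator loses \<open>\<delta>\<close> to the Gaussian factor and \<open>\<delta>\<close> to the error term; the denominator gains \<open>\<delta>\<close>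
      from the error term for the full dimension.\<close>
    define \<theta> where "\<theta> = (1 - 2 * \<delta>) / (1 + \<delta>)"
    have \<theta>: "0 \<le> \<theta>" "\<theta> \<le> 1" "1 - \<theta> \<le> 3 * \<delta>" using \<delta> by (auto simp: \<theta>_def field_simps)
    have "\<forall>\<^sub>F n in sequentially. E n / g n < \<delta>"
      using order_tendstoD(2)[OF e_lim \<delta>(1)] .
    moreover have "\<forall>\<^sub>F n in sequentially. v n \<le> \<delta>\<^sup>2 * s n"
      by (rule small) (use \<delta> in simp)
    moreover have "\<forall>\<^sub>F n in sequentially. v n \<le> (d / C2) * s n"
      by (rule small) (use dcC C2 in simp)
    moreover note ev1
    ultimately show "\<forall>\<^sub>F n in sequentially. dist (dTV (I n) (law (I n) (Q r (qn r n))) (law (I n) (P r n))) 0 < \<eta>"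
    proof eventually_elim
      case (elim n)
      then have n: "1 \<le> n \<and> 1 \<le> K n" by simp
      then have n1: "1 \<le> n" by simp
      have q: "qn r n = scaled_q r (K n)" using K(2) n by simp
      let ?W = "weights r" and ?I = "I n"
      let ?A = "?W - ?I"
      have I: "?I \<subseteq> ?W" by (rule assms(2)[OF n1])
      have WA: "?W - ?A = ?I" "?I \<union> ?A = ?W" "?I \<inter> ?A = {}" using I by auto
      note qq = qn(1,2)[OF n1]
      have s0: "0 < s n" by (rule full(4)[OF n])
      have mA: "infsum (gmean (irr_dim r) (qn r n)) ?A = real n - infsum (gmean (irr_dim r) (qn r n)) ?I"
        using infsum_Un_disjoint[OF summable_cumulants_q(1)[OF r qq I] summable_cumulants_q(1)[OF r qq, of ?A] WA(3)] qn(3)[OF n1]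
        unfolding WA(2) mean_dim_def by simp
      have vA: "infsum (gvar (irr_dim r) (qn r n)) ?A = s n - v n"
        using infsum_Un_disjoint[OF summable_cumulants_q(2)[OF r qq I] summable_cumulants_q(2)[OF r qq, of ?A] WA(3)]
        unfolding WA(2) s_def v_def by simp
      have "\<delta>\<^sup>2 \<le> (1 / 2)\<^sup>2" using \<delta> by (intro power_mono) auto
      then have d2: "\<delta>\<^sup>2 * s n \<le> s n / 2" using s0 by (simp add: power2_eq_square)
      define u where "u = s n - v n"
      have u: "0 < u" "s n / 2 \<le> u" "u \<le> s n" using elim(2) d2 s0 v0[OF n1] unfolding u_def by linarith+
      have "v n \<le> d * T n"
      proof -
        have "(d / C2) * s n \<le> (d / C2) * (C2 * T n)"
          using full(2)[OF n] dcC C2 by (intro mult_left_mono) auto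
        then show ?thesis using elim(3) C2 by simp
      qed
      then have miss: "infsum (gvar (irr_dim r) (scaled_q r (K n))) (?W - ?A) \<le> d * (K n ^ (2 * ?R) * K n ^ r)"
        unfolding WA(1) by (simp add: v_def T_def q)
      have lltA: "\<bar>2 * pi * dim_prob (irr_dim r) (qn r n) ?A m - sqrt (2 * pi / u) *
          exp (- (real_of_int m - (real n - infsum (gmean (irr_dim r) (qn r n)) ?I))\<^sup>2 / (2 * u))\<bar> \<le> E n" for m
        using llt[OF _ Diff_subset miss, THEN conjunct2, rule_format, of m] n mA vA by (simp add: E_def q u_def gauss_def)
      have Eg: "E n \<le> \<delta> * g n" using elim(1) g0[OF n] by (simp add: pos_divide_less_eq less_imp_le)
      have pu: "2 * pi * p n \<le> (1 + \<delta>) * g n" using full(3)[OF n] Eg by (simp add: algebra_simps)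
      have pl: "0 < p n"
      proof -
        have "(1 - \<delta>) * g n \<le> 2 * pi * p n" using full(3)[OF n] Eg by (simp add: algebra_simps)
        moreover have "0 < (1 - \<delta>) * g n" using \<delta> g0[OF n] by simp
        ultimately have "0 < 2 * pi * p n" by linarith
        then show ?thesis by (simp add: zero_less_mult_iff)
      qed
      \<comment> \<open>Narrow enough for the Gaussian factor to be at least \<open>1 - \<delta>\<close>, and wide enough for Chebyshev's
        inequality, because the variance of the part in \<open>I n\<close> is at most \<open>\<delta>\<^sup>2 s\<close>.\<close>
      define w where "w = sqrt \<delta> * sqrt (s n)"
      have w: "0 < w" "w\<^sup>2 = \<delta> * s n" using \<delta> s0 by (auto simp: w_def power_mult_distrib)
      have dom: "\<theta> * dim_prob (irr_dim r) (qn r n) ?W (int n) \<le> dim_prob (irr_dim r) (qn r n) ?A (int n - int j)"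
        if j: "\<bar>real j - infsum (gmean (irr_dim r) (qn r n)) ?I\<bar> < w" for j
      proof -
        let ?x = "real j - infsum (gmean (irr_dim r) (qn r n)) ?I"
        have "?x\<^sup>2 \<le> w\<^sup>2" using power_mono[of "\<bar>?x\<bar>" w 2] j by simp
        then have "?x\<^sup>2 / (2 * u) \<le> \<delta> * s n / (2 * u)" unfolding w(2) using u by (intro divide_right_mono) auto
        also have "\<dots> \<le> \<delta>"
        proof -
          have "\<delta> * s n \<le> \<delta> * (2 * u)" using u \<delta> by (intro mult_left_mono) auto
          then show ?thesis using u by (simp add: divide_le_eq)
        qed
        finally have "exp (- \<delta>) \<le> exp (- ?x\<^sup>2 / (2 * u))" by simp
        moreover have "1 - \<delta> \<le> exp (- \<delta>)" using exp_ge_add_one_self[of "- \<delta>"] by simp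
        ultimately have ex: "1 - \<delta> \<le> exp (- ?x\<^sup>2 / (2 * u))" by linarith
        have "g n \<le> sqrt (2 * pi / u)" unfolding g_def using u s0 by (intro real_sqrt_le_mono divide_left_mono) auto
        then have "g n * (1 - \<delta>) \<le> sqrt (2 * pi / u) * exp (- ?x\<^sup>2 / (2 * u))"
          using ex \<delta> u by (intro mult_mono) auto
        moreover have "(real_of_int (int n - int j) - (real n - infsum (gmean (irr_dim r) (qn r n)) ?I))\<^sup>2 = ?x\<^sup>2"
          by (simp add: power2_eq_square algebra_simps)
        ultimately have "(1 - 2 * \<delta>) * g n \<le> 2 * pi * dim_prob (irr_dim r) (qn r n) ?A (int n - int j)"
          using lltA[of "int n - int j"] Eg by (simp add: algebra_simps)
        moreover have "\<theta> * (2 * pi * p n) \<le> (1 - 2 * \<delta>) * g n"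
        proof -
          have "\<theta> * (2 * pi * p n) \<le> \<theta> * ((1 + \<delta>) * g n)" using pu \<theta> by (intro mult_left_mono) auto
          also have "\<dots> = (1 - 2 * \<delta>) * g n" using \<delta> by (simp add: \<theta>_def)
          finally show ?thesis .
        qed
        ultimately have "\<theta> * (2 * pi * p n) \<le> 2 * pi * dim_prob (irr_dim r) (qn r n) ?A (int n - int j)" by linarith
        moreover have "\<theta> * (2 * pi * p n) = 2 * pi * (\<theta> * p n)" by simp
        ultimately show ?thesis using mult_le_cancel_left_pos[of "2 * pi"] by (simp add: p_def)
      qed
      note D = dTV_law_le[OF r qq I w(1) \<theta>(1,2) pl[unfolded p_def] dom]
      have "infsum (gvar (irr_dim r) (qn r n)) ?I / w\<^sup>2 \<le> \<delta>"
        unfolding w(2) v_def[symmetric] using elim(2) \<delta> s0 by (simp add: divide_le_eq power2_eq_square mult.assoc)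
      then have "dTV ?I (law ?I (Q r (qn r n))) (law ?I (P r n)) < \<eta>"
        using D(2) \<theta>(3) \<delta>(3) by linarith
      then show ?case using D(1) by simp
    qed
  qed
  show ?thesis using first second by blast
qed

end
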